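(* Let $0<a\leq 1$ and let $N$ be an odd positive integer. Put $A_{N,j}(y):=\pi(2\pi y)^{\frac{1}{N}}e^{\frac{i\pi j}{N}}$. Then for $x>0$, \begin{align*} &\sum_{n=1}^{\infty}\frac{\exp(-an^{N}x)}{n(1-\exp(-n^{N}x))}\\ &=\frac{\zeta(N+1)}{x}+\frac{1}{N}\left(\left(\tfrac{1}{2}-a\right)\left((N-1)\gamma-\log x\right)+\log\Gamma(a)-\tfrac{1}{2}\log 2\pi\right)\\ &\quad+(-1)^{\frac{N+3}{2}}2^{N}\pi^{N+1}\sum_{j=1}^{\left\lfloor\frac{N+1}{2N}\right\rfloor}\left(\frac{-1}{4\pi^2}\right)^{jN}\frac{B_{2j}(a)B_{N+1-2jN}}{(2j)!(N+1-2jN)!}x^{2j-1}\\ &\quad+\frac{(-1)^{\frac{N+3}{2}}}{N}\sum_{j=-\frac{N-1}{2}}^{\frac{N-1}{2}}(-1)^j\bigg\{\sum_{n=1}^{\infty}\frac{\cos(2\pi na)}{n\left(\exp\left(2A_{N,j}\left(\frac{n}{x}\right)\right)-1\right)}\\ &\quad+\frac{(-1)^{j+\frac{N+1}{2}}}{\pi}\sum_{n=1}^{\infty}\frac{\sin(2\pi na)}{n}\left\{\log\left(\tfrac{1}{\pi}A_{N,j}\left(\tfrac{n}{x}\right)\right)-\tfrac{1}{2}\left(\psi\left(\tfrac{i}{\pi}A_{N,j}\left(\tfrac{n}{x}\right)\right)+\psi\left(-\tfrac{i}{\pi}A_{N,j}\left(\tfrac{n}{x}\right)\right)\right)\right\}\bigg\}.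 \end{align*} Equivalently, if $\alpha,\beta>0$ with $\alpha\beta^{N}=\pi^{N+1}$, then \begin{align*} &\sum_{n=1}^{\infty}\frac{\exp(-a(2n)^{N}\alpha)}{n(1-\exp(-(2n)^{N}\alpha))}-\frac{(-1)^{\frac{N+3}{2}}}{N}\sum_{j=-\frac{N-1}{2}}^{\frac{N-1}{2}}(-1)^{j}\bigg(\sum_{n=1}^{\infty}\frac{\cos(2\pi na)}{n\left(\exp\left((2n)^{\frac{1}{N}}\beta e^{\frac{i\pi j}{N}}\right)-1\right)}\\ &\quad+\frac{(-1)^{j+\frac{N+1}{2}}}{\pi}\sum_{n=1}^{\infty}\frac{\sin(2\pi na)}{n}\left\{\log\left(\tfrac{\beta}{2\pi}(2n)^{\frac{1}{N}}e^{\frac{i\pi j}{N}}\right)-\frac{1}{2}\left(\psi\left(\tfrac{i\beta}{2\pi}(2n)^{\frac{1}{N}}e^{\frac{i\pi j}{N}}\right)+\psi\left(\tfrac{-i\beta}{2\pi}(2n)^{\frac{1}{N}}e^{\frac{i\pi j}{N}}\right)\right)\right\}\bigg)\\ &=\frac{1}{N}\left((a-1)\log(2\pi)+\log\Gamma(a)\right)+\left(a-\frac{1}{2}\right)\left\{\frac{(N-1)(\log 2-\gamma)}{N}+\frac{\log(\alpha/\beta)}{N+1}\right\}\\ &\quad+(-1)^{\frac{N+3}{2}}\sum_{j=0}^{\left\lfloor\frac{N+1}{2N}\right\rfloor}\frac{(-1)^jB_{2j}(a)B_{N+1-2Nj}}{(2j)!(N+1-2Nj)!}\alpha^{\frac{2j}{N+1}}\beta^{N-\frac{2N^2j}{N+1}}.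 \end{align*}
   Context: $\gamma$ is Euler's constant, $\zeta$ the Riemann zeta function, $B_j(a)$ Bernoulli polynomials ($\sum_{j\ge0}B_j(a)z^j/j!=ze^{az}/(e^z-1)$), $B_j=B_j(1)$, $\psi=\Gamma'/\Gamma$ the digamma function, and $\log$ the principal branch. Sums over $j$ run through integers; empty sums are $0$. *)

theory Defs
  imports "HOL-Analysis.Analysis"
begin

text \<open>Bernoulli polynomials B_n(a), defined by the generating function
  sum_n B_n(a) z^n/n! = z e^(az)/(e^z - 1).  Comparing coefficients of z^(n+1)/(n+1)!
  in z e^(az) = (e^z - 1) * sum_j B_j(a) z^j/j! gives
  (n+1) a^n = sum_(j=0..n) binom(n+1,j) B_j(a), which is the recursion below.\<close>
fun bernpoly :: "nat \<Rightarrow> real \<Rightarrow> real" where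
  "bernpoly n a =
     (real (n + 1) * a ^ n - (\<Sum>j<n. real ((n + 1) choose j) * bernpoly j a)) / real (n + 1)"

definition zeta_nat :: "nat \<Rightarrow> real" where
  "zeta_nat s = (\<Sum>n. 1 / real (Suc n) ^ s)"

definition A_Nj :: "nat \<Rightarrow> int \<Rightarrow> real \<Rightarrow> complex" where
  "A_Nj N j y = complex_of_real (pi * (2 * pi * y) powr (1 / real N))
                 * exp (\<i> * complex_of_real (pi * real_of_int j / real N))"

end

theory Submission
  imports Defs
begin

text \<open>
  For \<open>t > 0\<close> the quotient \<open>exp (-a t) / (1 - exp (-t))\<close> equals \<open>1/t + 1/2 - a\<close> plus an absolutely
  convergent series over \<open>m \<ge> 1\<close> of rational functions of \<open>t\<close>, because that series is its Fourier series
  in \<open>a\<close>. Put \<open>t = n^N x\<close>, divide by \<open>n\<close> and sum over \<open>n\<close>. The double series over \<open>m\<close> and \<open>n\<close> is only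
  conditionally convergent, but it becomes absolutely convergent once the \<open>m\<close>-th summand is compared, on
  every interval \<open>[n - 1, n]\<close>, with its own integral; then the summations may be exchanged. For
  fixed \<open>m\<close> the sum over \<open>n\<close> splits into partial fractions over the \<open>2N\<close> roots of
  \<open>u^(2N) = -(2 \<pi> m / x)^2\<close> and is evaluated by the hyperbolic cotangent and the digamma function.

  The integrals add up to a quantity depending only on \<open>a\<close> and on the upper limit \<open>T\<close>, whose constant term
  as \<open>T\<close> tends to infinity is independent of \<open>N\<close> and \<open>x\<close>. For \<open>N = 1\<close> and \<open>x\<close> tending to \<open>0\<close>
  it is the constant term of \<open>-log (q^a; q)\<close> with \<open>q = exp (-x)\<close>, and the Bohr--Mollerup theorem identifies it
  as \<open>log \<Gamma>(a) - log (2 \<pi>) / 2\<close> (up to the Euler constant).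
\<close>

section \<open>Fourier series on the unit interval\<close>

text \<open>The integral is forced: for fixed \<open>m\<close> the sine part of the summand behaves
  like a multiple of \<open>1 / n\<close>, so the sum over \<open>n\<close> alone diverges
  logarithmically unless its coefficient vanishes. Under \<open>t = u ^ N * x\<close> one has
  \<open>du / u = dt / (N t)\<close>, so the integrals up to \<open>n = K\<close> amount to
  \<open>1 / N\<close> times a function of \<open>T = K ^ N * x\<close> alone; hence one constant
  serves all \<open>N\<close> and \<open>x\<close>.

  Oddness of \<open>N\<close> places the relevant roots on rays at angles \<open>pi * j / N\<close>
  with \<open>\<bar>j\<bar> < N / 2\<close>, strictly inside the right half-plane. There
  \<open>u^2 + z^2\<close> is bounded below by a multiple of \<open>u^2 + \<bar>z\<bar>^2\<close>,
  and principal logarithms have no branch jumps. A summand minus its integral is then of order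
  \<open>1 / (p^2 + r^2)\<close>, where \<open>p\<close> is the left endpoint and \<open>r\<close>,
  the modulus of the root, grows like \<open>m powr (1 / N)\<close>. Estimating this for
  \<open>p > 0\<close> by \<open>p powr - (3/2) * r powr - (1/2)\<close> trades decay in
  \<open>p\<close> for decay in \<open>m\<close>; with the prefactor \<open>1 / m\<close> this is
  absolutely summable.

  The finite Bernoulli sum over \<open>j \<ge> 1\<close> has a single term for \<open>N = 1\<close>
  and none otherwise. It comes from an alternating sum of reciprocals of the roots, which vanishes
  for \<open>N > 1\<close>.\<close>

lemma has_integral_0_times_cis_kernel:
  fixes h :: "real \<Rightarrow> real"
  assumes "\<And>m::int. ((\<lambda>x. of_real (h x) * cis (2 * pi * of_int m * x)) has_integral 0) {0..1}"
  shows "((\<lambda>x. of_real (h x * (c + cos (2 * pi * (x - p))) ^ k) * cis (2 * pi * of_int m * x))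
            has_integral 0) {0..1}"
proof (induction k arbitrary: m)
  case 0
  then show ?case using assms[of m] by simp
next
  case (Suc k)
  let ?T = "\<lambda>x. h x * (c + cos (2 * pi * (x - p))) ^ k"
  let ?e = "\<lambda>m x. cis (2 * pi * of_int m * x)"
  let ?S = "\<lambda>x. of_real c * (of_real (?T x) * ?e m x)
         + (cis (- 2 * pi * p) / 2) * (of_real (?T x) * ?e (m + 1) x)
         + (cis (2 * pi * p) / 2) * (of_real (?T x) * ?e (m - 1) x)"
  \<comment> \<open>Multiplication by the cosine moves the frequency \<open>m\<close> to
    \<open>m + 1\<close> and \<open>m - 1\<close>, so the induction hypothesis has to hold at every
    integer frequency.\<close>
  have "((\<lambda>x. ?S x)
        has_integral (of_real c * 0 + (cis (- 2 * pi * p) / 2) * 0 + (cis (2 * pi * p) / 2) * 0)) {0..1}"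
    by (intro has_integral_add has_integral_mult_right Suc.IH)
  moreover have "?S x
        = of_real (h x * (c + cos (2 * pi * (x - p))) ^ Suc k) * ?e m x" for x
  proof -
    have e1: "cis (- 2 * pi * p) * ?e (m + 1) x
        = cis (2 * pi * (x - p)) * ?e m x"
      by (simp add: cis_mult algebra_simps)
    have e2: "cis (2 * pi * p) * ?e (m - 1) x
        = cis (- (2 * pi * (x - p))) * ?e m x"
      by (simp add: cis_mult algebra_simps)
    have e3: "cis (2 * pi * (x - p)) + cis (- (2 * pi * (x - p))) = 2 * of_real (cos (2 * pi * (x - p)))"
      by (simp add: complex_eq_iff)
    have "?S x
       = of_real (?T x) * (of_real c * ?e m x
         + (cis (- 2 * pi * p) * ?e (m + 1) x
         + cis (2 * pi * p) * ?e (m - 1) x) / 2)"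
      by (simp add: field_simps)
    also have "\<dots> = of_real (?T x) * (of_real c * ?e m x
         + ((cis (2 * pi * (x - p)) + cis (- (2 * pi * (x - p)))) * ?e m x) / 2)"
      unfolding e1 e2 by (simp add: ring_distribs)
    also have "\<dots> = of_real (?T x) * (of_real c + of_real (cos (2 * pi * (x - p)))) * ?e m x"
      unfolding e3 by (simp add: ring_distribs mult_ac)
    also have "\<dots> = of_real (h x * (c + cos (2 * pi * (x - p))) ^ Suc k) * ?e m x"
      by (simp add: mult_ac)
    finally show ?thesis .
  qed
  ultimately show ?case by (simp only: mult_zero_right add_0)
qed

text \<open>If \<open>h p\<close> were positive, the powers of
  \<open>T = c + cos (2 * pi * (x - p))\<close> would act as a peak kernel: \<open>T\<close> is at
  least \<open>q > 1\<close> close to \<open>p\<close>, at least 1 on the neighbourhood where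
  \<open>h\<close> is known to be positive, and at most 1 in absolute value elsewhere. The integral
  of \<open>h * T ^ k\<close> is always 0, while the peak contributes a multiple of
  \<open>q ^ k\<close>.\<close>

lemma fourier_coeffs_0_imp_nonpos:
  fixes h :: "real \<Rightarrow> real"
  assumes cont: "continuous_on {0..1} h"
    and coeff: "\<And>m::int. ((\<lambda>x. of_real (h x) * cis (2 * pi * of_int m * x)) has_integral 0) {0..1}"
    and p: "0 < p" "p < 1"
  shows "h p \<le> 0"
proof (rule ccontr)
  assume "\<not> h p \<le> 0"
  hence hp: "h p > 0" by simp
  have "p \<in> {0..1}" using p by simp
  then obtain d0 where d0: "d0 > 0" "\<And>x. x \<in> {0..1} \<Longrightarrow> \<bar>x - p\<bar> < d0 \<Longrightarrow> \<bar>h x - h p\<bar> < h p / 2"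
    using cont hp unfolding continuous_on_iff dist_real_def by (metis half_gt_zero)
  \<comment> \<open>Being smaller than \<open>p\<close> and \<open>1 - p\<close> keeps the
    neighbourhood inside the interval and away from its wrapped copy on the circle; the bound 1/4
    keeps the angles up to \<open>2 * pi * d\<close> where the cosine decreases.\<close>
  define d where "d = Min {d0 / 2, p / 2, (1 - p) / 2, 1 / 4}"
  have d_le: "d \<le> d0 / 2" "d \<le> p / 2" "d \<le> (1 - p) / 2" "d \<le> 1 / 4"
    unfolding d_def by (rule Min_le; simp)+
  have "d > 0" using d0(1) p by (auto simp: d_def)
  with d_le d0(1) p have d: "d > 0" "d < d0" "d < p" "d < 1 - p" "d \<le> 1 / 4"
    by (auto simp: field_simps)
  have hge: "h x \<ge> h p / 2" if "\<bar>x - p\<bar> \<le> d" for x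
  proof -
    have "x \<in> {0..1}" using that d by (auto simp: abs_le_iff)
    hence "\<bar>h x - h p\<bar> < h p / 2" using d0(2)[of x] that d by simp
    thus ?thesis unfolding abs_less_iff by linarith
  qed
  \<comment> \<open>This \<open>c\<close> makes \<open>T\<close> equal to 1 exactly at distance
    \<open>d\<close> from \<open>p\<close>.\<close>
  define c where "c = 1 - cos (2 * pi * d)"
  define T where "T = (\<lambda>x. c + cos (2 * pi * (x - p)))"
  define q where "q = c + cos (pi * d)"
  have cos_mono: "cos y \<le> cos z" if "0 \<le> z" "z \<le> y" "y \<le> pi" for y z
    using that by (simp add: cos_mono_le_eq)
  have c0: "c \<ge> 0" by (simp add: c_def)
  have q1: "q > 1"
    unfolding q_def c_def using d by (simp add: cos_mono_less_eq)
  have absy: "\<bar>2 * pi * (x - p)\<bar> = 2 * pi * \<bar>x - p\<bar>" for x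
    by (simp only: abs_mult) simp
  have Tnear: "T x \<ge> 1" if "\<bar>x - p\<bar> \<le> d" for x
  proof -
    have "cos (2 * pi * d) \<le> cos \<bar>2 * pi * (x - p)\<bar>"
      using that d by (intro cos_mono) (auto simp: abs_mult)
    thus ?thesis by (simp add: T_def c_def)
  qed
  have Tnearer: "T x \<ge> q" if "\<bar>x - p\<bar> \<le> d / 2" for x
  proof -
    have "cos (pi * d) \<le> cos \<bar>2 * pi * (x - p)\<bar>"
      using that d by (intro cos_mono) (auto simp: abs_mult)
    thus ?thesis by (simp add: T_def q_def)
  qed
  have Tfar: "\<bar>T x\<bar> \<le> 1" if "\<bar>x - p\<bar> > d" "x \<in> {0..1}" for x
  proof -
    have le: "\<bar>x - p\<bar> \<le> 1 - d" using that d by (auto simp: abs_if split: if_splits)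
    have "cos \<bar>2 * pi * (x - p)\<bar> \<le> cos (2 * pi * d)"
    proof (cases "\<bar>x - p\<bar> \<le> 1 / 2")
      case True
      thus ?thesis using that d by (intro cos_mono) (auto simp: abs_mult)
    next
      case False
      \<comment> \<open>Beyond half a period the shorter way to \<open>p\<close> runs round the
        circle, and \<open>le\<close> bounds that way below by \<open>d\<close>.\<close>
      have "cos \<bar>2 * pi * (x - p)\<bar> = cos (2 * pi - \<bar>2 * pi * (x - p)\<bar>)"
        by (simp add: cos_diff)
      also have "2 * pi - \<bar>2 * pi * (x - p)\<bar> = 2 * pi * (1 - \<bar>x - p\<bar>)"
        unfolding absy by (simp add: ring_distribs)
      also have "cos \<dots> \<le> cos (2 * pi * d)"
        using le False d by (intro cos_mono) (auto simp: abs_mult)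
      finally show ?thesis .
    qed
    moreover have "cos \<bar>2 * pi * (x - p)\<bar> \<ge> -1" by (rule cos_ge_minus_one)
    moreover have "\<bar>T x\<bar> \<le> 1" if "C \<le> cos (2 * pi * d)" "- 1 \<le> C" "T x = c + C" for C
      using that c0 unfolding c_def by linarith
    ultimately show ?thesis by (simp add: T_def)
  qed
  obtain M where M: "\<And>x. x \<in> {0..1} \<Longrightarrow> \<bar>h x\<bar> \<le> M"
    using compact_imp_bounded[OF compact_continuous_image[OF cont compact_Icc]]
    unfolding bounded_iff by (metis imageI real_norm_def)
  have M0: "M \<ge> 0" using M[of p] p by auto
  have int0: "((\<lambda>x. h x * T x ^ k) has_integral 0) {0..1}" for k
  proof -
    have "((\<lambda>x. Re (of_real (h x * (c + cos (2 * pi * (x - p))) ^ k) * cis (2 * pi * of_int 0 * x)))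
            has_integral Re 0) {0..1}"
      by (rule has_integral_Re[OF has_integral_0_times_cis_kernel[OF coeff]])
    thus ?thesis by (simp add: T_def del: of_real_mult of_real_power of_real_add)
  qed
  have bound: "(h p / 2) * q ^ k * d \<le> M" for k
  proof -
    \<comment> \<open>The minorant of \<open>h x * T x ^ k\<close> is a block over \<open>?I\<close>
      lowered by the constant \<open>M\<close>, which absorbs the region where \<open>h\<close> may
      be negative.\<close>
    let ?I = "{p - d / 2..p + d / 2}"
    have I: "?I \<subseteq> {0..1}" using d by auto
    have "((\<lambda>x. if x \<in> ?I then h p / 2 * q ^ k else 0) has_integral (d * (h p / 2 * q ^ k))) {0..1}"
      using has_integral_const_real[of "h p / 2 * q ^ k" "p - d / 2" "p + d / 2"] d
      by (subst has_integral_restrict[OF I]) simp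
    moreover have "((\<lambda>x. - M) has_integral (- M)) {0..1::real}"
      using has_integral_const_real[of "- M" 0 1] by simp
    ultimately have "((\<lambda>x. - M + (if x \<in> ?I then h p / 2 * q ^ k else 0)) has_integral
        (- M + d * (h p / 2 * q ^ k))) {0..1}"
      by (intro has_integral_add)
    moreover have "- M + (if x \<in> ?I then h p / 2 * q ^ k else 0) \<le> h x * T x ^ k" if x: "x \<in> {0..1}" for x
    proof (cases "\<bar>x - p\<bar> \<le> d")
      case True
      show ?thesis
      proof (cases "x \<in> ?I")
        case I': True
        hence "\<bar>x - p\<bar> \<le> d / 2" by (auto simp: abs_if)
        hence "q ^ k \<le> T x ^ k" using Tnearer q1 by (intro power_mono) auto
        hence "h p / 2 * q ^ k \<le> h x * T x ^ k"
          using hge[OF True] q1 hp by (intro mult_mono) auto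
        thus ?thesis using I' M0 by auto
      next
        case False
        have "0 \<le> h x * T x ^ k" using hge[OF True] hp Tnear[OF True] by auto
        moreover have "(if x \<in> ?I then h p / 2 * q ^ k else 0) = 0" using False by (simp only: if_False)
        ultimately show ?thesis using M0 by simp
      qed
    next
      case False
      hence "x \<notin> ?I" using d by (auto simp: abs_if split: if_splits)
      hence "(if x \<in> ?I then h p / 2 * q ^ k else 0) = 0" by (simp only: if_False)
      moreover have "\<bar>h x * T x ^ k\<bar> \<le> M * 1"
        unfolding abs_mult power_abs using False x
        by (intro mult_mono M power_le_one Tfar) (auto simp: M0)
      ultimately show ?thesis by (simp add: abs_le_iff)
    qed
    ultimately have "- M + d * (h p / 2 * q ^ k) \<le> 0"
      using int0[of k] has_integral_le by blast
    thus ?thesis by (simp add: mult_ac)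
  qed
  have qlim: "filterlim (\<lambda>k. q ^ k) at_top sequentially"
    using filterlim_realpow_sequentially_gt1[of q] q1
    by (intro filterlim_at_infinity_imp_filterlim_at_top) (auto intro!: always_eventually)
  have "filterlim (\<lambda>k. (h p / 2) * q ^ k * d) at_top sequentially"
    using hp d
    by (intro filterlim_at_top_mult_tendsto_pos[OF tendsto_const]
              filterlim_tendsto_pos_mult_at_top[OF tendsto_const] qlim) auto
  hence "eventually (\<lambda>k. (h p / 2) * q ^ k * d > M) sequentially"
    by (simp add: filterlim_at_top_dense)
  then obtain k where "(h p / 2) * q ^ k * d > M" by (auto dest: eventually_happens)
  with bound[of k] show False by simp
qed

text \<open>The one-sided result is applied to \<open>h\<close> and to \<open>- h\<close>. The peak
  argument works at interior points only; since \<open>h\<close> is not assumed periodic, the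
  endpoints are reached by continuity.\<close>

lemma fourier_coeffs_0_imp_0:
  fixes h :: "real \<Rightarrow> real"
  assumes cont: "continuous_on {0..1} h"
    and C: "\<And>m. ((\<lambda>x. h x * cos (2 * pi * real m * x)) has_integral 0) {0..1}"
    and S: "\<And>m. ((\<lambda>x. h x * sin (2 * pi * real m * x)) has_integral 0) {0..1}"
    and x: "x \<in> {0..1}"
  shows "h x = 0"
proof -
  have coeff: "((\<lambda>x. of_real (h x) * cis (2 * pi * of_int m * x)) has_integral 0) {0..1}" for m
  proof -
    have s: "((\<lambda>x. of_int (sgn m) * (h x * sin (2 * pi * real (nat \<bar>m\<bar>) * x))) has_integral of_int (sgn m) * 0) {0..1}"
      by (intro has_integral_mult_right S)
    have "((\<lambda>x. of_real (h x * cos (2 * pi * real (nat \<bar>m\<bar>) * x)) + \<i> * of_real (of_int (sgn m) * (h x * sin (2 * pi * real (nat \<bar>m\<bar>) * x))))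
       has_integral (of_real 0 + \<i> * of_real (of_int (sgn m) * 0))) {0..1}"
      by (intro has_integral_add has_integral_mult_right has_integral_of_real C s)
    moreover have "of_real (h x * cos (2 * pi * real (nat \<bar>m\<bar>) * x)) + \<i> * of_real (of_int (sgn m) * (h x * sin (2 * pi * real (nat \<bar>m\<bar>) * x)))
        = of_real (h x) * cis (2 * pi * of_int m * x)" for x
      by (cases "m > 0"; cases "m = 0") (auto simp: complex_eq_iff)
    ultimately show ?thesis by (simp del: of_real_mult)
  qed
  have coeff': "((\<lambda>x. of_real (- h x) * cis (2 * pi * of_int m * x)) has_integral 0) {0..1}" for m
    using has_integral_neg[OF coeff[of m]] by simp
  have in0: "h p = 0" if "0 < p" "p < 1" for p
    using fourier_coeffs_0_imp_nonpos[OF cont coeff that]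
      fourier_coeffs_0_imp_nonpos[OF continuous_on_minus[OF cont] coeff' that] by simp
  have cl: "closure {0<..<1::real} = {0..1}" by simp
  show ?thesis
    by (rule continuous_constant_on_closure[of "{0<..<1}" h 0 x]) (use x cont in0 in auto)
qed

lemma summable_shifted_powr: "s > 1 \<Longrightarrow> summable (\<lambda>m. real (Suc m) powr - s)"
  using summable_Suc_iff[of "\<lambda>m. real m powr - s"] summable_real_powr_iff[of "- s"] by simp

section \<open>Orthogonality relations and the Fourier expansion\<close>

lemma has_integral_cos_period:
  "((\<lambda>x. cos (2 * pi * of_int k * x)) has_integral (if k = 0 then 1 else 0)) {0..1}"
proof (cases "k = 0")
  case True
  then show ?thesis using has_integral_const_real[of "1::real" 0 1] by simp
next
  case False
  have "((\<lambda>x. cos (2 * pi * of_int k * x)) has_integral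
          sin (2 * pi * of_int k * 1) / (2 * pi * of_int k) - sin (2 * pi * of_int k * 0) / (2 * pi * of_int k)) {0..1}"
    using False
    by (intro fundamental_theorem_of_calculus)
       (auto intro!: derivative_eq_intros simp: has_real_derivative_iff_has_vector_derivative[symmetric])
  thus ?thesis using sin_int_2pin[of k] False by (simp add: mult_ac)
qed

lemma has_integral_sin_period:
  "((\<lambda>x. sin (2 * pi * of_int k * x)) has_integral 0) {0..1}"
proof (cases "k = 0")
  case False
  have "((\<lambda>x. sin (2 * pi * of_int k * x)) has_integral
          - cos (2 * pi * of_int k * 1) / (2 * pi * of_int k) - - cos (2 * pi * of_int k * 0) / (2 * pi * of_int k)) {0..1}"
    using False
    by (intro fundamental_theorem_of_calculus)
       (auto intro!: derivative_eq_intros simp: has_real_derivative_iff_has_vector_derivative[symmetric])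
  thus ?thesis using cos_int_2pin[of k] by (simp add: mult_ac)
qed auto

lemma has_integral_cos_cos_period:
  assumes "m > 0"
  shows "((\<lambda>x. cos (2 * pi * real m * x) * cos (2 * pi * real k * x)) has_integral (if k = m then 1/2 else 0)) {0..1}"
proof -
  let ?c = "\<lambda>k::int. \<lambda>x::real. cos (2 * pi * of_int k * x)"
  have "((\<lambda>x. (1/2) * (?c (int m - int k) x + ?c (int m + int k) x)) has_integral
        (1/2) * ((if int m - int k = 0 then 1 else 0) + (if int m + int k = 0 then 1 else 0))) {0..1}"
    by (intro has_integral_mult_right has_integral_add has_integral_cos_period)
  moreover have "(1/2) * (?c (int m - int k) x + ?c (int m + int k) x) =
      cos (2 * pi * real m * x) * cos (2 * pi * real k * x)" for x
    by (simp add: cos_add cos_diff ring_distribs)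
  moreover have "(1/2) * ((if int m - int k = 0 then 1 else 0) + (if int m + int k = 0 then 1 else 0))
      = (if k = m then 1/2 else 0 :: real)"
    using assms by auto
  ultimately show ?thesis by (simp only:)
qed

lemma has_integral_sin_sin_period:
  assumes "m > 0"
  shows "((\<lambda>x. sin (2 * pi * real m * x) * sin (2 * pi * real k * x)) has_integral (if k = m then 1/2 else 0)) {0..1}"
proof -
  let ?c = "\<lambda>k::int. \<lambda>x::real. cos (2 * pi * of_int k * x)"
  have "((\<lambda>x. (1/2) * (?c (int m - int k) x - ?c (int m + int k) x)) has_integral
        (1/2) * ((if int m - int k = 0 then 1 else 0) - (if int m + int k = 0 then 1 else 0))) {0..1}"
    by (intro has_integral_mult_right has_integral_diff has_integral_cos_period)
  moreover have "(1/2) * (?c (int m - int k) x - ?c (int m + int k) x) =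
      sin (2 * pi * real m * x) * sin (2 * pi * real k * x)" for x
    by (simp add: cos_add cos_diff ring_distribs)
  moreover have "(1/2) * ((if int m - int k = 0 then 1 else 0) - (if int m + int k = 0 then 1 else 0))
      = (if k = m then 1/2 else 0 :: real)"
    using assms by auto
  ultimately show ?thesis by (simp only:)
qed

lemma has_integral_sin_cos_period:
  "((\<lambda>x. sin (2 * pi * real m * x) * cos (2 * pi * real k * x)) has_integral 0) {0..1}"
proof -
  let ?s = "\<lambda>k::int. \<lambda>x::real. sin (2 * pi * of_int k * x)"
  have "((\<lambda>x. (1/2) * (?s (int m + int k) x + ?s (int m - int k) x)) has_integral
        (1/2) * (0 + 0)) {0..1}"
    by (intro has_integral_mult_right has_integral_add has_integral_sin_period)
  thus ?thesis by (simp add: sin_add sin_diff ring_distribs mult_ac)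
qed

text \<open>Absolutely summable coefficients give a uniformly convergent, hence continuous, sum
  \<open>g\<close> with the same coefficients as \<open>f\<close>; continuity then forces
  \<open>g = f\<close> up to the endpoints. The halves in the hypotheses are the mean squares of
  cosine and sine.\<close>

lemma fourier_series:
  fixes f :: "real \<Rightarrow> real" and c s :: "nat \<Rightarrow> real"
  assumes cont: "continuous_on {0..1} f"
    and I0: "(f has_integral 0) {0..1}"
    and C: "\<And>m. ((\<lambda>x. f x * cos (2 * pi * real (Suc m) * x)) has_integral c m / 2) {0..1}"
    and S: "\<And>m. ((\<lambda>x. f x * sin (2 * pi * real (Suc m) * x)) has_integral s m / 2) {0..1}"
    and sumc: "summable (\<lambda>m. \<bar>c m\<bar>)" and sums: "summable (\<lambda>m. \<bar>s m\<bar>)"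
    and x: "x \<in> {0..1}"
  shows "(\<lambda>m. c m * cos (2 * pi * real (Suc m) * x) + s m * sin (2 * pi * real (Suc m) * x)) sums f x"
proof -
  define t where "t = (\<lambda>m x. c m * cos (2 * pi * real (Suc m) * x) + s m * sin (2 * pi * real (Suc m) * x))"
  define g where "g = (\<lambda>x. \<Sum>m. t m x)"
  let ?c = "\<lambda>k x. cos (2 * pi * real k * x)" and ?s = "\<lambda>k x. sin (2 * pi * real k * x)"
  have bnd: "norm (t m x) \<le> \<bar>c m\<bar> + \<bar>s m\<bar>" for m x
  proof -
    have "\<bar>t m x\<bar> \<le> \<bar>c m\<bar> * \<bar>?c (Suc m) x\<bar> + \<bar>s m\<bar> * \<bar>?s (Suc m) x\<bar>"
      unfolding t_def abs_mult[symmetric] by (rule abs_triangle_ineq)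
    also have "\<dots> \<le> \<bar>c m\<bar> * 1 + \<bar>s m\<bar> * 1"
      by (intro add_mono mult_left_mono) auto
    finally show ?thesis by simp
  qed
  have summ: "summable (\<lambda>m. t m x)" for x
    using bnd by (intro summable_comparison_test'[OF summable_add[OF sumc sums]]) auto
  have ul: "uniform_limit {0..1} (\<lambda>M x. \<Sum>m<M. t m x) g sequentially"
    unfolding g_def using bnd by (intro Weierstrass_m_test[OF _ summable_add[OF sumc sums]]) auto
  have tcont: "continuous_on A (\<lambda>x. \<Sum>m<M. t m x)" for A M
    unfolding t_def by (intro continuous_intros)
  have gcont: "continuous_on {0..1} g"
    by (rule uniform_limit_theorem[OF _ ul]) (auto intro!: always_eventually tcont)
  have coeff: "((\<lambda>x. g x * u x) has_integral I) {0..1}"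
    if ucont: "continuous_on {0..1} u" and u1: "\<And>x. \<bar>u x\<bar> \<le> 1"
       and int: "\<And>m. ((\<lambda>x. t m x * u x) has_integral i m) {0..1}" and I: "i sums I" for u i I
  proof -
    have lim: "uniform_limit {0..1} (\<lambda>M x. (\<Sum>m<M. t m x) * u x) (\<lambda>x. g x * u x) sequentially"
      using ul unfolding uniform_limit_iff
    proof (safe, goal_cases)
      case (1 e)
      then have "\<forall>\<^sub>F M in sequentially. \<forall>x\<in>{0..1}. dist (\<Sum>m<M. t m x) (g x) < e" by blast
      then show ?case
      proof eventually_elim
        case (elim M)
        show ?case
        proof
          fix x :: real assume "x \<in> {0..1}"
          have "dist ((\<Sum>m<M. t m x) * u x) (g x * u x) = dist (\<Sum>m<M. t m x) (g x) * \<bar>u x\<bar>"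
            by (simp add: dist_real_def abs_mult flip: left_diff_distrib)
          also have "\<dots> \<le> dist (\<Sum>m<M. t m x) (g x) * 1" using u1 by (intro mult_left_mono) auto
          finally show "dist ((\<Sum>m<M. t m x) * u x) (g x * u x) < e"
            using elim \<open>x \<in> {0..1}\<close> by fastforce
        qed
      qed
    qed
    have "\<And>M. continuous_on {0..1} (\<lambda>x. (\<Sum>m<M. t m x) * u x)"
      by (intro continuous_on_mult tcont ucont)
    from uniform_limit_integral[OF lim this sequentially_bot] obtain I' J where
      I': "\<And>M. ((\<lambda>x. (\<Sum>m<M. t m x) * u x) has_integral I' M) {0..1}"
      and J: "((\<lambda>x. g x * u x) has_integral J) {0..1}" and l: "I' \<longlonglongrightarrow> J"
      by blast
    have "((\<lambda>x. (\<Sum>m<M. t m x) * u x) has_integral (\<Sum>m<M. i m)) {0..1}" for M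
      unfolding sum_distrib_right by (intro has_integral_sum int) auto
    hence "I' M = (\<Sum>m<M. i m)" for M using I' has_integral_unique by blast
    hence "I' = (\<lambda>M. \<Sum>m<M. i m)" by blast
    with l I have "J = I" unfolding sums_def using LIMSEQ_unique by blast
    with J show ?thesis by simp
  qed
  have "g x = f x"
  proof -
    have cosc: "((\<lambda>x. (f x - g x) * ?c k x) has_integral 0) {0..1}" for k
    proof -
      have "((\<lambda>x. t m x * ?c k x) has_integral (if m + 1 = k then c m / 2 else 0)) {0..1}" for m
      proof -
        have "((\<lambda>x. c m * (?c (Suc m) x * ?c k x)
              + s m * (?s (Suc m) x * ?c k x)) has_integral
            (c m * (if k = Suc m then 1/2 else 0) + s m * 0)) {0..1}"
          by (intro has_integral_add has_integral_mult_right has_integral_cos_cos_period has_integral_sin_cos_period) simp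
        moreover have "c m * (?c (Suc m) x * ?c k x)
              + s m * (?s (Suc m) x * ?c k x) = t m x * ?c k x" for x
          by (simp add: t_def ring_distribs del: of_nat_Suc)
        moreover have "c m * (if k = Suc m then 1/2 else 0) + s m * 0 = (if m + 1 = k then c m / 2 else 0)"
          by auto
        ultimately show ?thesis by (simp only:)
      qed
      moreover have "(\<lambda>m. if m + 1 = k then c m / 2 else 0) sums (if k = 0 then 0 else c (k - 1) / 2)"
        using sums_single[of "k - 1" "\<lambda>m. c m / 2"] by (cases k) auto
      ultimately have "((\<lambda>x. g x * ?c k x) has_integral (if k = 0 then 0 else c (k - 1) / 2)) {0..1}"
        by (intro coeff[where u = "\<lambda>x. ?c k x"]) (auto intro!: continuous_intros)
      moreover have "((\<lambda>x. f x * ?c k x) has_integral (if k = 0 then 0 else c (k - 1) / 2)) {0..1}"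
        using I0 C[of "k - 1"] by (cases k) auto
      ultimately have "((\<lambda>x. f x * ?c k x - g x * ?c k x) has_integral
          ((if k = 0 then 0 else c (k - 1) / 2) - (if k = 0 then 0 else c (k - 1) / 2))) {0..1}"
        by (intro has_integral_diff)
      thus ?thesis by (simp only: left_diff_distrib diff_self)
    qed
    have sinc: "((\<lambda>x. (f x - g x) * ?s k x) has_integral 0) {0..1}" for k
    proof (cases "k = 0")
      case False
      have "((\<lambda>x. t m x * ?s k x) has_integral (if m + 1 = k then s m / 2 else 0)) {0..1}" for m
      proof -
        have "((\<lambda>x. c m * (?s k x * ?c (Suc m) x)
              + s m * (?s (Suc m) x * ?s k x)) has_integral
            (c m * 0 + s m * (if k = Suc m then 1/2 else 0))) {0..1}"
          by (intro has_integral_add has_integral_mult_right has_integral_sin_sin_period has_integral_sin_cos_period) simp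
        moreover have "c m * (?s k x * ?c (Suc m) x)
              + s m * (?s (Suc m) x * ?s k x) = t m x * ?s k x" for x
          by (simp add: t_def ring_distribs del: of_nat_Suc)
        moreover have "c m * 0 + s m * (if k = Suc m then 1/2 else 0) = (if m + 1 = k then s m / 2 else 0)"
          by auto
        ultimately show ?thesis by (simp only:)
      qed
      moreover have "(\<lambda>m. if m + 1 = k then s m / 2 else 0) sums (s (k - 1) / 2)"
        using sums_single[of "k - 1" "\<lambda>m. s m / 2"] False by (cases k) auto
      ultimately have "((\<lambda>x. g x * ?s k x) has_integral (s (k - 1) / 2)) {0..1}"
        by (intro coeff[where u = "\<lambda>x. ?s k x"]) (auto intro!: continuous_intros)
      moreover have "((\<lambda>x. f x * ?s k x) has_integral (s (k - 1) / 2)) {0..1}"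
        using S[of "k - 1"] False by (cases k) auto
      ultimately have "((\<lambda>x. f x * ?s k x - g x * ?s k x) has_integral
          ((s (k - 1) / 2) - (s (k - 1) / 2))) {0..1}"
        by (intro has_integral_diff)
      thus ?thesis by (simp only: left_diff_distrib diff_self)
    qed auto
    have "f x - g x = 0"
      by (rule fourier_coeffs_0_imp_0[of "\<lambda>x. f x - g x"]) (use x cosc sinc cont gcont in \<open>auto intro!: continuous_intros\<close>)
    thus ?thesis by simp
  qed
  moreover have "(\<lambda>m. t m x) sums g x" unfolding g_def using summ by (rule summable_sums)
  ultimately show ?thesis by (simp add: t_def)
qed

section \<open>Bernoulli polynomials and the partial fractions of the exponential quotient\<close>

declare bernpoly.simps [simp del]

lemma bernpoly_0 [simp]: "bernpoly 0 a = 1"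
  by (subst bernpoly.simps) simp

lemma bernpoly_1: "bernpoly (Suc 0) a = a - 1/2"
  by (subst bernpoly.simps) (simp add: field_simps)

lemma bernpoly_sum:
  "(\<Sum>j<n. real (Suc n choose j) * bernpoly j a) + real (Suc n) * bernpoly n a = real (Suc n) * a ^ n"
  by (subst (2) bernpoly.simps) (simp add: field_simps)

text \<open>Differentiating the recursion term by term, the absorption identity for binomial
  coefficients turns its coefficients into those of the recursion one degree lower.\<close>

lemma has_field_derivative_bernpoly:
  "(bernpoly n has_real_derivative real n * bernpoly (n - 1) x) (at x)"
proof (induction n arbitrary: x rule: less_induct)
  case (less n)
  show ?case
  proof (cases n)
    case 0
    have "bernpoly 0 = (\<lambda>_. 1)" by auto
    with 0 show ?thesis by simp
  next
    case (Suc p)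
    have fn: "bernpoly n = (\<lambda>a. (real (n + 1) * a ^ n - (\<Sum>j<n. real (n + 1 choose j) * bernpoly j a)) / real (n + 1))"
      using bernpoly.simps by blast
    have D: "(bernpoly n has_real_derivative (real (n + 1) * (real n * x ^ (n - 1))
        - (\<Sum>j<n. real (n + 1 choose j) * (real j * bernpoly (j - 1) x))) / real (n + 1)) (at x)"
    proof -
      have S: "((\<lambda>a. \<Sum>j<n. real (n + 1 choose j) * bernpoly j a) has_real_derivative
          (\<Sum>j<n. real (n + 1 choose j) * (real j * bernpoly (j - 1) x))) (at x)"
        by (intro DERIV_sum DERIV_cmult less.IH) auto
      show ?thesis unfolding fn
        by (intro DERIV_cdivide DERIV_diff S DERIV_cmult) (auto intro!: derivative_eq_intros)
    qed
    have "(\<Sum>j<n. real (n + 1 choose j) * (real j * bernpoly (j - 1) x))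
        = (\<Sum>i<p. real (Suc (Suc p) choose Suc i) * (real (Suc i) * bernpoly i x))"
      unfolding Suc by (subst sum.lessThan_Suc_shift) simp
    also have "\<dots> = (\<Sum>i<p. real (Suc n) * (real (Suc p choose i) * bernpoly i x))"
    proof (intro sum.cong refl)
      fix i
      have "real (Suc (Suc p) choose Suc i) * real (Suc i) = real (Suc (Suc p)) * real (Suc p choose i)"
        using Suc_times_binomial[of i "Suc p"] unfolding of_nat_mult[symmetric] by (metis mult.commute)
      thus "real (Suc (Suc p) choose Suc i) * (real (Suc i) * bernpoly i x)
          = real (Suc n) * (real (Suc p choose i) * bernpoly i x)"
        unfolding Suc by (simp only: mult.assoc[symmetric])
    qed
    also have "\<dots> = real (Suc n) * (real (Suc p) * x ^ p - real (Suc p) * bernpoly p x)"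
      using bernpoly_sum[of p x] by (simp only: sum_distrib_left[symmetric]) simp
    finally have *: "(\<Sum>j<n. real (n + 1 choose j) * (real j * bernpoly (j - 1) x))
        = real (Suc n) * (real (Suc p) * x ^ p - real (Suc p) * bernpoly p x)" .
    have "(real (n + 1) * (real n * x ^ (n - 1)) - real (Suc n) * (real (Suc p) * x ^ p - real (Suc p) * bernpoly p x)) / real (n + 1)
        = real n * bernpoly (n - 1) x"
      unfolding Suc by (simp add: divide_simps) (simp add: algebra_simps)
    with D show ?thesis unfolding * by (simp only:)
  qed
qed

lemma continuous_on_bernpoly [continuous_intros]:
  "continuous_on A f \<Longrightarrow> continuous_on A (\<lambda>x. bernpoly n (f x))"
  using continuous_on_compose2[of UNIV "bernpoly n" A f]
    DERIV_continuous_on[of UNIV "bernpoly n" "\<lambda>x. real n * bernpoly (n - 1) x"]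
    has_field_derivative_bernpoly by auto

text \<open>The jump of degree 1 is the only boundary term that can survive the integrations by
  parts against trigonometric functions.\<close>

lemma bernpoly_diff_endpoints: "bernpoly n 1 - bernpoly n 0 = (if n = 1 then 1 else 0)"
proof (induction n rule: less_induct)
  case (less n)
  have "real (Suc n) * (bernpoly n 1 - bernpoly n 0) =
      real (Suc n) * (1 - 0 ^ n) - (\<Sum>j<n. real (Suc n choose j) * (bernpoly j 1 - bernpoly j 0))"
    using bernpoly_sum[of n 1] bernpoly_sum[of n 0] by (simp add: algebra_simps sum_subtractf)
  also have "(\<Sum>j<n. real (Suc n choose j) * (bernpoly j 1 - bernpoly j 0)) =
      (\<Sum>j<n. if j = 1 then real (Suc n choose j) else 0)"
    using less by (intro sum.cong) auto
  also have "\<dots> = (if n > 1 then real (Suc n) else 0)" by simp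
  finally have "real (Suc n) * (bernpoly n 1 - bernpoly n 0) = real (Suc n) * (if n = 1 then 1 else 0)"
    by (cases "n = 0"; cases "n = 1") auto
  thus ?case by (simp del: of_nat_Suc)
qed

lemma has_integral_bernpoly: "n > 0 \<Longrightarrow> (bernpoly n has_integral 0) {0..1}"
proof -
  assume "n > 0"
  have "(bernpoly n has_integral bernpoly (Suc n) 1 / real (Suc n) - bernpoly (Suc n) 0 / real (Suc n)) {0..1}"
    by (intro fundamental_theorem_of_calculus)
       (auto intro!: derivative_eq_intros has_field_derivative_bernpoly has_field_derivative_at_within[OF has_field_derivative_bernpoly]
         simp: has_real_derivative_iff_has_vector_derivative[symmetric] simp del: of_nat_Suc)
  thus ?thesis using bernpoly_diff_endpoints[of "Suc n"] \<open>n > 0\<close> by (simp flip: diff_divide_distrib)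
qed

text \<open>Two integrations by parts condensed into one explicit primitive \<open>?F\<close>.
  Moving by two degrees leads from cosine to cosine and from sine to sine; the cosine boundary term
  is nonzero only for \<open>n = 0\<close>, and the sine boundary term always vanishes.\<close>

lemma has_integral_bernpoly_cos_sin_step:
  assumes w: "w \<noteq> 0" "sin w = 0" "cos w = 1"
  shows "((\<lambda>x. bernpoly n x * cos (w * x)) has_integral I) {0..1} \<Longrightarrow>
         ((\<lambda>x. bernpoly (n + 2) x * cos (w * x)) has_integral
           (real (n + 2) * (bernpoly (n + 1) 1 - bernpoly (n + 1) 0) - real (n + 2) * real (n + 1) * I) / w\<^sup>2) {0..1}"
    and "((\<lambda>x. bernpoly n x * sin (w * x)) has_integral I) {0..1} \<Longrightarrow>
         ((\<lambda>x. bernpoly (n + 2) x * sin (w * x)) has_integral - real (n + 2) * real (n + 1) * I / w\<^sup>2) {0..1}"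
proof -
  have dB: "(bernpoly m has_real_derivative real m * bernpoly (m - 1) x) (at x within A)" for m x A
    using has_field_derivative_bernpoly has_field_derivative_at_within by blast
  {
    let ?F = "\<lambda>x. bernpoly (n + 2) x * sin (w * x) / w + real (n + 2) * bernpoly (n + 1) x * cos (w * x) / w\<^sup>2"
    let ?f = "\<lambda>x. bernpoly (n + 2) x * cos (w * x) + real (n + 2) * real (n + 1) / w\<^sup>2 * (bernpoly n x * cos (w * x))"
    assume I: "((\<lambda>x. bernpoly n x * cos (w * x)) has_integral I) {0..1}"
    have "(?f has_integral ?F 1 - ?F 0) {0..1}"
    proof (intro fundamental_theorem_of_calculus)
      fix x :: real
      let ?D = "(real (n + 2) * bernpoly (n + 1) x * sin (w * x) + bernpoly (n + 2) x * (w * cos (w * x))) / w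
         + real (n + 2) * (real (n + 1) * bernpoly n x * cos (w * x) - bernpoly (n + 1) x * (w * sin (w * x))) / w\<^sup>2"
      have "(?F has_real_derivative ?D) (at x within {0..1})"
        by (rule derivative_eq_intros dB refl | simp add: w(1))+
           (use w(1) in \<open>simp add: divide_simps power2_eq_square\<close>, simp add: algebra_simps power4_eq_xxxx)
      also have "?D = ?f x"
        using w(1) by (simp add: divide_simps power2_eq_square) (simp add: algebra_simps)
      finally show "(?F has_vector_derivative ?f x) (at x within {0..1})"
        by (simp only: has_real_derivative_iff_has_vector_derivative)
    qed simp
    from has_integral_diff[OF this has_integral_mult_right[OF I, of "real (n + 2) * real (n + 1) / w\<^sup>2"]]
    show "((\<lambda>x. bernpoly (n + 2) x * cos (w * x)) has_integral
           (real (n + 2) * (bernpoly (n + 1) 1 - bernpoly (n + 1) 0) - real (n + 2) * real (n + 1) * I) / w\<^sup>2) {0..1}"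
      using w by (simp add: diff_divide_distrib right_diff_distrib)
  }
  {
    let ?F = "\<lambda>x. - bernpoly (n + 2) x * cos (w * x) / w + real (n + 2) * bernpoly (n + 1) x * sin (w * x) / w\<^sup>2"
    let ?f = "\<lambda>x. bernpoly (n + 2) x * sin (w * x) + real (n + 2) * real (n + 1) / w\<^sup>2 * (bernpoly n x * sin (w * x))"
    assume I: "((\<lambda>x. bernpoly n x * sin (w * x)) has_integral I) {0..1}"
    have "(?f has_integral ?F 1 - ?F 0) {0..1}"
    proof (intro fundamental_theorem_of_calculus)
      fix x :: real
      let ?D = "(- (real (n + 2) * bernpoly (n + 1) x) * cos (w * x) + bernpoly (n + 2) x * (w * sin (w * x))) / w
         + real (n + 2) * (real (n + 1) * bernpoly n x * sin (w * x) + bernpoly (n + 1) x * (w * cos (w * x))) / w\<^sup>2"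
      have "(?F has_real_derivative ?D) (at x within {0..1})"
        by (rule derivative_eq_intros dB refl | simp add: w(1))+
           (use w(1) in \<open>simp add: divide_simps power2_eq_square\<close>, simp add: algebra_simps power4_eq_xxxx)
      also have "?D = ?f x"
        using w(1) by (simp add: divide_simps power2_eq_square) (simp add: algebra_simps)
      finally show "(?F has_vector_derivative ?f x) (at x within {0..1})"
        by (simp only: has_real_derivative_iff_has_vector_derivative)
    qed simp
    from has_integral_diff[OF this has_integral_mult_right[OF I, of "real (n + 2) * real (n + 1) / w\<^sup>2"]]
    show "((\<lambda>x. bernpoly (n + 2) x * sin (w * x)) has_integral - real (n + 2) * real (n + 1) * I / w\<^sup>2) {0..1}"
      using w bernpoly_diff_endpoints[of "n + 2"] by (simp add: minus_mult_left[symmetric] minus_divide_left[symmetric] del: minus_add_distrib mult_minus_left)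
  }
qed

lemma has_integral_even_bernpoly_cos_sin:
  fixes m k :: nat
  defines "w \<equiv> 2 * pi * real (Suc m)"
  shows "((\<lambda>x. bernpoly (2 * Suc k) x * cos (w * x)) has_integral (- 1) ^ k * fact (2 * Suc k) / w ^ (2 * Suc k)) {0..1}"
    and "((\<lambda>x. bernpoly (2 * Suc k) x * sin (w * x)) has_integral 0) {0..1}"
proof -
  have w: "w \<noteq> 0" "sin w = 0" "cos w = 1"
    using cos_int_2pin[of "int (Suc m)"] sin_int_2pin[of "int (Suc m)"] by (auto simp: w_def simp del: of_nat_Suc)
  show "((\<lambda>x. bernpoly (2 * Suc k) x * cos (w * x)) has_integral (- 1) ^ k * fact (2 * Suc k) / w ^ (2 * Suc k)) {0..1}"
  proof (induction k)
    case 0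
    \<comment> \<open>In degree 0 the integral vanishes, so the value in degree 2 comes entirely
      from the boundary jump of degree 1.\<close>
    have "((\<lambda>x. bernpoly 0 x * cos (w * x)) has_integral 0) {0..1}"
      using has_integral_cos_period[of "int (Suc m)"] by (simp add: w_def)
    from has_integral_bernpoly_cos_sin_step(1)[OF w this] show ?case
      by (simp add: bernpoly_1 fact_numeral power2_eq_square numeral_2_eq_2)
  next
    case (Suc k)
    have "2 * Suc k + 2 = 2 * Suc (Suc k)" by simp
    moreover have "(real (2 * Suc k + 2) * (bernpoly (2 * Suc k + 1) 1 - bernpoly (2 * Suc k + 1) 0)
        - real (2 * Suc k + 2) * real (2 * Suc k + 1) * ((- 1) ^ k * fact (2 * Suc k) / w ^ (2 * Suc k))) / w\<^sup>2
      = (- 1) ^ Suc k * fact (2 * Suc (Suc k)) / w ^ (2 * Suc (Suc k))"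
      using w(1) bernpoly_diff_endpoints[of "2 * Suc k + 1"]
      by (simp add: field_simps power2_eq_square)
    ultimately show ?case
      using has_integral_bernpoly_cos_sin_step(1)[OF w Suc.IH] by (simp only:)
  qed
  show "((\<lambda>x. bernpoly (2 * Suc k) x * sin (w * x)) has_integral 0) {0..1}"
  proof (induction k)
    case 0
    have "((\<lambda>x. bernpoly 0 x * sin (w * x)) has_integral 0) {0..1}"
      using has_integral_sin_period[of "int (Suc m)"] by (simp add: w_def)
    from has_integral_bernpoly_cos_sin_step(2)[OF w this] show ?case by (simp add: numeral_2_eq_2)
  next
    case (Suc k)
    from has_integral_bernpoly_cos_sin_step(2)[OF w Suc.IH] show ?case by simp
  qed
qed

theorem bernpoly_fourier_sums:
  assumes x: "x \<in> {0..1}"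
  shows "(\<lambda>m. 2 * (- 1) ^ k * fact (2 * Suc k) / (2 * pi * real (Suc m)) ^ (2 * Suc k)
            * cos (2 * pi * real (Suc m) * x)) sums bernpoly (2 * Suc k) x"
proof -
  define c where "c = (\<lambda>m. 2 * (- 1) ^ k * fact (2 * Suc k) / (2 * pi * real (Suc m)) ^ (2 * Suc k) :: real)"
  have "summable (\<lambda>m. (2 * fact (2 * Suc k) / (2 * pi) ^ (2 * Suc k)) * real (Suc m) powr - real (2 * Suc k))"
    by (intro summable_mult summable_shifted_powr) simp
  moreover have "(2 * fact (2 * Suc k) / (2 * pi) ^ (2 * Suc k)) * real (Suc m) powr - real (2 * Suc k) = \<bar>c m\<bar>" for m
    unfolding c_def by (subst powr_minus, subst powr_realpow)
      (simp_all add: abs_mult power_abs power_mult_distrib field_simps del: power_Suc fact_Suc mult_Suc_right of_nat_Suc)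
  ultimately have sc: "summable (\<lambda>m. \<bar>c m\<bar>)" by (simp only:)
  have "(\<lambda>m. c m * cos (2 * pi * real (Suc m) * x) + 0 * sin (2 * pi * real (Suc m) * x)) sums bernpoly (2 * Suc k) x"
  proof (rule fourier_series)
    show "((\<lambda>x. bernpoly (2 * Suc k) x * cos (2 * pi * real (Suc m) * x)) has_integral c m / 2) {0..1}" for m
      using has_integral_even_bernpoly_cos_sin(1)[of k m] unfolding c_def by (simp del: power_Suc fact_Suc mult_Suc_right of_nat_Suc)
    show "((\<lambda>x. bernpoly (2 * Suc k) x * sin (2 * pi * real (Suc m) * x)) has_integral 0 / 2) {0..1}" for m
      using has_integral_even_bernpoly_cos_sin(2)[of k m] by (simp del: power_Suc fact_Suc mult_Suc_right of_nat_Suc)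
    show "(bernpoly (2 * Suc k) has_integral 0) {0..1}" by (rule has_integral_bernpoly) simp
  qed (use sc x in \<open>auto intro!: continuous_intros\<close>)
  thus ?thesis by (simp add: c_def del: power_Suc fact_Suc mult_Suc_right of_nat_Suc)
qed

text \<open>Euler's evaluation: at the endpoint 1 every cosine in the Fourier series equals 1, in
  agreement with the convention that Bernoulli numbers are values at 1.\<close>

lemma zeta_nat_even:
  "zeta_nat (2 * Suc k) = (- 1) ^ k * bernpoly (2 * Suc k) 1 * (2 * pi) ^ (2 * Suc k) / (2 * fact (2 * Suc k))"
proof -
  have cos1: "cos (2 * pi * real (Suc m)) = 1" for m
    using cos_int_2pin[of "int (Suc m)"] by (simp del: of_nat_Suc)
  let ?K = "2 * (- 1) ^ k * fact (2 * Suc k) / (2 * pi) ^ (2 * Suc k) :: real"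
  have "(\<lambda>m. inverse ?K * (2 * (- 1) ^ k * fact (2 * Suc k) / (2 * pi * real (Suc m)) ^ (2 * Suc k)
            * cos (2 * pi * real (Suc m) * 1))) sums (inverse ?K * bernpoly (2 * Suc k) 1)"
    by (intro sums_mult bernpoly_fourier_sums) simp
  moreover have "inverse ?K * (2 * (- 1) ^ k * fact (2 * Suc k) / (2 * pi * real (Suc m)) ^ (2 * Suc k)
            * cos (2 * pi * real (Suc m) * 1)) = 1 / real (Suc m) ^ (2 * Suc k)" for m
    unfolding mult_1_right cos1 power_mult_distrib
    by (simp add: field_simps del: power_Suc fact_Suc mult_Suc_right of_nat_Suc)
  moreover have "inverse ?K = (- 1) ^ k * (2 * pi) ^ (2 * Suc k) / (2 * fact (2 * Suc k))"
    by (cases "even k") (simp_all add: field_simps del: power_Suc fact_Suc mult_Suc_right of_nat_Suc)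
  ultimately have "(\<lambda>m. 1 / real (Suc m) ^ (2 * Suc k)) sums
      ((- 1) ^ k * (2 * pi) ^ (2 * Suc k) / (2 * fact (2 * Suc k)) * bernpoly (2 * Suc k) 1)"
    by (simp only:)
  thus ?thesis unfolding zeta_nat_def by (simp only: sums_iff times_divide_eq_left times_divide_eq_right mult_ac)
qed

section \<open>The exponential quotient as a Fourier series in \<open>a\<close>\<close>

lemma has_integral_exp_cos_sin:
  fixes t w :: real
  assumes t: "t > 0" and w: "sin w = 0" "cos w = 1"
  shows "((\<lambda>a. exp (- a * t) * cos (w * a)) has_integral t * (1 - exp (- t)) / (t\<^sup>2 + w\<^sup>2)) {0..1}"
    and "((\<lambda>a. exp (- a * t) * sin (w * a)) has_integral w * (1 - exp (- t)) / (t\<^sup>2 + w\<^sup>2)) {0..1}"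
proof -
  have pos: "t\<^sup>2 + w\<^sup>2 > 0" using t by (simp add: add_pos_nonneg)
  let ?F = "\<lambda>a. exp (- a * t) * (- t * cos (w * a) + w * sin (w * a)) / (t\<^sup>2 + w\<^sup>2)"
  have "((\<lambda>a. exp (- a * t) * cos (w * a)) has_integral ?F 1 - ?F 0) {0..1}"
  proof (intro fundamental_theorem_of_calculus)
    fix a :: real
    have "(?F has_real_derivative exp (- a * t) * cos (w * a)) (at a within {0..1})"
      using pos by (auto intro!: derivative_eq_intros simp: divide_simps) (simp_all add: algebra_simps power2_eq_square)
    thus "(?F has_vector_derivative exp (- a * t) * cos (w * a)) (at a within {0..1})"
      by (simp only: has_real_derivative_iff_has_vector_derivative)
  qed simp
  also have "?F 1 - ?F 0 = t * (1 - exp (- t)) / (t\<^sup>2 + w\<^sup>2)"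
    using w by (simp add: divide_simps) (simp add: algebra_simps)
  finally show "((\<lambda>a. exp (- a * t) * cos (w * a)) has_integral t * (1 - exp (- t)) / (t\<^sup>2 + w\<^sup>2)) {0..1}" .
  let ?F = "\<lambda>a. exp (- a * t) * (- t * sin (w * a) - w * cos (w * a)) / (t\<^sup>2 + w\<^sup>2)"
  have "((\<lambda>a. exp (- a * t) * sin (w * a)) has_integral ?F 1 - ?F 0) {0..1}"
  proof (intro fundamental_theorem_of_calculus)
    fix a :: real
    have "(?F has_real_derivative exp (- a * t) * sin (w * a)) (at a within {0..1})"
      using pos by (auto intro!: derivative_eq_intros simp: divide_simps) (simp_all add: algebra_simps power2_eq_square)
    thus "(?F has_vector_derivative exp (- a * t) * sin (w * a)) (at a within {0..1})"
      by (simp only: has_real_derivative_iff_has_vector_derivative)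
  qed simp
  also have "?F 1 - ?F 0 = w * (1 - exp (- t)) / (t\<^sup>2 + w\<^sup>2)"
    using w by (simp add: divide_simps) (simp add: algebra_simps)
  finally show "((\<lambda>a. exp (- a * t) * sin (w * a)) has_integral w * (1 - exp (- t)) / (t\<^sup>2 + w\<^sup>2)) {0..1}" .
qed

definition mlterm :: "real \<Rightarrow> nat \<Rightarrow> real \<Rightarrow> real" where
  "mlterm a m t = (let w = 2 * pi * real (Suc m) in
     cos (w * a) * (2 * t / (t\<^sup>2 + w\<^sup>2)) - sin (w * a) * (2 * t\<^sup>2 / (w * (t\<^sup>2 + w\<^sup>2))))"

text \<open>Subtracting \<open>1 / t\<close> removes the mean over \<open>a\<close>, and adding
  \<open>a - 1/2\<close> removes the jump between \<open>a = 0\<close> and \<open>a = 1\<close>. The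
  sine coefficients then decay like \<open>1 / w ^ 3\<close> instead of \<open>1 / w\<close>, so
  \<open>fourier_series\<close> applies, endpoints included.\<close>

theorem mittag_leffler_exp:
  assumes a: "0 \<le> a" "a \<le> 1" and t: "t > 0"
  shows "(\<lambda>m. mlterm a m t) sums (exp (- a * t) / (1 - exp (- t)) - 1 / t - (1/2 - a))"
proof -
  define E where "E = 1 - exp (- t)"
  have E: "E > 0" using t by (simp add: E_def)
  define w where "w = (\<lambda>m. 2 * pi * real (Suc m))"
  have w: "w m > 0" "sin (w m) = 0" "cos (w m) = 1" for m
    using cos_int_2pin[of "int (Suc m)"] sin_int_2pin[of "int (Suc m)"] by (auto simp: w_def simp del: of_nat_Suc)
  have pos: "t\<^sup>2 + (w m)\<^sup>2 > 0" for m using t by (simp add: add_pos_nonneg)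
  define f where "f = (\<lambda>a. exp (- a * t) / E - 1 / t - (1/2 - a))"
  have IB: "((\<lambda>a. bernpoly 1 a) has_integral 0) {0..1}"
    by (rule has_integral_bernpoly) simp
  \<comment> \<open>The mean value is the cosine integral at frequency 0.\<close>
  have I1: "((\<lambda>a. exp (- a * t)) has_integral E / t) {0..1}"
    using has_integral_exp_cos_sin(1)[OF t, of 0] t by (simp add: E_def power2_eq_square)
  have f_eq: "f = (\<lambda>a. (1 / E) * exp (- a * t) + bernpoly 1 a - 1 / t)"
    by (auto simp: f_def bernpoly_1)
  have I: "(f has_integral 0) {0..1}"
  proof -
    have "(f has_integral (1 / E) * (E / t) + 0 - 1 / t) {0..1}"
      unfolding f_eq using has_integral_const_real[of "1 / t" 0 1]
      by (intro has_integral_diff has_integral_add has_integral_mult_right I1 IB) simp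
    thus ?thesis using E by simp
  qed
  have Bc: "((\<lambda>a. bernpoly 1 a * cos (w m * a)) has_integral 0) {0..1}"
   and Bs: "((\<lambda>a. bernpoly 1 a * sin (w m * a)) has_integral - 1 / w m) {0..1}" for m
  proof -
    let ?F = "\<lambda>a. bernpoly 1 a * sin (w m * a) / w m + cos (w m * a) / (w m)\<^sup>2"
    have "((\<lambda>a. bernpoly 1 a * cos (w m * a)) has_integral ?F 1 - ?F 0) {0..1}"
    proof (intro fundamental_theorem_of_calculus)
      fix a :: real
      have "(?F has_real_derivative bernpoly 1 a * cos (w m * a)) (at a within {0..1})"
        using w(1)[of m] unfolding One_nat_def bernpoly_1
        by (auto intro!: derivative_eq_intros simp: divide_simps power2_eq_square)
      thus "(?F has_vector_derivative bernpoly 1 a * cos (w m * a)) (at a within {0..1})"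
        by (simp only: has_real_derivative_iff_has_vector_derivative)
    qed simp
    thus "((\<lambda>a. bernpoly 1 a * cos (w m * a)) has_integral 0) {0..1}" by (simp add: w)
    let ?F = "\<lambda>a. - bernpoly 1 a * cos (w m * a) / w m + sin (w m * a) / (w m)\<^sup>2"
    have "((\<lambda>a. bernpoly 1 a * sin (w m * a)) has_integral ?F 1 - ?F 0) {0..1}"
    proof (intro fundamental_theorem_of_calculus)
      fix a :: real
      have "(?F has_real_derivative bernpoly 1 a * sin (w m * a)) (at a within {0..1})"
        using w(1)[of m] unfolding One_nat_def bernpoly_1
        by (auto intro!: derivative_eq_intros simp: divide_simps power2_eq_square)
      thus "(?F has_vector_derivative bernpoly 1 a * sin (w m * a)) (at a within {0..1})"
        by (simp only: has_real_derivative_iff_has_vector_derivative)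
    qed simp
    thus "((\<lambda>a. bernpoly 1 a * sin (w m * a)) has_integral - 1 / w m) {0..1}"
      by (simp add: w bernpoly_1 field_simps)
  qed
  define c where "c = (\<lambda>m. 2 * t / (t\<^sup>2 + (w m)\<^sup>2))"
  define s where "s = (\<lambda>m. - (2 * t\<^sup>2 / (w m * (t\<^sup>2 + (w m)\<^sup>2))))"
  have inv: "1 / (t\<^sup>2 + (w m)\<^sup>2) \<le> real (Suc m) powr - 2" for m
  proof -
    have "1 * real (Suc m) \<le> (2 * pi) * real (Suc m)"
      using pi_gt3 by (intro mult_right_mono) auto
    hence "(real (Suc m))\<^sup>2 \<le> (w m)\<^sup>2"
      unfolding w_def by (intro power_mono) auto
    also have "\<dots> \<le> t\<^sup>2 + (w m)\<^sup>2" by simp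
    finally show ?thesis
      by (simp add: powr_minus powr_realpow[of "real (Suc m)" 2, simplified] field_simps del: of_nat_Suc)
         (simp add: divide_simps add_pos_nonneg t pos)
  qed
  have w1: "w m \<ge> 1" for m using mult_mono[of 1 "2 * pi" 1 "real (Suc m)"] pi_gt3 by (simp add: w_def)
  have sumc: "summable (\<lambda>m. \<bar>c m\<bar>)"
  proof (rule summable_comparison_test')
    show "summable (\<lambda>m. 2 * t * real (Suc m) powr - 2)"
      by (intro summable_mult summable_shifted_powr) simp
    show "norm \<bar>c m\<bar> \<le> 2 * t * real (Suc m) powr - 2" for m
      using mult_left_mono[OF inv[of m], of "2 * t"] t pos[of m] by (simp add: c_def)
  qed
  have sums: "summable (\<lambda>m. \<bar>s m\<bar>)"
  proof (rule summable_comparison_test')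
    show "summable (\<lambda>m. 2 * t\<^sup>2 * real (Suc m) powr - 2)"
      by (intro summable_mult summable_shifted_powr) simp
    show "norm \<bar>s m\<bar> \<le> 2 * t\<^sup>2 * real (Suc m) powr - 2" for m
    proof -
      have "norm \<bar>s m\<bar> = 2 * t\<^sup>2 * (1 / (t\<^sup>2 + (w m)\<^sup>2)) / w m"
        using w(1)[of m] pos[of m] by (simp add: s_def abs_mult)
      also have "\<dots> \<le> 2 * t\<^sup>2 * (1 / (t\<^sup>2 + (w m)\<^sup>2))"
        using w1[of m] pos[of m] by (intro mult_imp_div_pos_le mult_le_cancel_left1[THEN iffD2]) (auto simp: divide_less_0_iff)
      also have "\<dots> \<le> 2 * t\<^sup>2 * real (Suc m) powr - 2" by (intro mult_left_mono inv) auto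
      finally show ?thesis .
    qed
  qed
  have "(\<lambda>m. c m * cos (2 * pi * real (Suc m) * a) + s m * sin (2 * pi * real (Suc m) * a)) sums f a"
  proof (rule fourier_series[OF _ I _ _ sumc sums])
    show "continuous_on {0..1} f" unfolding f_def using E by (auto intro!: continuous_intros)
    show "((\<lambda>x. f x * cos (2 * pi * real (Suc m) * x)) has_integral c m / 2) {0..1}" for m
    proof -
      have "((\<lambda>x. (1 / E) * (exp (- x * t) * cos (w m * x)) + bernpoly 1 x * cos (w m * x) - (1 / t) * cos (w m * x))
          has_integral ((1 / E) * (t * (1 - exp (- t)) / (t\<^sup>2 + (w m)\<^sup>2)) + 0 - (1 / t) * 0)) {0..1}"
        using has_integral_cos_period[of "int (Suc m)"]
        by (intro has_integral_diff has_integral_add has_integral_mult_right Bc has_integral_exp_cos_sin t w) (simp add: w_def)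
      moreover have "(1 / E) * (t * (1 - exp (- t)) / (t\<^sup>2 + (w m)\<^sup>2)) + 0 - (1 / t) * 0 = c m / 2"
        using E pos[of m] by (simp add: E_def[symmetric] c_def divide_simps)
      moreover have "(1 / E) * (exp (- x * t) * cos (w m * x)) + bernpoly 1 x * cos (w m * x) - (1 / t) * cos (w m * x)
          = f x * cos (2 * pi * real (Suc m) * x)" for x
        by (simp only: f_eq w_def left_diff_distrib distrib_right mult.assoc)
      ultimately show ?thesis by (simp only:)
    qed
    show "((\<lambda>x. f x * sin (2 * pi * real (Suc m) * x)) has_integral s m / 2) {0..1}" for m
    proof -
      have "((\<lambda>x. (1 / E) * (exp (- x * t) * sin (w m * x)) + bernpoly 1 x * sin (w m * x) - (1 / t) * sin (w m * x))
          has_integral ((1 / E) * (w m * (1 - exp (- t)) / (t\<^sup>2 + (w m)\<^sup>2)) + (- 1 / w m) - (1 / t) * 0)) {0..1}"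
        using has_integral_sin_period[of "int (Suc m)"]
        by (intro has_integral_diff has_integral_add has_integral_mult_right Bs has_integral_exp_cos_sin t w) (simp add: w_def)
      moreover have "(1 / E) * (w m * (1 - exp (- t)) / (t\<^sup>2 + (w m)\<^sup>2)) + (- 1 / w m) - (1 / t) * 0 = s m / 2"
        using E w(1)[of m] pos[of m] by (simp add: E_def[symmetric] s_def divide_simps) (simp add: algebra_simps power2_eq_square)
      moreover have "(1 / E) * (exp (- x * t) * sin (w m * x)) + bernpoly 1 x * sin (w m * x) - (1 / t) * sin (w m * x)
          = f x * sin (2 * pi * real (Suc m) * x)" for x
        by (simp only: f_eq w_def left_diff_distrib distrib_right mult.assoc)
      ultimately show ?thesis by (simp only:)
    qed
  qed (use a in auto)
  thus ?thesis by (simp add: mlterm_def f_def c_def s_def w_def E_def Let_def mult_ac)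
qed

section \<open>Partial fractions over roots of unity\<close>

lemma cis_2pi_int: "cis (2 * pi * of_int k) = 1"
  using cos_int_2pin[of k] sin_int_2pin[of k] by (simp add: complex_eq_iff)

lemma cis_nat_mult_eq_power: "cis (real k * x) = cis x ^ k"
  by (rule Complex.DeMoivre[symmetric])

lemma minus_one_powi_eq_cis: "(- 1) powi j = cis (pi * of_int j)"
proof (cases "even j")
  case True
  then obtain k where "j = 2 * k" by auto
  with True show ?thesis using cis_2pi_int[of k] by (simp add: mult_ac)
next
  case False
  then obtain k where k: "j = 2 * k + 1" by (auto elim: oddE)
  have "cis (pi * of_int j) = cis (2 * pi * of_int k) * cis pi"
    unfolding cis_mult k by (simp add: algebra_simps)
  with False show ?thesis by (simp add: cis_2pi_int)
qed

lemma sum_symmetric_interval: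
  "(\<Sum>j\<in>{- int M..int M}. f j) = (\<Sum>k<2 * M + 1. f (int k - int M))"
  by (rule sum.reindex_bij_witness[of _ "\<lambda>k. int k - int M" "\<lambda>j. nat (j + int M)"]) auto

lemma sum_roots_of_unity:
  fixes l :: int
  assumes N: "N = 2 * M + 1"
  shows "(\<Sum>j\<in>{- int M..int M}. cis (2 * pi * of_int l * of_int j / real N)) = (if int N dvd l then of_nat N else 0)"
proof -
  define w where "w = cis (2 * pi * of_int l / real N)"
  have N0: "N > 0" using N by simp
  have wN: "w ^ N = 1"
  proof -
    have "w ^ N = cis (2 * pi * of_int l)"
      unfolding w_def cis_nat_mult_eq_power[symmetric] using N0 by simp
    thus ?thesis using cos_int_2pin[of l] sin_int_2pin[of l] by (simp add: complex_eq_iff)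
  qed
  have "(\<Sum>j\<in>{- int M..int M}. cis (2 * pi * of_int l * of_int j / real N))
      = (\<Sum>k<N. cis (- (2 * pi * of_int l / real N) * real M) * w ^ k)"
    unfolding sum_symmetric_interval N[symmetric]
  proof (rule sum.cong)
    fix k
    show "cis (2 * pi * of_int l * of_int (int k - int M) / real N)
        = cis (- (2 * pi * of_int l / real N) * real M) * w ^ k"
      unfolding w_def cis_nat_mult_eq_power[symmetric] cis_mult by (simp add: field_simps diff_divide_distrib)
  qed simp
  also have "\<dots> = cis (- (2 * pi * of_int l / real N) * real M) * (\<Sum>k<N. w ^ k)"
    by (simp add: sum_distrib_left)
  also have "\<dots> = (if int N dvd l then of_nat N else 0)"
  proof (cases "int N dvd l")
    case True
    then obtain c where c: "l = int N * c" by auto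
    hence "w = 1"
      using N0 cis_2pi_int[of c] by (simp add: w_def mult_ac)
    moreover have "cis (- (2 * pi * of_int l / real N) * real M) = 1"
      using N0 cos_int_2pin[of "- c * int M"] sin_int_2pin[of "- c * int M"] by (simp add: c complex_eq_iff mult_ac)
    ultimately show ?thesis using True by simp
  next
    case False
    have "w \<noteq> 1"
    proof
      assume "w = 1"
      hence "cos (2 * pi * of_int l / real N) = 1" by (simp add: w_def complex_eq_iff)
      then obtain c :: int where "2 * pi * of_int l / real N = of_int c * 2 * pi"
        using cos_one_2pi_int by auto
      hence "real_of_int l = of_int (c * int N)" using N0 by (simp add: field_simps)
      hence "l = c * int N" using of_int_eq_iff by blast
      with False show False by simp
    qed
    thus ?thesis using False wN by (simp add: geometric_sum)
  qed
  finally show ?thesis .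
qed

text \<open>As the \<open>N\<close>-th power of each root is 1, \<open>1 / (1 - q w)\<close> is a
  finite geometric sum over \<open>l < N\<close> divided by \<open>1 - q ^ N\<close>; orthogonality
  of the roots of unity then retains the single exponent \<open>l = N - p\<close>.\<close>

lemma sum_partial_fractions_roots_of_unity:
  fixes q :: complex
  assumes N: "N = 2 * M + 1" and p: "1 \<le> p" "p \<le> N" and q: "q ^ N \<noteq> 1"
  shows "(\<Sum>j\<in>{- int M..int M}. cis (2 * pi * of_int j * real p / real N) / (1 - q * cis (2 * pi * of_int j / real N)))
          = of_nat N * q ^ (N - p) / (1 - q ^ N)"
proof -
  have N0: "N > 0" using N by simp
  define w where "w = (\<lambda>j::int. cis (2 * pi * of_int j / real N))"
  let ?p = "\<lambda>j. cis (2 * pi * of_int j * real p / real N)"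
    and ?lp = "\<lambda>l j. cis (2 * pi * of_int (int (l + p)) * of_int j / real N)"
  have wN: "w j ^ N = 1" for j
  proof -
    have "w j ^ N = cis (2 * pi * of_int j)"
      unfolding w_def cis_nat_mult_eq_power[symmetric] using N0 by simp
    thus ?thesis using cos_int_2pin[of j] sin_int_2pin[of j] by (simp add: complex_eq_iff)
  qed
  have "(\<Sum>j\<in>{- int M..int M}. ?p j / (1 - q * w j))
      = (\<Sum>j\<in>{- int M..int M}. (\<Sum>l<N. q ^ l * ?lp l j) / (1 - q ^ N))"
  proof (rule sum.cong)
    fix j
    have ne: "q * w j \<noteq> 1"
    proof
      assume "q * w j = 1"
      hence "(q * w j) ^ N = 1" by simp
      thus False using q wN by (simp add: power_mult_distrib)
    qed
    have "(\<Sum>l<N. (q * w j) ^ l) = (1 - q ^ N) / (1 - q * w j)"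
      using ne wN[of j] by (subst geometric_sum) (auto simp: power_mult_distrib divide_simps, simp_all add: algebra_simps)
    hence "1 / (1 - q * w j) = (\<Sum>l<N. (q * w j) ^ l) / (1 - q ^ N)"
      using q ne by (simp add: field_simps)
    hence "?p j / (1 - q * w j)
        = ?p j * ((\<Sum>l<N. (q * w j) ^ l) / (1 - q ^ N))"
      by (metis mult.right_neutral times_divide_eq_right)
    also have "\<dots> = (\<Sum>l<N. ?p j * (q * w j) ^ l) / (1 - q ^ N)"
      by (simp add: sum_distrib_left)
    also have "(\<Sum>l<N. ?p j * (q * w j) ^ l)
        = (\<Sum>l<N. q ^ l * ?lp l j)"
    proof (rule sum.cong)
      fix l
      have "?p j * w j ^ l = ?lp l j"
        unfolding w_def cis_nat_mult_eq_power[symmetric] cis_mult by (simp add: field_simps add_divide_distrib)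
      thus "?p j * (q * w j) ^ l
          = q ^ l * ?lp l j"
        by (simp add: power_mult_distrib mult_ac)
    qed simp
    finally show "?p j / (1 - q * w j)
        = (\<Sum>l<N. q ^ l * ?lp l j) / (1 - q ^ N)" .
  qed simp
  also have "\<dots> = (\<Sum>l<N. q ^ l * (\<Sum>j\<in>{- int M..int M}. ?lp l j)) / (1 - q ^ N)"
    by (subst sum_distrib_left, subst sum.swap) (simp add: sum_divide_distrib)
  also have "(\<Sum>l<N. q ^ l * (\<Sum>j\<in>{- int M..int M}. ?lp l j))
      = (\<Sum>l<N. if l = N - p then q ^ l * of_nat N else 0)"
  proof (rule sum.cong)
    fix l assume l: "l \<in> {..<N}"
    \<comment> \<open>From \<open>l < N\<close> and \<open>1 \<le> p \<le> N\<close> it follows that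
      \<open>l + p\<close> lies strictly between 0 and \<open>2 * N\<close>, where \<open>N\<close>
      is the only multiple of \<open>N\<close>.\<close>
    have "int N dvd int (l + p) \<longleftrightarrow> l = N - p"
    proof
      assume "int N dvd int (l + p)"
      hence "N dvd l + p" by (simp only: int_dvd_int_iff)
      then obtain c where c: "l + p = N * c" by auto
      have "c < 2"
      proof (rule ccontr)
        assume "\<not> c < 2"
        hence "N * 2 \<le> N * c" by simp
        moreover have "l + p < N * 2" using l p by simp
        ultimately show False using c by simp
      qed
      moreover have "c \<noteq> 0" using c p by (cases c) auto
      ultimately have "c = 1" by simp
      with c show "l = N - p" by simp
    next
      assume "l = N - p"
      hence "l + p = N" using p by simp
      thus "int N dvd int (l + p)" by simp
    qed
    thus "q ^ l * (\<Sum>j\<in>{- int M..int M}. ?lp l j)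
        = (if l = N - p then q ^ l * of_nat N else 0)"
      unfolding sum_roots_of_unity[OF N] by simp
  qed simp
  also have "\<dots> = of_nat N * q ^ (N - p)" using p by (simp add: mult_ac)
  finally show ?thesis by (simp add: w_def)
qed

lemma sum_alternating_symmetric: "(\<Sum>j\<in>{- int M..int M}. (- 1) powi j) = ((- 1) ^ M :: complex)"
proof (induction M)
  case (Suc M)
  have "{- int (Suc M)..int (Suc M)} = insert (int (Suc M)) (insert (- int (Suc M)) {- int M..int M})"
    by auto
  moreover have "(- 1) powi (- int (Suc M)) = (- 1 :: complex) ^ Suc M"
    by (simp only: power_int_minus power_int_of_nat) (cases "even M"; simp)
  ultimately show ?case using Suc.IH by (simp add: power_int_of_nat del: of_nat_Suc)
qed simp

text \<open>The squares \<open>z j ^ 2\<close> are \<open>R^2\<close> times the \<open>N\<close>-th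
  roots of unity, so both sums are cases of \<open>sum_partial_fractions_roots_of_unity\<close> with
  \<open>q = - R^2 / u^2\<close>: the exponent is \<open>p = N\<close> in the first and
  \<open>p = M + 1\<close> in the second. Since \<open>N\<close> is odd, \<open>q ^ N\<close> is
  negative and hence different from 1.\<close>

lemma partial_fractions_real:
  fixes u W :: real
  assumes N: "N = 2 * M + 1" and u: "u > 0" and W: "W > 0"
  defines "z \<equiv> \<lambda>j::int. of_real (W powr (1 / real N)) * cis (pi * of_int j / real N)"
  shows "(\<Sum>j\<in>{- int M..int M}. of_real u / (of_real u ^ 2 + z j ^ 2))
          = of_real (real N * u ^ (2 * N - 1) / (u ^ (2 * N) + W\<^sup>2))" (is ?A)
    and "(\<Sum>j\<in>{- int M..int M}. (- 1) powi j * z j / (of_real u ^ 2 + z j ^ 2))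
          = of_real ((- 1) ^ M * real N * W * u ^ (N - 1) / (u ^ (2 * N) + W\<^sup>2))" (is ?B)
proof -
  have N0: "N > 0" using N by simp
  define R where "R = W powr (1 / real N)"
  have R: "R > 0" using W by (simp add: R_def)
  have RN: "R ^ N = W"
    using W N0 by (simp add: R_def powr_realpow[symmetric] powr_powr)
  define q where "q = - (R\<^sup>2 / u\<^sup>2)"
  let ?e = "\<lambda>j. 1 - complex_of_real q * cis (2 * pi * of_int j / real N)" and ?d = "u ^ (2 * N) + W\<^sup>2"
  have qN: "q ^ N = - (W\<^sup>2 / u ^ (2 * N))"
  proof -
    have "q ^ N = - ((R ^ N)\<^sup>2 / (u\<^sup>2) ^ N)"
    proof -
      have "q ^ N = - ((R\<^sup>2 / u\<^sup>2) ^ N)"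
        unfolding q_def by (rule power_minus_odd) (simp add: N)
      thus ?thesis by (simp only: power_divide power_mult[symmetric] mult.commute)
    qed
    thus ?thesis unfolding RN by (simp only: power_mult)
  qed
  have "q ^ N < 0" unfolding qN using W u by simp
  hence q1: "complex_of_real q ^ N \<noteq> 1"
    by (metis less_numeral_extra(1) not_less_iff_gr_or_eq of_real_eq_1_iff of_real_power order_less_trans zero_less_one)
  have den: "of_real u ^ 2 + z j ^ 2 = of_real (u\<^sup>2) * (?e j)" for j
  proof -
    have "z j ^ 2 = of_real (R\<^sup>2) * cis (2 * pi * of_int j / real N)"
      unfolding z_def R_def power_mult_distrib cis_nat_mult_eq_power[symmetric] by (simp add: mult_ac)
    thus ?thesis using u by (simp add: q_def field_simps)
  qed
  have cis1: "cis (2 * pi * of_int j * real N / real N) = 1" for j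
    using N0 cos_int_2pin[of j] sin_int_2pin[of j] by (simp add: complex_eq_iff)
  have "(\<Sum>j\<in>{- int M..int M}. of_real u / (of_real u ^ 2 + z j ^ 2)) =
     (\<Sum>j\<in>{- int M..int M}. of_real (1 / u) * (cis (2 * pi * of_int j * real N / real N) / (?e j)))"
    unfolding den cis1 using u by (intro sum.cong refl) (simp add: power2_eq_square)
  also have "\<dots> = of_real (1 / u) * (of_nat N * of_real q ^ (N - N) / (1 - of_real q ^ N))"
    unfolding sum_distrib_left[symmetric]
    by (subst sum_partial_fractions_roots_of_unity[OF N _ _ q1]) (use N0 in auto)
  also have "\<dots> = of_real (1 / u * (real N / (1 - q ^ N)))" by simp
  also have "1 / u * (real N / (1 - q ^ N)) = real N * u ^ (2 * N - 1) / (?d)"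
  proof -
    have "u ^ (2 * N) = u * u ^ (2 * N - 1)" using N0 by (simp flip: power_Suc)
    moreover have "?d > 0" using u by (simp add: add_pos_nonneg)
    ultimately show ?thesis unfolding qN using u by (simp add: divide_simps)
  qed
  finally show ?A .
  \<comment> \<open>The sign contributes the angle \<open>pi * j\<close>, and
    \<open>pi * j + pi * j / N = 2 * pi * j * (M + 1) / N\<close> because
    \<open>N + 1 = 2 * (M + 1)\<close>; so sign and ray together form a power of a root of
    unity.\<close>
  have num: "(- 1) powi j * z j = of_real R * cis (2 * pi * of_int j * real (M + 1) / real N)" for j
  proof -
    have "(- 1) powi j * z j = of_real R * (cis (pi * of_int j) * cis (pi * of_int j / real N))"
      by (simp add: minus_one_powi_eq_cis z_def R_def)
    also have "cis (pi * of_int j) * cis (pi * of_int j / real N) = cis (2 * pi * of_int j * real (M + 1) / real N)"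
      unfolding cis_mult by (rule arg_cong[of _ _ cis]) (simp add: N field_simps)
    finally show ?thesis .
  qed
  have "(\<Sum>j\<in>{- int M..int M}. (- 1) powi j * z j / (of_real u ^ 2 + z j ^ 2)) =
     (\<Sum>j\<in>{- int M..int M}. of_real (R / u\<^sup>2) * (cis (2 * pi * of_int j * real (M + 1) / real N) / (?e j)))"
    unfolding den num using u by (intro sum.cong refl) simp
  also have "\<dots> = of_real (R / u\<^sup>2) * (of_nat N * of_real q ^ (N - (M + 1)) / (1 - of_real q ^ N))"
    unfolding sum_distrib_left[symmetric]
    by (subst sum_partial_fractions_roots_of_unity[OF N _ _ q1]) (use N in auto)
  also have "\<dots> = of_real (R / u\<^sup>2 * (real N * q ^ M / (1 - q ^ N)))" by (simp add: N)
  also have "R / u\<^sup>2 * (real N * q ^ M / (1 - q ^ N)) = (- 1) ^ M * real N * W * u ^ (N - 1) / (?d)"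
  proof -
    have q': "q ^ M = (- 1) ^ M * (R ^ (2 * M) / u ^ (2 * M))"
      unfolding q_def power_mult power_divide[symmetric] by (subst power_minus) simp
    have W': "W = R * R ^ (2 * M)" using RN N by simp
    have u1: "u ^ (2 * N) = u\<^sup>2 * u ^ (2 * M) * u ^ (2 * M)"
      unfolding N power_add[symmetric] by (rule arg_cong[of _ _ "\<lambda>n. u ^ n"]) simp
    have pos: "?d > 0" using u by (simp add: add_pos_nonneg)
    have "1 - q ^ N = (?d) / u ^ (2 * N)" unfolding qN using u by (simp add: field_simps)
    hence "R / u\<^sup>2 * (real N * q ^ M / (1 - q ^ N)) = R / u\<^sup>2 * (real N * q ^ M * u ^ (2 * N) / (?d))"
      by simp
    also have "\<dots> = (R / u\<^sup>2 * real N * q ^ M * u ^ (2 * N)) / (?d)" by simp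
    also have "R / u\<^sup>2 * real N * q ^ M * u ^ (2 * N) = (- 1) ^ M * real N * W * u ^ (2 * M)"
      unfolding q' u1 by (subst W') (use u in \<open>simp add: field_simps\<close>)
    finally show ?thesis by (simp add: N)
  qed
  finally show ?B .
qed

section \<open>Kernel estimates in the right half-plane\<close>

text \<open>With \<open>z = x + i y\<close> and \<open>r = \<bar>z\<bar>\<close>, the squared norm
  is \<open>(u^2 + r^2)^2 - 4 u^2 y^2\<close>; multiplied by \<open>r^2\<close> it exceeds
  \<open>x^2 (u^2 + r^2)^2\<close> by the nonnegative quantity \<open>y^2 (u^2 - r^2)^2\<close>. The
  factor \<open>Re z / norm z\<close> is the cosine of the argument, hence constant along a
  ray.\<close>

lemma norm_square_plus_ge:
  fixes u :: real and z :: complex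
  assumes "Re z > 0"
  shows "norm (of_real u ^ 2 + z ^ 2) \<ge> (Re z / norm z) * (u\<^sup>2 + (norm z)\<^sup>2)"
proof -
  define x y where "x = Re z" and "y = Im z"
  have x: "x > 0" using assms by (simp add: x_def)
  define r where "r = norm z"
  have r: "r > 0" using assms by (auto simp: r_def)
  have r2: "r\<^sup>2 = x\<^sup>2 + y\<^sup>2" by (simp add: r_def cmod_power2 x_def y_def)
  have "((x / r) * (u\<^sup>2 + r\<^sup>2))\<^sup>2 * r\<^sup>2 = x\<^sup>2 * (u\<^sup>2 + r\<^sup>2)\<^sup>2"
    using r by (simp add: power_mult_distrib power_divide)
  also have "\<dots> \<le> (norm (of_real u ^ 2 + z ^ 2))\<^sup>2 * r\<^sup>2"
  proof -
    have z2: "Re (of_real u ^ 2 + z ^ 2) = u\<^sup>2 + x\<^sup>2 - y\<^sup>2" "Im (of_real u ^ 2 + z ^ 2) = 2 * x * y"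
      by (simp_all add: x_def y_def power2_eq_square)
    have "(norm (of_real u ^ 2 + z ^ 2))\<^sup>2 = (u\<^sup>2 + x\<^sup>2 - y\<^sup>2)\<^sup>2 + (2 * x * y)\<^sup>2"
      unfolding cmod_power2 z2 ..
    also have "\<dots> = (u\<^sup>2 + r\<^sup>2)\<^sup>2 - 4 * u\<^sup>2 * y\<^sup>2"
      unfolding r2 by (simp add: power2_eq_square algebra_simps)
    finally have eq: "(norm (of_real u ^ 2 + z ^ 2))\<^sup>2 = (u\<^sup>2 + r\<^sup>2)\<^sup>2 - 4 * u\<^sup>2 * y\<^sup>2" .
    have "0 \<le> y\<^sup>2 * (u\<^sup>2 - r\<^sup>2)\<^sup>2" by simp
    also have "\<dots> = ((u\<^sup>2 + r\<^sup>2)\<^sup>2 - 4 * u\<^sup>2 * y\<^sup>2) * r\<^sup>2 - (r\<^sup>2 - y\<^sup>2) * (u\<^sup>2 + r\<^sup>2)\<^sup>2"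
      by (simp add: power2_eq_square algebra_simps)
    also have "r\<^sup>2 - y\<^sup>2 = x\<^sup>2" using r2 by simp
    finally show ?thesis unfolding eq by simp
  qed
  finally have "((x / r) * (u\<^sup>2 + r\<^sup>2))\<^sup>2 \<le> (norm (of_real u ^ 2 + z ^ 2))\<^sup>2"
    using r by (simp add: mult_le_cancel_right)
  thus ?thesis unfolding x_def[symmetric] r_def[symmetric] by (rule power2_le_imp_le) simp
qed

lemma square_plus_nonzero: "Re z > 0 \<Longrightarrow> of_real u ^ 2 + z ^ 2 \<noteq> (0::complex)"
proof -
  assume z: "Re z > 0"
  hence "norm z > 0" by auto
  hence "0 < (Re z / norm z) * (u\<^sup>2 + (norm z)\<^sup>2)"
    using z by (intro mult_pos_pos divide_pos_pos add_nonneg_pos) auto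
  also have "\<dots> \<le> norm (of_real u ^ 2 + z ^ 2)" by (rule norm_square_plus_ge[OF z])
  finally show ?thesis by (simp only: zero_less_norm_iff) simp
qed

lemma kernel_diff_bound_aux:
  fixes n u :: real and z c :: complex
  assumes z: "Re z > 0" and u: "0 \<le> n - 1" "n - 1 \<le> u" "u \<le> n"
    and c: "norm c \<le> n\<^sup>2 + (norm z)\<^sup>2"
  shows "norm (c / ((of_real n ^ 2 + z ^ 2) * (of_real u ^ 2 + z ^ 2)))
          \<le> (norm z / Re z)\<^sup>2 / ((n - 1)\<^sup>2 + (norm z)\<^sup>2)"
proof -
  define k where "k = Re z / norm z"
  have nz: "norm z > 0" using z by auto
  have k: "k > 0" using z nz by (simp add: k_def)
  have p: "v\<^sup>2 + (norm z)\<^sup>2 > 0" for v :: real using nz by (simp add: add_nonneg_pos)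
  have "(n - 1)\<^sup>2 \<le> u\<^sup>2" using u by (intro power_mono) auto
  hence le: "(n - 1)\<^sup>2 + (norm z)\<^sup>2 \<le> u\<^sup>2 + (norm z)\<^sup>2" by simp
  have "norm (c / ((of_real n ^ 2 + z ^ 2) * (of_real u ^ 2 + z ^ 2)))
      \<le> (n\<^sup>2 + (norm z)\<^sup>2) / ((k * (n\<^sup>2 + (norm z)\<^sup>2)) * (k * ((n - 1)\<^sup>2 + (norm z)\<^sup>2)))"
    unfolding norm_divide norm_mult
  proof (intro frac_le mult_mono c)
    show "k * (n\<^sup>2 + (norm z)\<^sup>2) \<le> norm (of_real n ^ 2 + z ^ 2)"
      unfolding k_def by (rule norm_square_plus_ge[OF z])
    have "k * ((n - 1)\<^sup>2 + (norm z)\<^sup>2) \<le> k * (u\<^sup>2 + (norm z)\<^sup>2)"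
      using le k by (intro mult_left_mono) auto
    also have "\<dots> \<le> norm (of_real u ^ 2 + z ^ 2)"
      unfolding k_def by (rule norm_square_plus_ge[OF z])
    finally show "k * ((n - 1)\<^sup>2 + (norm z)\<^sup>2) \<le> norm (of_real u ^ 2 + z ^ 2)" .
  qed (use k p in \<open>auto intro!: mult_pos_pos less_imp_le\<close>)
  also have "\<dots> = (1 / k)\<^sup>2 / ((n - 1)\<^sup>2 + (norm z)\<^sup>2)"
  proof -
    have "A / ((k * A) * (k * B)) = (1 / k)\<^sup>2 / B" if "A > 0" "B > 0" for A B
      using k that by (simp add: divide_simps power2_eq_square)
    from this[OF p p] show ?thesis .
  qed
  finally show ?thesis by (simp add: k_def)
qed

text \<open>Over the common denominator, \<open>n - u \<le> 1\<close> keeps the numerator below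
  \<open>n^2 + \<bar>z\<bar>^2\<close>. This cancels the quadratic factor at \<open>n\<close>, and
  the factor at \<open>u\<close> is estimated at the left endpoint \<open>n - 1\<close>.\<close>

lemma kernel_diff_bound:
  fixes n u :: real and z :: complex
  assumes z: "Re z > 0" and u: "0 \<le> n - 1" "n - 1 \<le> u" "u \<le> n"
  shows "norm (of_real n / (of_real n ^ 2 + z ^ 2) - of_real u / (of_real u ^ 2 + z ^ 2))
          \<le> (norm z / Re z)\<^sup>2 / ((n - 1)\<^sup>2 + (norm z)\<^sup>2)" (is ?A)
    and "norm (z / (of_real n ^ 2 + z ^ 2) - z / (of_real u ^ 2 + z ^ 2))
          \<le> (norm z / Re z)\<^sup>2 / ((n - 1)\<^sup>2 + (norm z)\<^sup>2)" (is ?B)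
proof -
  note nz = square_plus_nonzero[OF z, of n] square_plus_nonzero[OF z, of u]
  have nu: "0 \<le> n - u" "n - u \<le> 1" "0 \<le> u" "0 \<le> n" using u by auto
  let ?n = "complex_of_real n ^ 2 + z ^ 2" and ?u = "complex_of_real u ^ 2 + z ^ 2"
  have "of_real n / ?n - of_real u / ?u
     = (of_real (n - u) * (z ^ 2 - of_real (n * u))) / (?n * ?u)"
    using nz by (simp add: divide_simps) (simp add: algebra_simps power2_eq_square)
  moreover have "norm (of_real (n - u) * (z ^ 2 - of_real (n * u))) \<le> n\<^sup>2 + (norm z)\<^sup>2"
  proof -
    have "norm (of_real (n - u) * (z ^ 2 - of_real (n * u))) = (n - u) * norm (z ^ 2 - of_real (n * u))"
      using nu by (simp only: norm_mult norm_of_real abs_of_nonneg)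
    also have "\<dots> \<le> 1 * ((norm z)\<^sup>2 + n * u)"
      using nu norm_triangle_ineq4[of "z ^ 2" "of_real (n * u)"]
      by (intro mult_mono) (auto simp: norm_power norm_mult)
    also have "\<dots> \<le> 1 * ((norm z)\<^sup>2 + n * n)" using u nu by (intro mult_left_mono add_left_mono) auto
    finally show ?thesis by (simp add: power2_eq_square)
  qed
  ultimately show ?A using kernel_diff_bound_aux[OF z u] by metis
  have "z / ?n - z / ?u
     = (z * of_real ((u - n) * (u + n))) / (?n * ?u)"
    using nz by (simp add: divide_simps) (simp add: algebra_simps power2_eq_square)
  moreover have "norm (z * of_real ((u - n) * (u + n))) \<le> n\<^sup>2 + (norm z)\<^sup>2"
  proof -
    have "norm (z * of_real ((u - n) * (u + n))) = norm z * ((n - u) * (u + n))"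
      using nu by (simp only: norm_mult norm_of_real abs_mult abs_of_nonneg abs_minus_commute[of u n] add_nonneg_nonneg)
    also have "\<dots> \<le> norm z * (1 * (n + n))" using u nu by (intro mult_left_mono mult_mono) auto
    also have "\<dots> \<le> n\<^sup>2 + (norm z)\<^sup>2" using sum_squares_bound[of n "norm z"] by (simp add: algebra_simps)
    finally show ?thesis .
  qed
  ultimately show ?B using kernel_diff_bound_aux[OF z u] by metis
qed

text \<open>Half a power of decay in \<open>p\<close> is given up in order to keep decay in the
  modulus of the ray. The case \<open>p = 0\<close> is separate because
  \<open>0 powr - (3/2)\<close> is 0 and could not dominate the first interval.\<close>

definition tail_weight :: "nat \<Rightarrow> real" where
  "tail_weight p = (if p = 0 then 1 else real p powr - (3/2))"

lemma tail_weight_nonneg: "tail_weight p \<ge> 0"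
  by (simp add: tail_weight_def)

lemma summable_tail_weight: "summable tail_weight"
proof -
  have "summable (\<lambda>p. tail_weight (Suc p))"
    unfolding tail_weight_def using summable_shifted_powr[of "3/2"] by simp
  thus ?thesis by (simp only: summable_Suc_iff)
qed

text \<open>The square of the larger of \<open>p\<close> and \<open>r\<close> already dominates
  \<open>r powr (1/2) * p powr (3/2)\<close>. Of the two powers of \<open>r\<close>, the exponent
  \<open>- 2\<close> serves \<open>p = 0\<close> and the exponent \<open>- (1/2)\<close> serves
  \<open>p > 0\<close>.\<close>

lemma inverse_sum_squares_le_tail_weight:
  fixes r :: real
  assumes r: "r > 0"
  shows "1 / ((real p)\<^sup>2 + r\<^sup>2) \<le> (r powr - 2 + r powr - (1/2)) * tail_weight p"
proof (cases "p = 0")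
  case True
  have "r powr - 2 = 1 / r\<^sup>2" using r by (simp add: powr_minus divide_inverse)
  with True show ?thesis by (simp add: tail_weight_def)
next
  case False
  hence p: "real p > 0" by simp
  have "r powr (1/2) * real p powr (3/2) \<le> (real p)\<^sup>2 + r\<^sup>2"
  proof (cases "r \<le> real p")
    case True
    have "r powr (1/2) * real p powr (3/2) \<le> real p powr (1/2) * real p powr (3/2)"
      using True r by (intro mult_right_mono powr_mono2) auto
    also have "\<dots> = (real p)\<^sup>2" using p by (simp add: powr_add[symmetric])
    finally show ?thesis by (simp add: add_increasing2)
  next
    case False
    have "r powr (1/2) * real p powr (3/2) \<le> r powr (1/2) * r powr (3/2)"
      using False r by (intro mult_left_mono powr_mono2) auto
    also have "\<dots> = r\<^sup>2" using r by (simp add: powr_add[symmetric])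
    finally show ?thesis by (simp add: add_increasing)
  qed
  hence "1 / ((real p)\<^sup>2 + r\<^sup>2) \<le> 1 / (r powr (1/2) * real p powr (3/2))"
    using r p by (intro divide_left_mono) (auto simp: add_pos_nonneg)
  also have "\<dots> = r powr - (1/2) * real p powr - (3/2)"
    by (simp only: powr_minus_divide) simp
  also have "\<dots> \<le> (r powr - 2 + r powr - (1/2)) * real p powr - (3/2)"
    by (intro mult_right_mono) auto
  finally show ?thesis using False by (simp add: tail_weight_def)
qed

section \<open>Digamma values as regularised sums\<close>

text \<open>Off the integers, an open set, \<open>Gamma w * Gamma (1 - w) * sin (pi * w)\<close> is
  constant by Euler's reflection formula; its derivative, set equal to 0, is the claim.\<close>

lemma Digamma_reflection_complex:
  fixes z :: complex
  assumes z: "z \<notin> \<int>"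
  shows "Digamma (1 - z) - Digamma z = of_real pi * cot (of_real pi * z)"
proof -
  have op: "open (- \<int> :: complex set)" by (intro open_Compl closed_Ints)
  have nz: "z \<notin> \<int>\<^sub>\<le>\<^sub>0" using z by (auto elim!: nonpos_Ints_cases)
  have nz1: "1 - z \<notin> \<int>\<^sub>\<le>\<^sub>0"
  proof
    assume "1 - z \<in> \<int>\<^sub>\<le>\<^sub>0"
    then obtain k where "1 - z = of_int k" by (auto elim!: nonpos_Ints_cases)
    hence "z = of_int (1 - k)" by (simp add: algebra_simps)
    thus False using z Ints_of_int by metis
  qed
  have sin_nz: "sin (of_real pi * w) \<noteq> 0" if "w \<notin> \<int>" for w :: complex
  proof
    assume "sin (of_real pi * w) = 0"
    then obtain k :: int where "of_real pi * w = of_real (of_int k * pi)" using sin_eq_0 by blast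
    hence "w = of_int k" by simp
    thus False using that by simp
  qed
  let ?f = "\<lambda>w::complex. Gamma w * Gamma (1 - w) * sin (of_real pi * w)"
  have "(?f has_field_derivative
      (Gamma z * Digamma z * Gamma (1 - z) - Gamma z * (Gamma (1 - z) * Digamma (1 - z))) * sin (of_real pi * z)
        + Gamma z * Gamma (1 - z) * (of_real pi * cos (of_real pi * z))) (at z)"
    using nz nz1 by (auto intro!: derivative_eq_intros simp: algebra_simps)
  moreover have "(?f has_field_derivative 0) (at z)"
  proof (rule has_field_derivative_transform_within_open[OF _ op])
    show "((\<lambda>_. of_real pi) has_field_derivative 0) (at z)" by simp
    fix w :: complex assume "w \<in> - \<int>"
    thus "of_real pi = ?f w" using sin_nz[of w] by (simp add: Gamma_reflection_complex)
  qed (use z in simp)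
  ultimately have "(Gamma z * Digamma z * Gamma (1 - z) - Gamma z * (Gamma (1 - z) * Digamma (1 - z))) * sin (of_real pi * z)
        + Gamma z * Gamma (1 - z) * (of_real pi * cos (of_real pi * z)) = 0"
    by (rule DERIV_unique)
  hence "Gamma z * Gamma (1 - z) * ((Digamma z - Digamma (1 - z)) * sin (of_real pi * z) + of_real pi * cos (of_real pi * z)) = 0"
    by (simp add: algebra_simps)
  moreover have "Gamma z * Gamma (1 - z) \<noteq> 0" using nz nz1 by (simp add: Gamma_eq_zero_iff)
  ultimately have "(Digamma z - Digamma (1 - z)) * sin (of_real pi * z) + of_real pi * cos (of_real pi * z) = 0"
    by simp
  thus ?thesis using sin_nz[OF z] by (simp add: cot_def field_simps add_eq_0_iff2)
qed

lemma Digamma_imag_plus1: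
  assumes "Re z > 0"
  shows "Digamma (1 + \<i> * z) = Digamma (\<i> * z) + 1 / (\<i> * z)"
    and "Digamma (1 - \<i> * z) = Digamma (- \<i> * z) - 1 / (\<i> * z)"
proof -
  have z: "z \<noteq> 0" using assms by auto
  show "Digamma (1 + \<i> * z) = Digamma (\<i> * z) + 1 / (\<i> * z)"
    using Digamma_plus1[of "\<i> * z"] z by (simp add: add.commute)
  show "Digamma (1 - \<i> * z) = Digamma (- \<i> * z) - 1 / (\<i> * z)"
    using Digamma_plus1[of "- \<i> * z"] z by (simp add: add.commute)
qed

text \<open>The summand is half of \<open>1 / (n + i z) + 1 / (n - i z)\<close>. Starting at
  \<open>n = 1\<close> produces the digamma function at \<open>1 + i z\<close> and
  \<open>1 - i z\<close>; in the sum the two shift terms cancel.\<close>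

lemma tendsto_sum_minus_ln_Digamma:
  assumes z: "Re z > 0"
  shows "(\<lambda>m. (\<Sum>n<m. of_nat (Suc n) / (of_nat (Suc n) ^ 2 + z ^ 2)) - of_real (ln (real m)))
          \<longlonglongrightarrow> - (Digamma (\<i> * z) + Digamma (- \<i> * z)) / 2"
proof -
  have z0: "z \<noteq> 0" using z by auto
  let ?A = "\<lambda>w m. complex_of_real (ln (real m)) - (\<Sum>n<m. inverse (w + of_nat n))"
  have nz: "1 + \<i> * z + of_nat n \<noteq> 0" "1 - \<i> * z + of_nat n \<noteq> 0" for n
    using z by (auto simp: complex_eq_iff)
  have "(\<lambda>m. - (?A (1 + \<i> * z) m
            + ?A (1 - \<i> * z) m) / 2)
      \<longlonglongrightarrow> - (Digamma (1 + \<i> * z) + Digamma (1 - \<i> * z)) / 2"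
    using nz[of 0] by (intro tendsto_intros Digamma_LIMSEQ) auto
  also have "Digamma (1 + \<i> * z) + Digamma (1 - \<i> * z) = Digamma (\<i> * z) + Digamma (- \<i> * z)"
    unfolding Digamma_imag_plus1[OF z] by simp
  also have "(\<lambda>m. - (?A (1 + \<i> * z) m
            + ?A (1 - \<i> * z) m) / 2)
      = (\<lambda>m. (\<Sum>n<m. of_nat (Suc n) / (of_nat (Suc n) ^ 2 + z ^ 2)) - of_real (ln (real m)))"
  proof
    fix m
    have "of_nat (Suc n) / (of_nat (Suc n) ^ 2 + z ^ 2)
      = (inverse (1 + \<i> * z + of_nat n) + inverse (1 - \<i> * z + of_nat n)) / 2" for n
    proof -
      have eq: "of_nat (Suc n) ^ 2 + z ^ 2 = (1 + \<i> * z + of_nat n) * (1 - \<i> * z + of_nat n)"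
        by (simp add: algebra_simps power2_eq_square)
      show ?thesis unfolding eq using nz[of n] by (simp add: divide_simps) (simp add: algebra_simps)
    qed
    hence "(\<Sum>n<m. of_nat (Suc n) / (of_nat (Suc n) ^ 2 + z ^ 2))
        = ((\<Sum>n<m. inverse (1 + \<i> * z + of_nat n)) + (\<Sum>n<m. inverse (1 - \<i> * z + of_nat n))) / 2"
      by (simp only: sum.distrib flip: sum_divide_distrib)
    thus "- (?A (1 + \<i> * z) m
            + ?A (1 - \<i> * z) m) / 2
      = (\<Sum>n<m. of_nat (Suc n) / (of_nat (Suc n) ^ 2 + z ^ 2)) - of_real (ln (real m))"
      by (simp add: field_simps)
  qed
  finally show ?thesis .
qed

text \<open>The same partial fractions with a minus sign: the divergent logarithms cancel, and the
  difference of the digamma values is evaluated by one shift and the reflection formula.\<close>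

lemma sums_inverse_square_plus:
  assumes z: "Re z > 0"
  shows "(\<lambda>n. z / (of_nat (Suc n) ^ 2 + z ^ 2)) sums
          (of_real pi / 2 + of_real pi / (exp (2 * of_real pi * z) - 1) - 1 / (2 * z))"
proof -
  have z0: "z \<noteq> 0" using z by auto
  let ?A = "\<lambda>w m. complex_of_real (ln (real m)) - (\<Sum>n<m. inverse (w + of_nat n))"
  have nz: "1 + \<i> * z + of_nat n \<noteq> 0" "1 - \<i> * z + of_nat n \<noteq> 0" for n
    using z by (auto simp: complex_eq_iff)
  have notint: "\<i> * z \<notin> \<int>" using z by (auto elim!: Ints_cases simp: complex_eq_iff)
  have e1: "exp (2 * of_real pi * z) \<noteq> 1"
  proof
    assume "exp (2 * of_real pi * z) = 1"
    hence "norm (exp (2 * of_real pi * z)) = 1" by simp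
    thus False using z by (simp add: norm_exp_eq_Re)
  qed
  \<comment> \<open>At an argument rotated by \<open>\<i>\<close> the cotangent is a hyperbolic
    cotangent, written so that only \<open>exp (2 * pi * z) - 1\<close> appears, as in the cosine
    series of the theorem.\<close>
  have cot: "cot (of_real pi * (\<i> * z)) = - \<i> * (1 + 2 / (exp (2 * of_real pi * z) - 1))"
  proof -
    define e where "e = exp (of_real pi * z)"
    have e2: "exp (2 * of_real pi * z) = e ^ 2" by (simp add: e_def exp_double[symmetric] mult_ac)
    have e0: "e \<noteq> 0" by (simp add: e_def)
    have e21: "e ^ 2 \<noteq> 1" using e1 e2 by simp
    have i1: "exp (\<i> * (of_real pi * (\<i> * z))) = 1 / e" "exp (- (\<i> * (of_real pi * (\<i> * z)))) = e"
    proof -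
      have "\<i> * (of_real pi * (\<i> * z)) = - (of_real pi * z)"
        by (simp only: mult.left_commute[of \<i> "of_real pi"] complex_i_mult_minus) simp
      thus "exp (\<i> * (of_real pi * (\<i> * z))) = 1 / e" "exp (- (\<i> * (of_real pi * (\<i> * z)))) = e"
        by (simp_all only: e_def exp_minus minus_minus inverse_eq_divide)
    qed
    have s: "sin (of_real pi * (\<i> * z)) = (1 / e - e) / (2 * \<i>)"
      unfolding sin_exp_eq i1 ..
    have c: "cos (of_real pi * (\<i> * z)) = (1 / e + e) / 2"
      unfolding cos_exp_eq i1 ..
    have "1 - e\<^sup>2 \<noteq> 0" "e\<^sup>2 - 1 \<noteq> 0" using e21 by auto
    moreover have "1 / e - e = (1 - e\<^sup>2) / e" "1 / e + e = (1 + e\<^sup>2) / e" using e0 by (simp_all add: field_simps power2_eq_square)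
    ultimately show ?thesis unfolding cot_def s c e2 using e0
      by (simp add: divide_simps)
  qed
  have "(\<lambda>m. (?A (1 + \<i> * z) m
            - ?A (1 - \<i> * z) m) / (2 * \<i>))
      \<longlonglongrightarrow> (Digamma (1 + \<i> * z) - Digamma (1 - \<i> * z)) / (2 * \<i>)"
    using nz[of 0] by (intro tendsto_intros Digamma_LIMSEQ) auto
  also have "Digamma (1 + \<i> * z) - Digamma (1 - \<i> * z) = 1 / (\<i> * z) - of_real pi * cot (of_real pi * (\<i> * z))"
    unfolding Digamma_reflection_complex[OF notint, symmetric] Digamma_imag_plus1(1)[OF z] by simp
  also have "(1 / (\<i> * z) - of_real pi * cot (of_real pi * (\<i> * z))) / (2 * \<i>)
     = of_real pi / 2 + of_real pi / (exp (2 * of_real pi * z) - 1) - 1 / (2 * z)"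
  proof -
    have "1 / (\<i> * z) - of_real pi * (- \<i> * (1 + 2 / E)) = (2 * \<i>) * (of_real pi / 2 + of_real pi / E - 1 / (2 * z))" for E
    proof -
      have "1 / (\<i> * z) = - \<i> * (1 / z)" using z0 by (simp add: field_simps)
      moreover have "2 / E = 2 * (1 / E)" "of_real pi / E = of_real pi * (1 / E)" "1 / (2 * z) = (1 / z) / 2" by simp_all
      ultimately show ?thesis by (simp only:) (simp only: algebra_simps, simp)
    qed
    thus ?thesis unfolding cot by simp
  qed
  also have "(\<lambda>m. (?A (1 + \<i> * z) m
            - ?A (1 - \<i> * z) m) / (2 * \<i>))
     = (\<lambda>m. \<Sum>n<m. z / (of_nat (Suc n) ^ 2 + z ^ 2))"
  proof
    fix m
    have "z / (of_nat (Suc n) ^ 2 + z ^ 2)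
      = (inverse (1 - \<i> * z + of_nat n) - inverse (1 + \<i> * z + of_nat n)) / (2 * \<i>)" for n
    proof -
      have eq: "of_nat (Suc n) ^ 2 + z ^ 2 = (1 + \<i> * z + of_nat n) * (1 - \<i> * z + of_nat n)"
        by (simp add: algebra_simps power2_eq_square)
      show ?thesis unfolding eq using nz[of n] by (simp add: divide_simps)
    qed
    hence "(\<Sum>n<m. z / (of_nat (Suc n) ^ 2 + z ^ 2))
        = ((\<Sum>n<m. inverse (1 - \<i> * z + of_nat n)) - (\<Sum>n<m. inverse (1 + \<i> * z + of_nat n))) / (2 * \<i>)"
      by (simp only: sum_subtractf flip: sum_divide_distrib)
    thus "(?A (1 + \<i> * z) m
            - ?A (1 - \<i> * z) m) / (2 * \<i>)
      = (\<Sum>n<m. z / (of_nat (Suc n) ^ 2 + z ^ 2))"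
      by simp
  qed
  finally show ?thesis unfolding sums_def .
qed

lemma square_plus_not_nonpos_Reals:
  assumes "Re z > 0"
  shows "of_real u ^ 2 + z ^ 2 \<notin> \<real>\<^sub>\<le>\<^sub>0"
proof
  assume "of_real u ^ 2 + z ^ 2 \<in> \<real>\<^sub>\<le>\<^sub>0"
  hence im: "Im (of_real u ^ 2 + z ^ 2) = 0" and re: "Re (of_real u ^ 2 + z ^ 2) \<le> 0"
    by (auto simp: complex_nonpos_Reals_iff)
  from im have "Im z = 0" using assms by (simp add: power2_eq_square)
  with re assms have "u * u + Re z * Re z \<le> 0" by (simp add: power2_eq_square)
  moreover have "u * u + Re z * Re z > 0" using assms by (simp add: add_nonneg_pos)
  ultimately show False by simp
qed

text \<open>In the right half-plane the argument stays below \<open>pi / 2\<close> in absolute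
  value, so doubling it does not reach the cut.\<close>

lemma Ln_square:
  assumes "Re z > 0"
  shows "Ln (z ^ 2) = 2 * Ln z"
proof (rule Ln_unique)
  have z: "z \<noteq> 0" using assms by auto
  show "exp (2 * Ln z) = z ^ 2" using z by (simp add: exp_double)
  have "\<bar>Im (Ln z)\<bar> < pi / 2" using Re_Ln_pos_lt[OF z] assms by blast
  thus "- pi < Im (2 * Ln z)" "Im (2 * Ln z) \<le> pi" by auto
qed

text \<open>
  The left-hand side is the sum over \<open>n \<ge> 1\<close> of \<open>n / (n\<^sup>2 + z\<^sup>2)\<close> minus the integral of
  \<open>u / (u\<^sup>2 + z\<^sup>2)\<close> over \<open>[n - 1, n]\<close>.
\<close>
lemma norm_Ln_minus_Digamma_le:
  assumes z: "Re z > 0"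
  shows "norm (Ln z - (Digamma (\<i> * z) + Digamma (- \<i> * z)) / 2)
      \<le> (norm z / Re z)\<^sup>2 * (norm z powr - 2 + norm z powr - (1/2)) * (\<Sum>p. tail_weight p)"
proof -
  define B where "B = (norm z / Re z)\<^sup>2"
  define r where "r = norm z powr - 2 + norm z powr - (1/2)"
  have nz: "norm z > 0" using z by auto
  \<comment> \<open>A primitive of \<open>u / (u^2 + z^2)\<close>. By
    \<open>square_plus_not_nonpos_Reals\<close> the logarithm is taken off its cut for every real
    \<open>u\<close>, and by \<open>Ln_square\<close> its value at 0 is \<open>Ln z\<close>.\<close>
  define L where "L = (\<lambda>u::real. Ln (of_real u ^ 2 + z ^ 2) / 2)"
  have dL: "(L has_vector_derivative of_real u / (of_real u ^ 2 + z ^ 2)) (at u within A)" for u A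
  proof -
    have d: "((\<lambda>v::complex. v ^ 2 + z ^ 2) has_field_derivative 2 * of_real u) (at (of_real u))"
      by (auto intro!: derivative_eq_intros)
    have "((\<lambda>v::complex. Ln (v ^ 2 + z ^ 2)) has_field_derivative
        inverse (of_real u ^ 2 + z ^ 2) * (2 * of_real u)) (at (of_real u))"
      by (rule DERIV_chain2[OF has_field_derivative_Ln[OF square_plus_not_nonpos_Reals[OF z]] d])
    hence d2: "((\<lambda>v::complex. Ln (v ^ 2 + z ^ 2) / 2) has_field_derivative
        inverse (of_real u ^ 2 + z ^ 2) * (2 * of_real u) / 2) (at (of_real u))"
      by (rule DERIV_cdivide)
    have eq: "inverse (of_real u ^ 2 + z ^ 2) * (2 * of_real u) / 2 = of_real u / (of_real u ^ 2 + z ^ 2)"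
    proof -
      have "inverse p * (2 * q) / 2 = q / p" for p q :: complex by (cases "p = 0") (simp_all add: field_simps)
      thus ?thesis .
    qed
    show ?thesis unfolding L_def by (rule has_vector_derivative_real_field[OF d2[unfolded eq]])
  qed
  define e where "e = (\<lambda>n. of_nat (Suc n) / (of_nat (Suc n) ^ 2 + z ^ 2) - (L (real (Suc n)) - L (real n)))"
  have e: "norm (e n) \<le> B * r * tail_weight n" for n
  proof -
    let ?g = "\<lambda>u::real. of_nat (Suc n) / (of_nat (Suc n) ^ 2 + z ^ 2) - of_real u / (of_real u ^ 2 + z ^ 2)"
    \<comment> \<open>The increment of \<open>G\<close> over the interval is \<open>e n\<close> and
      its derivative is the kernel difference \<open>?g\<close>, so the mean value inequality turns
      the pointwise kernel bound into one for \<open>e n\<close>.\<close>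
    define G where "G = (\<lambda>u::real. of_real u * (of_nat (Suc n) / (of_nat (Suc n) ^ 2 + z ^ 2)) - L u)"
    have "norm (G (real (Suc n)) - G (real n)) \<le> (B / ((real n)\<^sup>2 + (norm z)\<^sup>2)) * norm (real (Suc n) - real n)"
    proof (rule differentiable_bound[of "{real n..real (Suc n)}" G
          "\<lambda>u h. h *\<^sub>R (?g u)"])
      fix u :: real assume u: "u \<in> {real n..real (Suc n)}"
      have "(G has_vector_derivative ?g u) (at u within {real n..real (Suc n)})"
        unfolding G_def by (rule has_vector_derivative_diff[OF _ dL]) (auto intro!: derivative_eq_intros)
      thus "(G has_derivative (\<lambda>h. h *\<^sub>R (?g u))) (at u within {real n..real (Suc n)})"
        by (simp only: has_vector_derivative_def)
      have *: "norm (?g u) \<le> B / ((real n)\<^sup>2 + (norm z)\<^sup>2)"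
        using kernel_diff_bound(1)[OF z, of "real (Suc n)" u] u by (simp add: B_def)
      show "onorm (\<lambda>h. h *\<^sub>R (?g u)) \<le> B / ((real n)\<^sup>2 + (norm z)\<^sup>2)"
      proof (rule onorm_le)
        fix h :: real
        show "norm (h *\<^sub>R (?g u)) \<le> B / ((real n)\<^sup>2 + (norm z)\<^sup>2) * norm h"
          unfolding norm_scaleR real_norm_def by (subst mult.commute, rule mult_right_mono[OF * abs_ge_zero])
      qed
    qed auto
    also have "G (real (Suc n)) - G (real n) = e n"
    proof -
      have "of_real (real (Suc n)) * c - L1 - (of_real (real n) * c - L0) = c - (L1 - L0)" for c L1 L0 :: complex
        by (simp add: algebra_simps)
      thus ?thesis unfolding G_def e_def by blast
    qed
    also have "(B / ((real n)\<^sup>2 + (norm z)\<^sup>2)) * norm (real (Suc n) - real n) = B * (1 / ((real n)\<^sup>2 + (norm z)\<^sup>2))" by simp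
    also have "\<dots> \<le> B * (r * tail_weight n)"
      unfolding r_def by (intro mult_left_mono inverse_sum_squares_le_tail_weight nz) (simp add: B_def)
    finally show ?thesis by (simp add: mult_ac)
  qed
  have "(\<lambda>m. \<Sum>n<m. e n) \<longlonglongrightarrow> Ln z - (Digamma (\<i> * z) + Digamma (- \<i> * z)) / 2"
  proof -
    \<comment> \<open>Extracting \<open>m^2\<close> from the logarithm leaves
      \<open>Ln (1 + z^2 / m^2) / 2\<close>, whose limit is 0; so \<open>L m\<close> may stand for
      the \<open>ln m\<close> in the digamma limit.\<close>
    have "(\<lambda>m. L (real m) - of_real (ln (real m))) \<longlonglongrightarrow> Ln (1 + 0 * z ^ 2) / 2"
    proof (rule Lim_transform_eventually)
      show "(\<lambda>m. Ln (1 + of_real (inverse (real m) ^ 2) * z ^ 2) / 2) \<longlonglongrightarrow> Ln (1 + 0 * z ^ 2) / 2"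
      proof -
        have "(\<lambda>m. inverse (real m) ^ 2) \<longlonglongrightarrow> 0 ^ 2" by (intro tendsto_power lim_inverse_n)
        hence "(\<lambda>m. complex_of_real (inverse (real m) ^ 2)) \<longlonglongrightarrow> of_real 0"
          by (intro tendsto_of_real) simp
        thus ?thesis by (intro tendsto_intros) auto
      qed
      show "\<forall>\<^sub>F m in sequentially. Ln (1 + of_real (inverse (real m) ^ 2) * z ^ 2) / 2 = L (real m) - of_real (ln (real m))"
        using eventually_gt_at_top[of 0]
      proof eventually_elim
        case (elim m)
        have "of_real (real m) ^ 2 * of_real (inverse (real m) ^ 2) = (1 :: complex)"
          unfolding of_real_power[symmetric] of_real_mult[symmetric] power_mult_distrib[symmetric] using elim by simp
        hence eqm: "of_real (real m) ^ 2 + z ^ 2 = of_real ((real m)\<^sup>2) * (1 + of_real (inverse (real m) ^ 2) * z ^ 2)"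
          by (simp only: distrib_left mult_1_right of_real_power mult.assoc[symmetric] mult_1_left)
        have "L (real m) = Ln (of_real ((real m)\<^sup>2) * (1 + of_real (inverse (real m) ^ 2) * z ^ 2)) / 2"
          using eqm by (simp only: L_def)
        also have "\<dots> = (of_real (ln ((real m)\<^sup>2)) + Ln (1 + of_real (inverse (real m) ^ 2) * z ^ 2)) / 2"
        proof -
          have ne: "1 + of_real (inverse (real m) ^ 2) * z ^ 2 \<noteq> 0"
          proof
            assume *: "1 + of_real (inverse (real m) ^ 2) * z ^ 2 = 0"
            have "of_real (real m) ^ 2 + z ^ 2 = of_real ((real m)\<^sup>2) * (1 + of_real (inverse (real m) ^ 2) * z ^ 2)"
              by (rule eqm)
            thus False using * square_plus_nonzero[OF z, of "real m"] by simp
          qed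
          have pos: "0 < (real m)\<^sup>2" using elim by simp
          show ?thesis using Ln_times_of_real[OF pos ne] Ln_of_real[OF pos] by (simp only:)
        qed
        also have "ln ((real m)\<^sup>2) = 2 * ln (real m)" using elim by (simp add: ln_realpow)
        finally show ?case by (simp add: add_divide_distrib)
      qed
    qed
    hence L1: "(\<lambda>m. L (real m) - of_real (ln (real m))) \<longlonglongrightarrow> 0" by simp
    have "(\<lambda>m. ((\<Sum>n<m. of_nat (Suc n) / (of_nat (Suc n) ^ 2 + z ^ 2)) - of_real (ln (real m)))
         - (L (real m) - of_real (ln (real m))) + L 0) \<longlonglongrightarrow> - (Digamma (\<i> * z) + Digamma (- \<i> * z)) / 2 - 0 + L 0"
      by (intro tendsto_add tendsto_diff tendsto_const tendsto_sum_minus_ln_Digamma z L1)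
    moreover have "L 0 = Ln z" by (simp add: L_def Ln_square[OF z])
    moreover have "(\<Sum>n<m. e n) = ((\<Sum>n<m. of_nat (Suc n) / (of_nat (Suc n) ^ 2 + z ^ 2)) - of_real (ln (real m)))
         - (L (real m) - of_real (ln (real m))) + L 0" for m
    proof -
      have "(\<Sum>n<m. L (real (Suc n)) - L (real n)) = L (real m) - L 0"
        using sum_lessThan_telescope[of "\<lambda>n. L (real n)" m] by simp
      thus ?thesis by (simp add: e_def sum_subtractf)
    qed
    moreover have "- (Digamma (\<i> * z) + Digamma (- \<i> * z)) / 2 - 0 + Ln z = Ln z - (Digamma (\<i> * z) + Digamma (- \<i> * z)) / 2"
      by (simp only: minus_divide_left[symmetric]) simp
    ultimately show ?thesis by (simp only:)
  qed
  hence s: "e sums (Ln z - (Digamma (\<i> * z) + Digamma (- \<i> * z)) / 2)" unfolding sums_def .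
  have sB: "summable (\<lambda>n. B * r * tail_weight n)" by (intro summable_mult summable_tail_weight)
  have sn: "summable (\<lambda>n. norm (e n))"
    using e by (intro summable_comparison_test'[OF sB]) auto
  have "norm (suminf e) \<le> (\<Sum>n. norm (e n))" by (rule summable_norm[OF sn])
  also have "\<dots> \<le> (\<Sum>n. B * r * tail_weight n)" by (intro suminf_le e sn sB)
  also have "\<dots> = B * r * (\<Sum>n. tail_weight n)" by (rule suminf_mult[OF summable_tail_weight])
  finally show ?thesis using s by (simp add: sums_iff B_def r_def)
qed

section \<open>Comparison of sum and integral\<close>

text \<open>A product bound makes the family absolutely summable over all pairs. The iterated series
  are turned into unordered sums, exchanged there, and turned back.\<close>

lemma suminf_swap_dominated:
  fixes f :: "nat \<Rightarrow> nat \<Rightarrow> real"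
  assumes bound: "\<And>m k. \<bar>f m k\<bar> \<le> u m * h k"
    and u: "summable u" "\<And>m. u m \<ge> 0" and h: "summable h" "\<And>k. h k \<ge> 0"
  shows "(\<lambda>k. \<Sum>m. f m k) sums (\<Sum>m. \<Sum>k. f m k)"
    and "\<And>k. summable (\<lambda>m. f m k)" and "\<And>m. summable (f m)" and "summable (\<lambda>m. \<Sum>k. f m k)"
proof -
  have bound': "norm (f m k) \<le> u m * h k" for m k using bound by simp
  show s1: "summable (\<lambda>m. f m k)" for k
    by (rule summable_comparison_test'[OF summable_mult2[OF u(1)] bound'])
  show s2: "summable (f m)" for m
    by (rule summable_comparison_test'[OF summable_mult[OF h(1)] bound'])
  have s1': "summable (\<lambda>m. norm (f m k))" for k
    by (rule summable_comparison_test'[OF summable_mult2[OF u(1)]]) (use bound' in simp)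
  have s2': "summable (\<lambda>k. norm (f m k))" for m
    by (rule summable_comparison_test'[OF summable_mult[OF h(1)]]) (use bound' in simp)
  have row: "(\<Sum>k. norm (f m k)) \<le> u m * suminf h" for m
  proof -
    have "(\<Sum>k. norm (f m k)) \<le> (\<Sum>k. u m * h k)"
      by (intro suminf_le bound' s2' summable_mult h)
    thus ?thesis by (simp only: suminf_mult[OF h(1)])
  qed
  have rows: "summable (\<lambda>m. \<Sum>k. norm (f m k))"
    by (rule summable_comparison_test'[OF summable_mult2[OF u(1), of "suminf h"]])
       (use row suminf_nonneg[OF s2'] in auto)
  have "\<bar>\<Sum>k. f m k\<bar> \<le> (\<Sum>k. norm (f m k))" for m
    using summable_norm[OF s2'] by simp
  thus s3: "summable (\<lambda>m. \<Sum>k. f m k)"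
    by (intro summable_comparison_test'[OF rows]) simp
  have col: "(\<Sum>m. norm (f m k)) \<le> suminf u * h k" for k
  proof -
    have "(\<Sum>m. norm (f m k)) \<le> (\<Sum>m. u m * h k)"
      by (intro suminf_le bound' s1' summable_mult2 u)
    thus ?thesis by (simp only: suminf_mult2[OF u(1), symmetric])
  qed
  have cols: "summable (\<lambda>k. \<Sum>m. norm (f m k))"
    by (rule summable_comparison_test'[OF summable_mult[OF h(1), of "suminf u"]])
       (use col suminf_nonneg[OF s1'] in auto)
  have "\<bar>\<Sum>m. f m k\<bar> \<le> (\<Sum>m. norm (f m k))" for k
    using summable_norm[OF s1'] by simp
  hence s4: "summable (\<lambda>k. \<Sum>m. f m k)"
    by (intro summable_comparison_test'[OF cols]) simp
  have eq: "infsum g UNIV = suminf g" if "summable (\<lambda>i. norm (g i))" for g :: "nat \<Rightarrow> real"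
    using norm_summable_imp_has_sum[OF that summable_sums[OF summable_norm_cancel[OF that]]] by (rule infsumI)
  have nsum: "g summable_on UNIV" if "summable (\<lambda>i. norm (g i))" for g :: "nat \<Rightarrow> real"
    using norm_summable_imp_summable_on[OF that] .
  have "(\<lambda>x. norm ((\<lambda>(m, k). f m k) x)) summable_on (UNIV \<times> UNIV)"
    unfolding Infinite_Sum.abs_summable_on_Sigma_iff
  proof (intro conjI ballI)
    fix m show "(\<lambda>y. norm (case (m, y) of (m, k) \<Rightarrow> f m k)) summable_on UNIV"
      using s2'[of m] by (simp add: nsum)
  next
    have "(\<Sum>\<^sub>\<infinity>k. norm (f m k)) = (\<Sum>k. norm (f m k))" for m
      using s2'[of m] by (intro eq) simp
    thus "(\<lambda>m. norm (\<Sum>\<^sub>\<infinity>y. norm (case (m, y) of (m, k) \<Rightarrow> f m k))) summable_on UNIV"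
      using rows suminf_nonneg[OF s2'] by (simp add: nsum)
  qed
  hence "(\<lambda>(m, k). f m k) summable_on (UNIV \<times> UNIV)" by (rule Infinite_Sum.abs_summable_summable)
  from infsum_swap_banach[OF this]
  have "(\<Sum>\<^sub>\<infinity>m. \<Sum>\<^sub>\<infinity>k. f m k) = (\<Sum>\<^sub>\<infinity>k. \<Sum>\<^sub>\<infinity>m. f m k)" .
  moreover have "(\<Sum>\<^sub>\<infinity>k. f m k) = (\<Sum>k. f m k)" for m by (rule eq[OF s2'])
  moreover have "(\<Sum>\<^sub>\<infinity>m. f m k) = (\<Sum>m. f m k)" for k by (rule eq[OF s1'])
  moreover have "(\<Sum>\<^sub>\<infinity>m. \<Sum>k. f m k) = (\<Sum>m. \<Sum>k. f m k)"
    by (rule eq, rule summable_comparison_test'[OF rows]) (use summable_norm[OF s2'] in simp)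
  moreover have "(\<Sum>\<^sub>\<infinity>k. \<Sum>m. f m k) = (\<Sum>k. \<Sum>m. f m k)"
    by (rule eq, rule summable_comparison_test'[OF cols]) (use summable_norm[OF s1'] in simp)
  ultimately have "(\<Sum>m. \<Sum>k. f m k) = (\<Sum>k. \<Sum>m. f m k)" by simp
  thus "(\<lambda>k. \<Sum>m. f m k) sums (\<Sum>m. \<Sum>k. f m k)" using summable_sums[OF s4] by simp
qed

section \<open>Primitives of the summands\<close>

definition mlder :: "real \<Rightarrow> nat \<Rightarrow> real \<Rightarrow> real" where
  "mlder a m t = (let w = 2 * pi * real (Suc m) in
     cos (w * a) * (2 / (t\<^sup>2 + w\<^sup>2)) - sin (w * a) * (2 * t / (w * (t\<^sup>2 + w\<^sup>2))))"

text \<open>The primitive of \<open>mlterm a m t / t\<close> that vanishes at 0. The division by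
  \<open>w^2\<close> inside the logarithm secures this normalisation, and with it the convergence of
  the series over \<open>m\<close>.\<close>

definition mlprim :: "real \<Rightarrow> nat \<Rightarrow> real \<Rightarrow> real" where
  "mlprim a m t = (let w = 2 * pi * real (Suc m) in
     cos (w * a) * (2 / w * arctan (t / w)) - sin (w * a) * (1 / w * ln (1 + t\<^sup>2 / w\<^sup>2)))"

lemma mlterm_eq_mlder: "mlterm a m t = t * mlder a m t"
  by (simp add: mlterm_def mlder_def Let_def power2_eq_square algebra_simps)

lemma has_field_derivative_mlprim:
  "(mlprim a m has_real_derivative mlder a m t) (at t within A)"
proof -
  define w where "w = 2 * pi * real (Suc m)"
  have w: "w > 0" by (simp add: w_def)
  have pos: "t\<^sup>2 + w\<^sup>2 > 0" "1 + t\<^sup>2 / w\<^sup>2 > 0" using w by (simp_all add: add_nonneg_pos add_pos_nonneg)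
  have "((\<lambda>t. cos (w * a) * (2 / w * arctan (t / w)) - sin (w * a) * (1 / w * ln (1 + t\<^sup>2 / w\<^sup>2)))
      has_real_derivative (cos (w * a) * (2 / w * (1 / (1 + (t / w)\<^sup>2) * (1 / w))) - sin (w * a) * (1 / w * ((2 * t / w\<^sup>2) / (1 + t\<^sup>2 / w\<^sup>2))))) (at t within A)"
    using w pos by (auto intro!: derivative_eq_intros simp: divide_inverse)
  also have "1 + (t / w)\<^sup>2 = (t\<^sup>2 + w\<^sup>2) / w\<^sup>2" using w by (simp add: field_simps)
  also have "1 + t\<^sup>2 / w\<^sup>2 = (t\<^sup>2 + w\<^sup>2) / w\<^sup>2" using w by (simp add: field_simps)
  also have "2 / w * (1 / ((t\<^sup>2 + w\<^sup>2) / w\<^sup>2) * (1 / w)) = 2 / (t\<^sup>2 + w\<^sup>2)"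
    using w pos by (simp add: power2_eq_square)
  also have "1 / w * ((2 * t / w\<^sup>2) / ((t\<^sup>2 + w\<^sup>2) / w\<^sup>2)) = 2 * t / (w * (t\<^sup>2 + w\<^sup>2))"
    using w pos by simp
  finally show ?thesis unfolding mlprim_def mlder_def Let_def w_def .
qed

lemma mlprim_0 [simp]: "mlprim a m 0 = 0"
  by (simp add: mlprim_def)

lemma two_pi_Suc_ge: "real (Suc m) \<le> 2 * pi * real (Suc m)" "1 \<le> 2 * pi * real (Suc m)"
proof -
  show "real (Suc m) \<le> 2 * pi * real (Suc m)"
    using mult_right_mono[of 1 "2 * pi" "real (Suc m)"] pi_gt3 by simp
  thus "1 \<le> 2 * pi * real (Suc m)" by linarith
qed

lemma abs_diff_trig_le: "\<bar>cos y * p - sin y * q\<bar> \<le> \<bar>p\<bar> + \<bar>q :: real\<bar>"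
proof -
  have "\<bar>cos y * p\<bar> \<le> 1 * \<bar>p\<bar>" "\<bar>sin y * q\<bar> \<le> 1 * \<bar>q\<bar>"
    unfolding abs_mult by (intro mult_right_mono; simp)+
  thus ?thesis by linarith
qed

lemma inverse_two_pi_Suc_sq: "1 / (2 * pi * real (Suc m))\<^sup>2 \<le> real (Suc m) powr - 2"
proof -
  have "(real (Suc m))\<^sup>2 \<le> (2 * pi * real (Suc m))\<^sup>2"
    using two_pi_Suc_ge by (intro power_mono) auto
  hence "1 / (2 * pi * real (Suc m))\<^sup>2 \<le> 1 / (real (Suc m))\<^sup>2"
    by (intro divide_left_mono) (auto simp del: of_nat_Suc)
  also have "\<dots> = real (Suc m) powr - 2" by (simp add: powr_minus divide_inverse del: of_nat_Suc)
  finally show ?thesis .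
qed

lemma mlder_bound:
  assumes t: "\<bar>t\<bar> \<le> T"
  shows "\<bar>mlder a m t\<bar> \<le> (2 + 2 * T) * real (Suc m) powr - 2"
proof -
  define w where "w = 2 * pi * real (Suc m)"
  have w: "w \<ge> 1" using two_pi_Suc_ge by (simp add: w_def)
  have T: "T \<ge> 0" using t by linarith
  have inv: "1 / (t\<^sup>2 + w\<^sup>2) \<le> 1 / w\<^sup>2"
    using w by (intro divide_left_mono) (auto simp: add_nonneg_pos)
  have "\<bar>mlder a m t\<bar> \<le> \<bar>2 / (t\<^sup>2 + w\<^sup>2)\<bar> + \<bar>2 * t / (w * (t\<^sup>2 + w\<^sup>2))\<bar>"
    unfolding mlder_def Let_def w_def by (rule abs_diff_trig_le)
  also have "\<bar>2 / (t\<^sup>2 + w\<^sup>2)\<bar> = 2 * (1 / (t\<^sup>2 + w\<^sup>2))" by simp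
  also have "\<bar>2 * t / (w * (t\<^sup>2 + w\<^sup>2))\<bar> = 2 * \<bar>t\<bar> * (1 / w) * (1 / (t\<^sup>2 + w\<^sup>2))"
    using w by (simp add: abs_mult)
  also have "2 * \<bar>t\<bar> * (1 / w) * (1 / (t\<^sup>2 + w\<^sup>2)) \<le> 2 * T * 1 * (1 / w\<^sup>2)"
    using w t T by (intro mult_mono inv) auto
  also have "2 * (1 / (t\<^sup>2 + w\<^sup>2)) \<le> 2 * (1 / w\<^sup>2)" using inv by simp
  finally have "\<bar>mlder a m t\<bar> \<le> (2 + 2 * T) * (1 / w\<^sup>2)" by (simp add: algebra_simps)
  also have "\<dots> \<le> (2 + 2 * T) * real (Suc m) powr - 2"
    unfolding w_def using T by (intro mult_left_mono inverse_two_pi_Suc_sq) auto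
  finally show ?thesis .
qed

definition mlsum :: "real \<Rightarrow> real \<Rightarrow> real" where
  "mlsum a T = (\<Sum>m. mlprim a m T)"

lemma mlsum_0 [simp]: "mlsum a 0 = 0" by (simp add: mlsum_def)

text \<open>Termwise differentiation: the derivatives are dominated by multiples of
  \<open>Suc m powr - 2\<close> on bounded intervals, and the primitives sum trivially at 0. The
  interval \<open>S\<close> has to contain 0 and to have \<open>T\<close> in its interior.\<close>

lemma mlsum_deriv_summable:
  shows "summable (\<lambda>m. mlprim a m T)" and "(mlsum a has_real_derivative (\<Sum>m. mlder a m T)) (at T)"
proof -
  define S where "S = {- (\<bar>T\<bar> + 1)..\<bar>T\<bar> + 1}"
  have uc: "uniformly_convergent_on S (\<lambda>n x. \<Sum>i<n. mlder a i x)"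
  proof (rule Weierstrass_m_test')
    show "norm (mlder a n x) \<le> (2 + 2 * (\<bar>T\<bar> + 1)) * real (Suc n) powr - 2" if "x \<in> S" for n x
      using mlder_bound[of x "\<bar>T\<bar> + 1" a n] that by (auto simp: S_def abs_le_iff)
    show "summable (\<lambda>n. (2 + 2 * (\<bar>T\<bar> + 1)) * real (Suc n) powr - 2)"
      by (intro summable_mult summable_shifted_powr) simp
  qed
  have T: "T \<in> interior S" by (auto simp: S_def interior_atLeastAtMost_real)
  have conv: "convex S" by (simp add: S_def)
  have S0: "0 \<in> S" by (simp add: S_def)
  have s0: "summable (\<lambda>n. mlprim a n 0)" by simp
  show "summable (\<lambda>m. mlprim a m T)"
    by (rule has_field_derivative_series'(1)[OF conv has_field_derivative_mlprim uc S0 s0 T])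
  have "mlsum a = (\<lambda>x. \<Sum>m. mlprim a m x)" by (auto simp: mlsum_def)
  thus "(mlsum a has_real_derivative (\<Sum>m. mlder a m T)) (at T)"
    using has_field_derivative_series'(2)[OF conv has_field_derivative_mlprim uc S0 s0 T] by simp
qed

text \<open>In the notation of the paper this is \<open>A\<close> with indices \<open>N, j\<close> at \<open>(m + 1) / x\<close>, divided by \<open>\<pi>\<close>.\<close>
definition ray :: "nat \<Rightarrow> real \<Rightarrow> nat \<Rightarrow> int \<Rightarrow> complex" where
  "ray N x m j = of_real ((2 * pi * real (Suc m) / x) powr (1 / real N)) * cis (pi * of_int j / real N)"

text \<open>With \<open>N = 2 * M + 1\<close> and \<open>\<bar>j\<bar> \<le> M\<close> the quotient
  \<open>j / N\<close> stays strictly below 1/2 in absolute value, so no ray lies on the imaginary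
  axis.\<close>

lemma ray_angle:
  assumes N: "N = 2 * M + 1" and j: "j \<in> {- int M..int M}"
  shows "cos (pi * of_int j / real N) > 0"
proof (rule cos_gt_zero_pi)
  have "\<bar>real_of_int j\<bar> \<le> real M" using j by auto
  hence "\<bar>real_of_int j\<bar> * 2 < real N" using N by simp
  hence "\<bar>real_of_int j / real N\<bar> < 1 / 2" using N by (simp add: abs_divide divide_simps)
  hence "pi * \<bar>real_of_int j / real N\<bar> < pi * (1 / 2)"
    by (intro mult_strict_left_mono) auto
  moreover have "pi * \<bar>real_of_int j / real N\<bar> = \<bar>pi * real_of_int j / real N\<bar>"
    by (simp only: times_divide_eq_right[symmetric] abs_mult[of pi]) simp
  ultimately have "\<bar>pi * real_of_int j / real N\<bar> < pi * (1 / 2)" by (simp only:)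
  moreover have "- (pi / 2) < X \<and> X < pi / 2" if "\<bar>X\<bar> < pi * (1 / 2)" for X using that by linarith
  ultimately show "- (pi / 2) < pi * real_of_int j / real N" "pi * real_of_int j / real N < pi / 2" by blast+
qed

lemma ray_simps:
  assumes N: "N = 2 * M + 1" and j: "j \<in> {- int M..int M}" and x: "x > 0"
  shows "norm (ray N x m j) = (2 * pi * real (Suc m) / x) powr (1 / real N)"
    and "Re (ray N x m j) > 0"
    and "norm (ray N x m j) / Re (ray N x m j) = 1 / cos (pi * of_int j / real N)"
  using ray_angle[OF N j] x by (auto simp: ray_def norm_mult simp del: of_nat_Suc)

text \<open>For \<open>t = u ^ N * x\<close> one has
  \<open>t^2 + w^2 = x^2 * (u ^ (2 * N) + (w / x)^2)\<close>, the denominator of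
  \<open>partial_fractions_real\<close>. The cosine part of \<open>mlterm\<close> yields the
  alternating sum over the rays, the sine part the plain one.\<close>

lemma mlterm_partial_fractions:
  fixes u x a :: real and m :: nat
  assumes N: "N = 2 * M + 1" and u: "u > 0" and x: "x > 0"
  defines "w \<equiv> 2 * pi * real (Suc m)"
  shows "complex_of_real (mlterm a m (u ^ N * x) / u) = of_real (2 / (real N * w)) *
     (\<Sum>j\<in>{- int M..int M}. of_real (cos (w * a)) * ((- 1) ^ M * (- 1) powi j * (ray N x m j / (of_real u ^ 2 + ray N x m j ^ 2)))
        - of_real (sin (w * a)) * (of_real u / (of_real u ^ 2 + ray N x m j ^ 2)))"
proof -
  define W where "W = w / x"
  have w: "w > 0" by (simp add: w_def)
  have W: "W > 0" using w x by (simp add: W_def)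
  have N0: "N > 0" using N by simp
  let ?c = "(- 1) ^ M * ((- 1) ^ M * real N * W * u ^ (N - 1) / (u ^ (2 * N) + W\<^sup>2))"
    and ?s = "real N * u ^ (2 * N - 1) / (u ^ (2 * N) + W\<^sup>2)" and ?t = "(u ^ N * x)\<^sup>2 + w\<^sup>2"
  have ray: "ray N x m j = of_real (W powr (1 / real N)) * cis (pi * of_int j / real N)" for j
    by (simp only: ray_def W_def w_def)
  have den: "?t = x\<^sup>2 * (u ^ (2 * N) + W\<^sup>2)"
    unfolding W_def using x by (simp add: power_mult_distrib power_divide distrib_left power_mult[symmetric] mult_ac)
  have pos: "u ^ (2 * N) + W\<^sup>2 > 0" using u by (simp add: add_pos_nonneg)
  have uN: "u ^ N = u * u ^ (N - 1)" "u ^ (2 * N) = u * u ^ (2 * N - 1)" using N0 by (simp_all flip: power_Suc)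
  have c: "2 * (u ^ N * x) / (?t) / u = 2 / (real N * w) * (?c)"
  proof -
    have "2 * (u ^ N * x) / (?t) / u = 2 / x * (u ^ (N - 1) / (u ^ (2 * N) + W\<^sup>2))"
      unfolding den by (subst uN(1)) (use u x in \<open>simp add: power2_eq_square\<close>)
    also have "\<dots> = 2 / (real N * w) * (?c)"
      unfolding W_def[symmetric] using w x N0 by (simp add: W_def flip: power_mult_distrib mult.assoc)
    finally show ?thesis .
  qed
  have s: "2 * (u ^ N * x)\<^sup>2 / (w * (?t)) / u = 2 / (real N * w) * (?s)"
  proof -
    have "(u ^ N * x)\<^sup>2 = u ^ (2 * N) * x\<^sup>2" by (simp add: power_mult_distrib power_mult[symmetric] mult_ac)
    thus ?thesis unfolding den using uN(2) u x w N0 pos by (simp add: divide_simps)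
  qed
  have "mlterm a m (u ^ N * x) / u = cos (w * a) * (2 * (u ^ N * x) / (?t) / u)
     - sin (w * a) * (2 * (u ^ N * x)\<^sup>2 / (w * (?t)) / u)"
    by (simp add: mlterm_def Let_def w_def diff_divide_distrib)
  also have "\<dots> = 2 / (real N * w) * (cos (w * a) * (?c)
       - sin (w * a) * (?s))"
    unfolding c s by (simp only: right_diff_distrib mult.left_commute)
  finally have "complex_of_real (mlterm a m (u ^ N * x) / u) = of_real (2 / (real N * w)) *
     (of_real (cos (w * a)) * ((- 1) ^ M * of_real ((- 1) ^ M * real N * W * u ^ (N - 1) / (u ^ (2 * N) + W\<^sup>2)))
       - of_real (sin (w * a)) * of_real (?s))"
    by (simp only: of_real_mult of_real_diff of_real_power of_real_minus of_real_1)
  also have "\<dots> = of_real (2 / (real N * w)) *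
     (\<Sum>j\<in>{- int M..int M}. of_real (cos (w * a)) * ((- 1) ^ M * (- 1) powi j * (ray N x m j / (of_real u ^ 2 + ray N x m j ^ 2)))
        - of_real (sin (w * a)) * (of_real u / (of_real u ^ 2 + ray N x m j ^ 2)))"
    unfolding partial_fractions_real[OF N u W, symmetric] ray sum_distrib_left sum_subtractf
    by (simp only: mult.assoc times_divide_eq_right)
  finally show ?thesis .
qed

section \<open>Absolute convergence of the corrections\<close>

definition angle_const :: "nat \<Rightarrow> real" where
  "angle_const N = (\<Sum>j\<in>{- int ((N - 1) div 2)..int ((N - 1) div 2)}. (1 / cos (pi * of_int j / real N))\<^sup>2)"

text \<open>The part of the bound that depends on \<open>m\<close>: the prefactor
  \<open>1 / w\<close> of the partial fractions times the powers of \<open>r\<close> in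
  \<open>inverse_sum_squares_le_tail_weight\<close>, at the common modulus \<open>R\<close> of the
  rays.\<close>

definition mlweight :: "nat \<Rightarrow> real \<Rightarrow> nat \<Rightarrow> real" where
  "mlweight N x m = (let R = (2 * pi * real (Suc m) / x) powr (1 / real N) in
     1 / (2 * pi * real (Suc m)) * (R powr - 2 + R powr - (1/2)))"

text \<open>A summand minus its integral over \<open>[k, k + 1]\<close>: \<open>mlprim a m (u ^ N * x) / N\<close> is an
  antiderivative of \<open>mlterm a m (u ^ N * x) / u\<close>.\<close>
definition mldiff :: "real \<Rightarrow> nat \<Rightarrow> real \<Rightarrow> nat \<Rightarrow> nat \<Rightarrow> real" where
  "mldiff a N x m k = mlterm a m (real (Suc k) ^ N * x) / real (Suc k)
     - (mlprim a m (real (Suc k) ^ N * x) - mlprim a m (real k ^ N * x)) / real N"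

text \<open>The mean value theorem replaces the integral over \<open>[k, k + 1]\<close> by the
  integrand at an intermediate point \<open>v\<close>. What remains is a difference of two values,
  expanded over the rays and estimated by \<open>kernel_diff_bound\<close>; the 4 is the prefactor 2
  times two kernels per ray.\<close>

lemma mldiff_bound:
  assumes N: "odd N" and x: "x > 0"
  shows "\<bar>mldiff a N x m k\<bar> \<le> 4 * angle_const N * mlweight N x m * tail_weight k"
proof -
  define M where "M = (N - 1) div 2"
  have N': "N = 2 * M + 1" using odd_two_times_div_two_succ[OF N] N by (simp add: M_def)
  have N0: "N > 0" using N' by simp
  define w where "w = 2 * pi * real (Suc m)"
  have w: "w > 0" by (simp add: w_def)
  define R where "R = (w / x) powr (1 / real N)"
  have R: "R > 0" using w x by (simp add: R_def)
  let ?J = "{- int M..int M}"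
  define n where "n = real (Suc k)"
  have "\<exists>v>real k. v < n \<and>
     mlprim a m (n ^ N * x) / real N - mlprim a m (real k ^ N * x) / real N = (n - real k) * (mlder a m (v ^ N * x) * (v ^ (N - 1) * x))"
  proof (rule MVT2)
    fix v
    have "((\<lambda>v. mlprim a m (v ^ N * x)) has_real_derivative (mlder a m (v ^ N * x) * (real N * v ^ (N - 1) * x))) (at v)"
      by (rule DERIV_chain2[OF has_field_derivative_mlprim]) (auto intro!: derivative_eq_intros)
    from DERIV_cdivide[OF this, of "real N"]
    show "((\<lambda>v. mlprim a m (v ^ N * x) / real N) has_real_derivative (mlder a m (v ^ N * x) * (v ^ (N - 1) * x))) (at v)"
      using N0 by simp
  qed (simp add: n_def)
  then obtain v where v: "real k < v" "v < n"
    and MVT: "mlprim a m (n ^ N * x) / real N - mlprim a m (real k ^ N * x) / real N = (n - real k) * (mlder a m (v ^ N * x) * (v ^ (N - 1) * x))"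
    by blast
  \<comment> \<open>The strict inequality matters for \<open>k = 0\<close>, because the integrand is
    written with a division by \<open>v\<close>.\<close>
  have v0: "v > 0" using v(1) by (rule le_less_trans[rotated]) simp
  let ?P = "\<lambda>j. ray N x m j / (of_real n ^ 2 + ray N x m j ^ 2) - ray N x m j / (of_real v ^ 2 + ray N x m j ^ 2)" and ?Q = "\<lambda>j. of_real n / (of_real n ^ 2 + ray N x m j ^ 2) - of_real v / (of_real v ^ 2 + ray N x m j ^ 2)"
  have "mlterm a m (v ^ N * x) / v = mlder a m (v ^ N * x) * (v ^ (N - 1) * x)"
    unfolding mlterm_eq_mlder using v0 N0 by (simp add: field_simps flip: power_Suc)
  with MVT have "mldiff a N x m k = mlterm a m (n ^ N * x) / n - mlterm a m (v ^ N * x) / v"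
    unfolding mldiff_def n_def[symmetric] diff_divide_distrib by (simp add: n_def)
  hence "\<bar>mldiff a N x m k\<bar> = norm (complex_of_real (mlterm a m (n ^ N * x) / n) - complex_of_real (mlterm a m (v ^ N * x) / v))"
    by (simp only: of_real_diff[symmetric] norm_of_real)
  also have "complex_of_real (mlterm a m (n ^ N * x) / n) - complex_of_real (mlterm a m (v ^ N * x) / v)
     = of_real (2 / (real N * w)) * (\<Sum>j\<in>?J.
        of_real (cos (w * a)) * ((- 1) ^ M * (- 1) powi j * (?P j))
        - of_real (sin (w * a)) * (?Q j))"
  proof -
    have n0: "n > 0" by (simp add: n_def)
    have gen: "(c * (e * p1) - q * r1) - (c * (e * p2) - q * r2) = c * (e * (p1 - p2)) - q * (r1 - r2)"
      for c e p1 p2 q r1 r2 :: complex by (simp add: algebra_simps)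
    show ?thesis
      unfolding mlterm_partial_fractions[OF N' n0 x] mlterm_partial_fractions[OF N' v0 x] w_def[symmetric]
        right_diff_distrib[symmetric] sum_subtractf[symmetric]
      by (intro arg_cong2[where f = "(*)"] sum.cong refl) (rule gen)
  qed
  also have "norm \<dots> \<le> 2 / (real N * w) * (\<Sum>j\<in>?J. 2 * ((1 / cos (pi * of_int j / real N))\<^sup>2 / ((real k)\<^sup>2 + R\<^sup>2)))"
    unfolding norm_mult norm_of_real
  proof (intro mult_mono sum_norm_le)
    fix j assume j: "j \<in> ?J"
    note rs = ray_simps[OF N' j x, of m]
    have nk: "n - 1 = real k" by (simp add: n_def)
    have nR: "norm (ray N x m j) = R" using rs(1) by (simp only: R_def w_def)
    define B where "B = (1 / cos (pi * of_int j / real N))\<^sup>2 / ((real k)\<^sup>2 + R\<^sup>2)"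
    have uu: "0 \<le> n - 1" "n - 1 \<le> v" "v \<le> n" using v nk by auto
    have b1: "norm (?P j) \<le> B"
      using kernel_diff_bound(2)[OF rs(2) uu] by (simp only: rs(3) nR[symmetric] nk B_def)
    have b2: "norm (?Q j) \<le> B"
      using kernel_diff_bound(1)[OF rs(2) uu] by (simp only: rs(3) nR[symmetric] nk B_def)
    have B0: "B \<ge> 0" by (simp add: B_def)
    have a1: "norm (of_real (cos (w * a)) * ((- 1) ^ M * (- 1) powi j * (?P j))) \<le> 1 * (1 * 1 * B)"
      unfolding norm_mult by (intro mult_mono b1) (auto simp: norm_power minus_one_powi_eq_cis B0)
    have a2: "norm (of_real (sin (w * a)) * (?Q j)) \<le> 1 * B"
      unfolding norm_mult by (intro mult_mono b2) (auto simp: B0)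
    show "norm (of_real (cos (w * a)) * ((- 1) ^ M * (- 1) powi j * (?P j))
        - of_real (sin (w * a)) * (?Q j))
        \<le> 2 * ((1 / cos (pi * of_int j / real N))\<^sup>2 / ((real k)\<^sup>2 + R\<^sup>2))"
      unfolding B_def[symmetric] by (rule order_trans[OF norm_triangle_ineq4]) (use a1 a2 in linarith)
  qed (use w N0 in auto)
  also have "\<dots> = 4 / (real N * w) * (angle_const N * (1 / ((real k)\<^sup>2 + R\<^sup>2)))"
    unfolding angle_const_def M_def[symmetric] sum_distrib_left[symmetric] sum_divide_distrib[symmetric] by simp
  also have "\<dots> \<le> 4 / w * (angle_const N * ((R powr - 2 + R powr - (1/2)) * tail_weight k))"
  proof (intro mult_mono inverse_sum_squares_le_tail_weight R)
    show "4 / (real N * w) \<le> 4 / w" using w N0 by (simp add: divide_simps)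
    show "0 \<le> angle_const N" by (simp add: angle_const_def sum_nonneg)
  qed (use w in \<open>auto simp: angle_const_def sum_nonneg\<close>)
  also have "\<dots> = 4 * angle_const N * mlweight N x m * tail_weight k"
    by (simp add: mlweight_def R_def w_def Let_def del: of_nat_Suc)
  finally show ?thesis .
qed

text \<open>Both powers of \<open>Suc m\<close> decay faster than the first power, which gives
  summability; the explicit dependence on \<open>x\<close> serves the limit at 0.\<close>

lemma mlweight_eq:
  assumes "N > 0" "x > 0"
  shows "mlweight N x m = (1 / (2 * pi) * (2 * pi / x) powr - (2 / real N)) * real (Suc m) powr - (1 + 2 / real N)
     + (1 / (2 * pi) * (2 * pi / x) powr - (1 / (2 * real N))) * real (Suc m) powr - (1 + 1 / (2 * real N))"
proof -
  have e: "1 / (2 * pi * real (Suc m)) * ((2 * pi * real (Suc m) / x) powr (1 / real N)) powr - s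
     = (1 / (2 * pi) * (2 * pi / x) powr - (s / real N)) * real (Suc m) powr - (1 + s / real N)" for s
  proof -
    have "((2 * pi * real (Suc m) / x) powr (1 / real N)) powr - s = (2 * pi / x * real (Suc m)) powr - (s / real N)"
      by (simp add: powr_powr mult_ac)
    also have "\<dots> = (2 * pi / x) powr - (s / real N) * real (Suc m) powr - (s / real N)"
      using assms by (subst powr_mult) auto
    also have "1 / (2 * pi * real (Suc m)) * \<dots> = (1 / (2 * pi) * (2 * pi / x) powr - (s / real N)) * (real (Suc m) powr - 1 * real (Suc m) powr - (s / real N))"
    proof -
      have "real (Suc m) powr - 1 = 1 / real (Suc m)" by (simp only: powr_minus_divide powr_one of_nat_0_le_iff)
      moreover have "1 / (2 * pi * S) * (A * B) = 1 / (2 * pi) * A * (1 / S * B)" for A B S :: real by simp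
      ultimately show ?thesis by (simp only:)
    qed
    also have "real (Suc m) powr - 1 * real (Suc m) powr - (s / real N) = real (Suc m) powr - (1 + s / real N)"
      unfolding powr_add[symmetric] by (rule arg_cong[of _ _ "\<lambda>e. real (Suc m) powr e"]) simp
    finally show ?thesis .
  qed
  show ?thesis unfolding mlweight_def Let_def distrib_left
    using e[of 2] e[of "1/2"] by simp
qed

lemma mlweight_nonneg: "mlweight N x m \<ge> 0"
  by (simp add: mlweight_def Let_def)

lemma summable_mlweight: "N > 0 \<Longrightarrow> x > 0 \<Longrightarrow> summable (mlweight N x)"
proof -
  assume "N > 0" "x > 0"
  hence "mlweight N x = (\<lambda>m. (1 / (2 * pi) * (2 * pi / x) powr - (2 / real N)) * real (Suc m) powr - (1 + 2 / real N)
     + (1 / (2 * pi) * (2 * pi / x) powr - (1 / (2 * real N))) * real (Suc m) powr - (1 + 1 / (2 * real N)))"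
    using mlweight_eq by blast
  moreover have "summable \<dots>" using \<open>N > 0\<close> by (intro summable_add summable_mult summable_shifted_powr) auto
  ultimately show ?thesis by simp
qed

lemma angle_const_nonneg: "angle_const N \<ge> 0"
  by (simp add: angle_const_def sum_nonneg)

definition mlcorr :: "real \<Rightarrow> nat \<Rightarrow> real \<Rightarrow> real" where
  "mlcorr a N x = (\<Sum>m. \<Sum>k. mldiff a N x m k)"

lemma mldiff_sums:
  assumes N: "odd N" and x: "x > 0"
  shows "(\<lambda>k. \<Sum>m. mldiff a N x m k) sums mlcorr a N x"
    and "\<And>k. summable (\<lambda>m. mldiff a N x m k)" and "\<And>m. summable (mldiff a N x m)"
    and "summable (\<lambda>m. \<Sum>k. mldiff a N x m k)"
    and "\<bar>mlcorr a N x\<bar> \<le> 4 * angle_const N * (\<Sum>m. mlweight N x m) * (\<Sum>k. tail_weight k)"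
proof -
  have N0: "N > 0" using N by (rule odd_pos)
  let ?u = "\<lambda>m. 4 * angle_const N * mlweight N x m"
  have u: "summable ?u" "\<And>m. ?u m \<ge> 0"
    by (intro summable_mult summable_mlweight N0 x) (simp add: angle_const_nonneg mlweight_nonneg)
  note sw = suminf_swap_dominated[OF mldiff_bound[OF N x, of a] u summable_tail_weight tail_weight_nonneg]
  show "(\<lambda>k. \<Sum>m. mldiff a N x m k) sums mlcorr a N x" unfolding mlcorr_def by (rule sw(1))
  show "summable (\<lambda>m. mldiff a N x m k)" for k by (rule sw(2))
  show s3: "summable (mldiff a N x m)" for m by (rule sw(3))
  show s4: "summable (\<lambda>m. \<Sum>k. mldiff a N x m k)" by (rule sw(4))
  have row: "\<bar>\<Sum>k. mldiff a N x m k\<bar> \<le> ?u m * (\<Sum>k. tail_weight k)" for m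
  proof -
    have ns: "summable (\<lambda>k. norm (mldiff a N x m k))"
      by (rule summable_comparison_test'[OF summable_mult[OF summable_tail_weight, of "?u m"]])
         (use mldiff_bound[OF N x, of a m] in simp)
    have "\<bar>\<Sum>k. mldiff a N x m k\<bar> \<le> (\<Sum>k. norm (mldiff a N x m k))" using summable_norm[OF ns] by simp
    also have "\<dots> \<le> (\<Sum>k. ?u m * tail_weight k)"
      using mldiff_bound[OF N x, of a m] by (intro suminf_le ns summable_mult summable_tail_weight) simp
    also have "\<dots> = ?u m * (\<Sum>k. tail_weight k)" by (rule suminf_mult[OF summable_tail_weight])
    finally show ?thesis .
  qed
  have ns: "summable (\<lambda>m. norm (\<Sum>k. mldiff a N x m k))"
    by (rule summable_comparison_test'[OF summable_mult2[OF u(1)]]) (use row in simp)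
  have "\<bar>mlcorr a N x\<bar> \<le> (\<Sum>m. norm (\<Sum>k. mldiff a N x m k))"
    unfolding mlcorr_def using summable_norm[OF ns] by simp
  also have "\<dots> \<le> (\<Sum>m. ?u m * (\<Sum>k. tail_weight k))"
    using row by (intro suminf_le ns summable_mult2 u) simp
  also have "\<dots> = (\<Sum>m. ?u m) * (\<Sum>k. tail_weight k)" by (rule suminf_mult2[OF u(1), symmetric])
  also have "(\<Sum>m. ?u m) = 4 * angle_const N * (\<Sum>m. mlweight N x m)"
    by (rule suminf_mult[OF summable_mlweight[OF N0 x]])
  finally show "\<bar>mlcorr a N x\<bar> \<le> 4 * angle_const N * (\<Sum>m. mlweight N x m) * (\<Sum>k. tail_weight k)" .
qed

text \<open>For \<open>N = 1\<close> the bound on the correction is a combination of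
  \<open>x powr 2\<close> and \<open>x powr (1/2)\<close> with constant coefficients.\<close>

lemma mlcorr_1_tendsto_0: "((\<lambda>x. mlcorr a 1 x) \<longlongrightarrow> 0) (at_right 0)"
proof (rule Lim_null_comparison)
  define C where "C = 4 * angle_const 1"
  define T where "T = (\<Sum>k. tail_weight k)"
  define S1 where "S1 = (\<Sum>m. real (Suc m) powr - 3)"
  define S2 where "S2 = (\<Sum>m. real (Suc m) powr - (3/2))"
  let ?V = "\<lambda>x. 1 / (2 * pi) * (2 * pi / x) powr - 2 * S1 + 1 / (2 * pi) * (2 * pi / x) powr - (1/2) * S2"
  have sp: "summable (\<lambda>m. real (Suc m) powr - 3)" "summable (\<lambda>m. real (Suc m) powr - (3/2))"
    by (rule summable_shifted_powr; simp)+
  have w: "(\<Sum>m. mlweight 1 x m) = ?V x"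
    if "x > 0" for x
  proof -
    have "(\<Sum>m. mlweight 1 x m) = (\<Sum>m. (1 / (2 * pi) * (2 * pi / x) powr - 2) * real (Suc m) powr - 3
        + (1 / (2 * pi) * (2 * pi / x) powr - (1/2)) * real (Suc m) powr - (3/2))"
      using that by (subst mlweight_eq) simp_all
    also have "\<dots> = (\<Sum>m. (1 / (2 * pi) * (2 * pi / x) powr - 2) * real (Suc m) powr - 3)
        + (\<Sum>m. (1 / (2 * pi) * (2 * pi / x) powr - (1/2)) * real (Suc m) powr - (3/2))"
      by (intro suminf_add[symmetric] summable_mult sp)
    also have "\<dots> = ?V x"
      unfolding S1_def S2_def suminf_mult[OF sp(1)] suminf_mult[OF sp(2)] ..
    finally show ?thesis .
  qed
  have pw: "((\<lambda>x. (2 * pi / x) powr - s) \<longlongrightarrow> 0) (at_right 0)" if "s > 0" for s :: real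
  proof -
    have "filterlim (\<lambda>x. 2 * pi / x) at_top (at_right (0::real))"
      using filterlim_tendsto_pos_mult_at_top[OF tendsto_const _ filterlim_inverse_at_top_right, of "2 * pi"]
      by (simp add: divide_inverse)
    from filterlim_compose[OF tendsto_neg_powr[OF _ filterlim_ident] this] show ?thesis using that by simp
  qed
  have "((\<lambda>x. C * (?V x) * T) \<longlongrightarrow>
     C * (1 / (2 * pi) * 0 * S1 + 1 / (2 * pi) * 0 * S2) * T) (at_right 0)"
    by (intro tendsto_intros pw) auto
  thus "((\<lambda>x. C * (?V x) * T) \<longlongrightarrow> 0) (at_right 0)"
    by simp
  show "\<forall>\<^sub>F x in at_right 0. norm (mlcorr a 1 x) \<le> C * (?V x) * T"
    using eventually_at_right_less[of "0::real"]
  proof eventually_elim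
    case (elim x)
    show ?case using mldiff_sums(5)[of 1 x a] elim unfolding w[OF elim] C_def T_def by simp
  qed
qed

section \<open>The constant term\<close>

definition lambert_term :: "real \<Rightarrow> nat \<Rightarrow> real \<Rightarrow> nat \<Rightarrow> real" where
  "lambert_term a N x n = exp (- a * real (Suc n) ^ N * x) / (real (Suc n) * (1 - exp (- (real (Suc n) ^ N) * x)))"

definition lambert :: "real \<Rightarrow> nat \<Rightarrow> real \<Rightarrow> real" where
  "lambert a N x = (\<Sum>n. lambert_term a N x n)"

lemma lambert_term_bounds:
  assumes a: "a > 0" and N: "N > 0" and x: "x > 0"
  shows "0 < lambert_term a N x n" and "lambert_term a N x n \<le> exp (- a * x) / (1 - exp (- x)) * exp (- a * x) ^ n"
proof -
  define s where "s = real (Suc n)"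
  have s: "s \<ge> 1" by (simp add: s_def)
  have sN: "s \<le> s ^ N" using s N power_increasing[of 1 N s] by simp
  have s1: "1 \<le> s ^ N" using s sN by linarith
  have "x * 1 \<le> x * s ^ N" using s1 x by (intro mult_left_mono) auto
  hence e: "exp (- (s ^ N) * x) \<le> exp (- x)" by (simp add: mult.commute)
  have e1: "exp (- x) < 1" using x by simp
  have pos: "s * (1 - exp (- (s ^ N) * x)) > 0" using s e e1 by (intro mult_pos_pos) linarith+
  show "0 < lambert_term a N x n"
    using pos unfolding lambert_term_def s_def[symmetric] by (intro divide_pos_pos) auto
  have "1 * (1 - exp (- x)) \<le> s * (1 - exp (- (s ^ N) * x))"
    using s e e1 by (intro mult_mono) auto
  moreover have "(a * x) * s \<le> (a * x) * s ^ N" using a x sN by (intro mult_left_mono) auto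
  hence "exp (- a * s ^ N * x) \<le> exp (- a * x * s)" by (simp add: mult_ac)
  ultimately have "lambert_term a N x n \<le> exp (- a * x * s) / (1 - exp (- x))"
    using e1 unfolding lambert_term_def s_def[symmetric] by (intro frac_le) auto
  also have "exp (- a * x * s) = exp (- a * x) * exp (- a * x) ^ n"
    by (simp add: s_def exp_of_nat_mult[symmetric] exp_add[symmetric] algebra_simps)
  finally show "lambert_term a N x n \<le> exp (- a * x) / (1 - exp (- x)) * exp (- a * x) ^ n" by simp
qed

lemma summable_lambert_term:
  assumes "a > 0" "N > 0" "x > 0"
  shows "summable (lambert_term a N x)"
proof (rule summable_comparison_test')
  show "summable (\<lambda>n. exp (- a * x) / (1 - exp (- x)) * exp (- a * x) ^ n)"
    using assms by (intro summable_mult summable_geometric) simp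
  show "norm (lambert_term a N x n) \<le> exp (- a * x) / (1 - exp (- x)) * exp (- a * x) ^ n" for n
    using lambert_term_bounds[OF assms, of n] by simp
qed

lemma lambert_term_sums:
  "a > 0 \<Longrightarrow> N > 0 \<Longrightarrow> x > 0 \<Longrightarrow> lambert_term a N x sums lambert a N x"
  unfolding lambert_def by (intro summable_sums summable_lambert_term)

lemma zeta_nat_sums: "s > 1 \<Longrightarrow> (\<lambda>n. 1 / real (Suc n) ^ s) sums zeta_nat s"
proof -
  assume s: "s > 1"
  have "summable (\<lambda>n. real (Suc n) powr - real s)" using s by (intro summable_shifted_powr) simp
  also have "(\<lambda>n. real (Suc n) powr - real s) = (\<lambda>n. 1 / real (Suc n) ^ s)"
  proof
    fix n
    show "real (Suc n) powr - real s = 1 / real (Suc n) ^ s"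
      by (simp only: powr_minus_divide powr_realpow of_nat_0_less_iff zero_less_Suc)
  qed
  finally show ?thesis unfolding zeta_nat_def by (rule summable_sums)
qed

section \<open>Partial sums and a constant common to all \<open>N\<close> and
  \<open>x\<close>\<close>

lemma lambert_term_eq:
  assumes a: "0 < a" "a \<le> 1" and N: "odd N" and x: "x > 0"
  shows "lambert_term a N x k = 1 / real (Suc k) ^ (N + 1) / x + (1/2 - a) * inverse (real (Suc k)) + (\<Sum>m. mldiff a N x m k)
     + (mlsum a (real (Suc k) ^ N * x) - mlsum a (real k ^ N * x)) / real N"
proof -
  define s where "s = real (Suc k)"
  have s: "s > 0" by (simp add: s_def)
  define t where "t = s ^ N * x"
  have t: "t > 0" using s x by (simp add: t_def)
  let ?E = "exp (- a * t) / (1 - exp (- t))" and ?d = "mlsum a (s ^ N * x) - mlsum a (real k ^ N * x)"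
  have "(\<lambda>m. mlterm a m t) sums (?E - 1 / t - (1/2 - a))"
    using a t by (intro mittag_leffler_exp) auto
  hence "(\<lambda>m. mlterm a m t / s) sums ((?E - 1 / t - (1/2 - a)) / s)"
    by (rule sums_divide)
  moreover have "(\<lambda>m. mldiff a N x m k + (mlprim a m (s ^ N * x) - mlprim a m (real k ^ N * x)) / real N)
      sums ((\<Sum>m. mldiff a N x m k) + (?d) / real N)"
    unfolding mlsum_def
    by (intro sums_add sums_divide sums_diff summable_sums mldiff_sums(2)[OF N x] mlsum_deriv_summable(1))
  moreover have "mldiff a N x m k + (mlprim a m (s ^ N * x) - mlprim a m (real k ^ N * x)) / real N = mlterm a m t / s" for m
    by (simp only: mldiff_def s_def t_def)
  ultimately have eq: "(?E - 1 / t - (1/2 - a)) / s =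
      (\<Sum>m. mldiff a N x m k) + (?d) / real N"
    using sums_unique2 by simp
  have 1: "lambert_term a N x k = ?E / s"
    by (simp add: lambert_term_def t_def s_def mult_ac)
  have 2: "1 / t / s = 1 / s ^ (N + 1) / x" by (simp add: t_def)
  have 3: "(1/2 - a) / s = (1/2 - a) * inverse s" by (rule divide_inverse)
  have gen: "l = z + h + m + d"
    if "l = A / s" "(A - B - D) / s = m + d" "B / s = z" "D / s = h" for l A B D m d z h :: real
    using that by (simp add: diff_divide_distrib)
  show ?thesis unfolding s_def[symmetric] by (rule gen[OF 1 eq 2 3])
qed

text \<open>After division by \<open>Suc k\<close>, the term \<open>1 / t\<close> of the expansion
  adds up to the zeta sum and the term \<open>1/2 - a\<close> to a harmonic number, while the
  primitives telescope to their value at \<open>K ^ N * x\<close>.\<close>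

lemma lambert_partial_sum:
  assumes a: "0 < a" "a \<le> 1" and N: "odd N" and x: "x > 0"
  shows "(\<Sum>k<K. lambert_term a N x k) = (\<Sum>k<K. 1 / real (Suc k) ^ (N + 1)) / x + (1/2 - a) * harm K
     + (\<Sum>k<K. \<Sum>m. mldiff a N x m k) + mlsum a (real K ^ N * x) / real N"
proof (induction K)
  case 0
  have "N > 0" using N by (rule odd_pos)
  thus ?case by (simp add: harm_def zero_power)
next
  case (Suc K)
  show ?case using Suc.IH lambert_term_eq[OF assms, of K]
    unfolding sum.lessThan_Suc harm_Suc add_divide_distrib diff_divide_distrib distrib_left by linarith
qed

text \<open>Once \<open>ln K\<close> is subtracted from the harmonic number, every other piece of
  the partial sum converges; this determines \<open>mlsum\<close> along the points
  \<open>K ^ N * x\<close>.\<close>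

lemma tendsto_mlsum_nat:
  assumes a: "0 < a" "a \<le> 1" and N: "odd N" and x: "x > 0"
  shows "(\<lambda>K. mlsum a (real K ^ N * x) / real N + (1/2 - a) * ln (real K)) \<longlonglongrightarrow>
     lambert a N x - zeta_nat (N + 1) / x - (1/2 - a) * euler_mascheroni - mlcorr a N x"
proof -
  have N0: "N > 0" using N by (rule odd_pos)
  have l: "(\<lambda>K. \<Sum>k<K. lambert_term a N x k) \<longlonglongrightarrow> lambert a N x"
    using lambert_term_sums[OF a(1) N0 x] by (simp only: sums_def)
  have z: "(\<lambda>K. \<Sum>k<K. 1 / real (Suc k) ^ (N + 1)) \<longlonglongrightarrow> zeta_nat (N + 1)"
    using zeta_nat_sums[of "N + 1"] N0 by (simp add: sums_def)
  have d: "(\<lambda>K. \<Sum>k<K. \<Sum>m. mldiff a N x m k) \<longlonglongrightarrow> mlcorr a N x"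
    using mldiff_sums(1)[OF N x] by (simp only: sums_def)
  have "(\<lambda>K. (\<Sum>k<K. lambert_term a N x k) - (\<Sum>k<K. 1 / real (Suc k) ^ (N + 1)) / x
        - (1/2 - a) * (harm K - ln (real K)) - (\<Sum>k<K. \<Sum>m. mldiff a N x m k)) \<longlonglongrightarrow>
      lambert a N x - zeta_nat (N + 1) / x - (1/2 - a) * euler_mascheroni - mlcorr a N x"
    using x by (intro tendsto_diff tendsto_mult tendsto_divide tendsto_const l z d euler_mascheroni_LIMSEQ) auto
  moreover have "(\<Sum>k<K. lambert_term a N x k) - (\<Sum>k<K. 1 / real (Suc k) ^ (N + 1)) / x
        - (1/2 - a) * (harm K - ln (real K)) - (\<Sum>k<K. \<Sum>m. mldiff a N x m k)
      = mlsum a (real K ^ N * x) / real N + (1/2 - a) * ln (real K)" for K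
    unfolding lambert_partial_sum[OF assms] right_diff_distrib by linarith
  ultimately show ?thesis by (simp only:)
qed

lemma tendsto_mono_at_top_of_nat:
  fixes F :: "real \<Rightarrow> real"
  assumes mono: "\<And>s t. 0 < s \<Longrightarrow> s \<le> t \<Longrightarrow> F s \<le> F t" and lim: "(\<lambda>n. F (real n)) \<longlonglongrightarrow> c"
  shows "(F \<longlongrightarrow> c) at_top"
proof (rule tendsto_sandwich)
  have fl: "filterlim (\<lambda>t::real. nat \<lfloor>t\<rfloor>) sequentially at_top"
    by (rule filterlim_compose[OF filterlim_nat_sequentially filterlim_floor_sequentially])
  have cl: "filterlim (\<lambda>t::real. nat \<lceil>t\<rceil>) sequentially at_top"
    by (rule filterlim_at_top_mono[OF fl]) (auto intro!: always_eventually nat_mono floor_le_ceiling)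
  show "((\<lambda>t::real. F (real (nat \<lfloor>t\<rfloor>))) \<longlongrightarrow> c) at_top" using filterlim_compose[OF lim fl] .
  show "((\<lambda>t::real. F (real (nat \<lceil>t\<rceil>))) \<longlongrightarrow> c) at_top" using filterlim_compose[OF lim cl] .
  show "\<forall>\<^sub>F t in at_top. F (real (nat \<lfloor>t\<rfloor>)) \<le> F t"
    using eventually_ge_at_top[of 1]
  proof eventually_elim
    case (elim t)
    hence "\<lfloor>t\<rfloor> \<ge> 1" by simp
    thus ?case by (intro mono) (simp_all add: of_nat_nat)
  qed
  show "\<forall>\<^sub>F t in at_top. F t \<le> F (real (nat \<lceil>t\<rceil>))"
    using eventually_ge_at_top[of 1]
  proof eventually_elim
    case (elim t)
    thus ?case by (intro mono) linarith+
  qed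
qed

text \<open>Different \<open>N\<close> and \<open>x\<close> sample \<open>mlsum\<close> along
  different sequences, so a limit over the reals is needed to compare them. The case
  \<open>N = 1\<close>, \<open>x = 1\<close> gives it along the integers, and monotonicity does the
  rest.\<close>

lemma mlsum_asymptotic:
  assumes a: "0 < a" "a \<le> 1"
  shows "\<exists>c. ((\<lambda>T. mlsum a T + (1/2 - a) * ln T) \<longlongrightarrow> c) at_top"
proof -
  \<comment> \<open>Subtracting \<open>1 / T\<close>, which vanishes at infinity, turns the
    derivative into the positive function \<open>?E t / t\<close>; without it monotonicity would not
    be evident.\<close>
  define F where "F = (\<lambda>T. mlsum a T + (1/2 - a) * ln T - 1 / T)"
  let ?E = "\<lambda>t. exp (- a * t) / (1 - exp (- t))"
  have F': "(F has_real_derivative ?E t / t) (at t)" if t: "t > 0" for t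
  proof -
    have "(\<lambda>m. t * mlder a m t) sums (?E t - 1 / t - (1/2 - a))"
      unfolding mlterm_eq_mlder[symmetric] using a t by (intro mittag_leffler_exp) auto
    from sums_divide[OF this, of t]
    have "(\<lambda>m. mlder a m t) sums ((?E t - 1 / t - (1/2 - a)) / t)" using t by simp
    hence "(\<Sum>m. mlder a m t) = (?E t - 1 / t - (1/2 - a)) / t" by (simp add: sums_iff)
    hence d: "(mlsum a has_real_derivative (?E t - 1 / t - (1/2 - a)) / t) (at t)"
      using mlsum_deriv_summable(2)[of a t] by simp
    have "(F has_real_derivative (?E t - 1 / t - (1/2 - a)) / t + (1/2 - a) * (1 / t) - (- 1 / (t * t))) (at t)"
      unfolding F_def using t
      by (intro DERIV_diff DERIV_add d DERIV_cmult) (auto intro!: derivative_eq_intros simp: divide_inverse)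
    moreover have "(E - 1 / t - (1/2 - a)) / t + (1/2 - a) * (1 / t) - (- 1 / (t * t)) = E / t" for E
      using t by (simp add: diff_divide_distrib)
    ultimately show ?thesis by simp
  qed
  have mono: "F s \<le> F t" if "0 < s" "s \<le> t" for s t
  proof (rule DERIV_nonneg_imp_nondecreasing[OF that(2)])
    fix u assume "s \<le> u" "u \<le> t"
    hence "u > 0" using that by simp
    thus "\<exists>y. DERIV F u :> y \<and> 0 \<le> y" using F'[of u] by (intro exI[of _ "?E u / u"]) auto
  qed
  define l where "l = lambert a 1 1 - zeta_nat (1 + 1) / 1 - (1/2 - a) * euler_mascheroni - mlcorr a 1 1"
  have inv: "((\<lambda>T. 1 / T) \<longlongrightarrow> 0) (at_top :: real filter)"
    using tendsto_inverse_0_at_top[OF filterlim_ident] by (simp add: inverse_eq_divide)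
  have "(\<lambda>K. mlsum a (real K) + (1/2 - a) * ln (real K)) \<longlonglongrightarrow> l"
    using tendsto_mlsum_nat[OF a, of 1 1] unfolding l_def by simp
  hence "(\<lambda>K. F (real K)) \<longlonglongrightarrow> l - 0"
    unfolding F_def by (intro tendsto_diff lim_1_over_n)
  hence "(F \<longlongrightarrow> l) at_top" by (intro tendsto_mono_at_top_of_nat mono) auto
  from tendsto_add[OF this inv] have "((\<lambda>T. mlsum a T + (1/2 - a) * ln T) \<longlongrightarrow> l + 0) at_top" by (simp add: F_def)
  thus ?thesis by blast
qed

text \<open>The order of the quantifiers is the content: \<open>c\<close> is the constant term of
  \<open>mlsum a\<close> alone. Since \<open>ln (K ^ N * x) = N * ln K + ln x\<close>, replacing the
  argument of the logarithm costs only \<open>(1/2 - a) * ln x / N\<close>.\<close>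

lemma lambert_eq_aux:
  assumes a: "0 < a" "a \<le> 1"
  shows "\<exists>c. \<forall>N x. odd N \<longrightarrow> x > 0 \<longrightarrow> lambert a N x = zeta_nat (N + 1) / x + (1/2 - a) * euler_mascheroni + mlcorr a N x
     + (c - (1/2 - a) * ln x) / real N"
proof -
  obtain c where c: "((\<lambda>T. mlsum a T + (1/2 - a) * ln T) \<longlongrightarrow> c) at_top"
    using mlsum_asymptotic[OF a] by blast
  have "lambert a N x = zeta_nat (N + 1) / x + (1/2 - a) * euler_mascheroni + mlcorr a N x + (c - (1/2 - a) * ln x) / real N"
    if N: "odd N" and x: "x > 0" for N x
  proof -
    have N0: "N > 0" using N by (rule odd_pos)
    have "filterlim (\<lambda>K. real K ^ N * x) at_top sequentially"
      by (intro filterlim_at_top_mult_tendsto_pos[OF tendsto_const x] filterlim_pow_at_top N0 filterlim_real_sequentially)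
    from filterlim_compose[OF c this]
    have "(\<lambda>K. mlsum a (real K ^ N * x) + (1/2 - a) * ln (real K ^ N * x)) \<longlonglongrightarrow> c" .
    hence "(\<lambda>K. ((mlsum a (real K ^ N * x) + (1/2 - a) * ln (real K ^ N * x)) - (1/2 - a) * ln x) / real N)
        \<longlonglongrightarrow> (c - (1/2 - a) * ln x) / real N"
      using N0 by (intro tendsto_divide tendsto_diff tendsto_const) auto
    moreover have "\<forall>\<^sub>F K in sequentially. ((mlsum a (real K ^ N * x) + (1/2 - a) * ln (real K ^ N * x)) - (1/2 - a) * ln x) / real N
        = mlsum a (real K ^ N * x) / real N + (1/2 - a) * ln (real K)"
      using eventually_gt_at_top[of 0]
    proof eventually_elim
      case (elim K)
      have "ln (real K ^ N * x) = real N * ln (real K) + ln x"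
        using elim x by (simp add: ln_mult ln_realpow)
      moreover have "((A + h * (n * b + d)) - h * d) / n = A / n + h * b" if "n \<noteq> 0" for A h n b d :: real
        using that by (simp add: field_simps)
      ultimately show ?case using N0 by simp
    qed
    ultimately have "(\<lambda>K. mlsum a (real K ^ N * x) / real N + (1/2 - a) * ln (real K)) \<longlonglongrightarrow> (c - (1/2 - a) * ln x) / real N"
      by (rule Lim_transform_eventually)
    with tendsto_mlsum_nat[OF a N x]
    have "lambert a N x - zeta_nat (N + 1) / x - (1/2 - a) * euler_mascheroni - mlcorr a N x = (c - (1/2 - a) * ln x) / real N"
      by (rule LIMSEQ_unique)
    thus ?thesis by simp
  qed
  thus ?thesis by blast
qed

text \<open>\<open>lambert a 1 x\<close> is \<open>- log (q^a; q)\<close> for \<open>q = exp (-x)\<close>, so the limit of \<open>qlog a\<close> at \<open>0\<close>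
  satisfies the functional equation of \<open>log \<Gamma>\<close>.\<close>
definition qlog :: "real \<Rightarrow> real \<Rightarrow> real" where
  "qlog a x = lambert a 1 x - zeta_nat 2 / x + (1/2 - a) * ln x"

section \<open>The constant as a function of \<open>a\<close>\<close>

text \<open>For \<open>N = 1\<close> the correction disappears as \<open>x\<close> tends to 0, so
  the unknown constant is the limit of \<open>qlog a\<close> shifted by
  \<open>(1/2 - a) * euler_mascheroni\<close>.\<close>

lemma qlog_Icc_tendsto:
  assumes a: "0 < a" "a \<le> 1"
  shows "\<exists>C. (qlog a \<longlongrightarrow> C) (at_right 0) \<and> (\<forall>N x. odd N \<longrightarrow> x > 0 \<longrightarrow>
     lambert a N x = zeta_nat (N + 1) / x + (1/2 - a) * euler_mascheroni + mlcorr a N x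
     + (C - (1/2 - a) * euler_mascheroni - (1/2 - a) * ln x) / real N)"
proof -
  obtain c where c: "\<And>N x. odd N \<Longrightarrow> x > 0 \<Longrightarrow> lambert a N x = zeta_nat (N + 1) / x + (1/2 - a) * euler_mascheroni + mlcorr a N x
     + (c - (1/2 - a) * ln x) / real N"
    using lambert_eq_aux[OF a] by blast
  have "((\<lambda>x. (1/2 - a) * euler_mascheroni + mlcorr a 1 x + c) \<longlongrightarrow> (1/2 - a) * euler_mascheroni + 0 + c) (at_right 0)"
    by (intro tendsto_add tendsto_const mlcorr_1_tendsto_0)
  moreover have "\<forall>\<^sub>F x in at_right 0. (1/2 - a) * euler_mascheroni + mlcorr a 1 x + c = qlog a x"
    using eventually_at_right_less[of "0::real"]
  proof eventually_elim
    case (elim x)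
    show ?case unfolding qlog_def using c[of 1 x] elim by (simp add: numeral_2_eq_2)
  qed
  ultimately have "(qlog a \<longlongrightarrow> (1/2 - a) * euler_mascheroni + 0 + c) (at_right 0)"
    by (rule Lim_transform_eventually)
  thus ?thesis using c by (intro exI[of _ "(1/2 - a) * euler_mascheroni + 0 + c"]) auto
qed

text \<open>Passing from \<open>a\<close> to \<open>a + 1\<close> multiplies the numerator by
  \<open>exp (- n x)\<close>; the difference cancels the factor \<open>1 - exp (- n x)\<close> and
  leaves the logarithmic series.\<close>

lemma lambert_1_shift:
  assumes a: "a > 0" and x: "x > 0"
  shows "lambert (a + 1) 1 x = lambert a 1 x + ln (1 - exp (- a * x))"
proof -
  define y where "y = exp (- a * x)"
  have y: "0 < y" "y < 1" using a x by (auto simp: y_def)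
  have "(\<lambda>n. y ^ Suc n / real (Suc n)) sums (- ln (1 - y))"
  proof -
    have "(\<lambda>n. - ((- (- y)) ^ n) / real n) sums ln (1 + - y)"
      using y by (intro ln_series') simp
    hence "(\<lambda>n. - (- ((- (- y)) ^ n) / real n)) sums (- ln (1 + - y))" by (rule sums_minus)
    hence "(\<lambda>n. y ^ n / real n) sums (- ln (1 - y))" by simp
    thus ?thesis using sums_Suc_iff[of "\<lambda>n. y ^ n / real n" "- ln (1 - y)"] by simp
  qed
  moreover have "y ^ Suc n / real (Suc n) = lambert_term a 1 x n - lambert_term (a + 1) 1 x n" for n
  proof -
    have ne: "exp (- real (Suc n) * x) \<noteq> 1" using x by simp
    have e: "exp (- (a + 1) * real (Suc n) * x) = exp (- a * real (Suc n) * x) * exp (- real (Suc n) * x)"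
      by (simp add: exp_add[symmetric] algebra_simps)
    have "y ^ Suc n = exp (- a * real (Suc n) * x)"
      unfolding y_def exp_of_nat_mult[symmetric] by (simp only: mult_ac)
    moreover have "E / (s * (1 - D)) - E * D / (s * (1 - D)) = E / s" if "D \<noteq> 1" for E D s :: real
    proof -
      have "E / (s * (1 - D)) - E * D / (s * (1 - D)) = E * (1 - D) / (s * (1 - D))"
        by (simp add: diff_divide_distrib[symmetric] algebra_simps)
      thus ?thesis using that by simp
    qed
    ultimately show ?thesis unfolding lambert_term_def power_one_right e using ne by simp
  qed
  ultimately have "(\<lambda>n. lambert_term a 1 x n - lambert_term (a + 1) 1 x n) sums (- ln (1 - y))" by simp
  moreover have "(\<lambda>n. lambert_term a 1 x n - lambert_term (a + 1) 1 x n) sums (lambert a 1 x - lambert (a + 1) 1 x)"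
    using a x by (intro sums_diff lambert_term_sums) auto
  ultimately have "- ln (1 - y) = lambert a 1 x - lambert (a + 1) 1 x" by (rule sums_unique2)
  thus ?thesis by (simp add: y_def)
qed

text \<open>The change of \<open>(1/2 - a) * ln x\<close> contributes \<open>- ln x\<close>, which
  combines with the logarithm of the shift to \<open>ln ((1 - exp (- a * x)) / x)\<close>, with
  limit \<open>ln a\<close>.\<close>

lemma qlog_shift_tendsto:
  assumes a: "a > 0" and C: "(qlog a \<longlongrightarrow> C) (at_right 0)"
  shows "(qlog (a + 1) \<longlongrightarrow> C + ln a) (at_right 0)"
proof -
  have "((\<lambda>x. 1 - exp (- a * x)) has_real_derivative a) (at 0)"
    by (auto intro!: derivative_eq_intros)
  hence "((\<lambda>x. (1 - exp (- a * x)) / x) \<longlongrightarrow> a) (at 0)"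
    by (simp add: has_field_derivative_iff)
  hence "((\<lambda>x. (1 - exp (- a * x)) / x) \<longlongrightarrow> a) (at_right 0)"
    by (rule tendsto_within_subset) simp
  hence "((\<lambda>x. qlog a x + ln ((1 - exp (- a * x)) / x)) \<longlongrightarrow> C + ln a) (at_right 0)"
    using a by (intro tendsto_add C tendsto_ln) auto
  moreover have "\<forall>\<^sub>F x in at_right 0. qlog a x + ln ((1 - exp (- a * x)) / x) = qlog (a + 1) x"
    using eventually_at_right_less[of "0::real"]
  proof eventually_elim
    case (elim x)
    have "1 - exp (- a * x) > 0" using a elim by simp
    hence "ln ((1 - exp (- a * x)) / x) = ln (1 - exp (- a * x)) - ln x"
      using elim by (rule ln_divide_pos)
    thus ?case using lambert_1_shift[OF a elim] by (simp add: qlog_def algebra_simps)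
  qed
  ultimately show ?thesis by (rule Lim_transform_eventually)
qed

definition qlim :: "real \<Rightarrow> real" where
  "qlim a = Lim (at_right 0) (qlog a)"

lemma qlim_eqI: "(qlog a \<longlongrightarrow> C) (at_right 0) \<Longrightarrow> qlim a = C"
  unfolding qlim_def by (rule tendsto_Lim[OF trivial_limit_at_right_real])

text \<open>The Fourier argument covers \<open>0 < a \<le> 1\<close> only, whereas Bohr--Mollerup
  requires the whole half-line; the shift by 1 extends the limit.\<close>

lemma qlog_tendsto_qlim: "a > 0 \<Longrightarrow> (qlog a \<longlongrightarrow> qlim a) (at_right 0)"
proof -
  assume a: "a > 0"
  have "\<exists>C. (qlog (b + real n) \<longlongrightarrow> C) (at_right 0)" if "0 < b" "b \<le> 1" for b n
  proof (induction n)
    case 0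
    thus ?case using qlog_Icc_tendsto[OF that] by auto
  next
    case (Suc n)
    then obtain C where "(qlog (b + real n) \<longlongrightarrow> C) (at_right 0)" by blast
    from qlog_shift_tendsto[OF _ this] that show ?case by (auto simp: add_ac)
  qed
  moreover have "\<exists>b n. 0 < b \<and> b \<le> 1 \<and> a = b + real n"
  proof -
    define n where "n = nat (\<lceil>a\<rceil> - 1)"
    have "\<lceil>a\<rceil> \<ge> 1" using a by simp
    hence "real n = of_int \<lceil>a\<rceil> - 1" by (simp add: n_def)
    hence "0 < a - real n" "a - real n \<le> 1" "a = (a - real n) + real n" by linarith+
    thus ?thesis by blast
  qed
  ultimately obtain C where "(qlog a \<longlongrightarrow> C) (at_right 0)" by blast
  thus ?thesis using qlim_eqI by metis
qed

text \<open>Each summand of \<open>lambert\<close> is convex in \<open>a\<close>, being an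
  exponential with a positive factor; the remaining part of \<open>qlog\<close> is affine in
  \<open>a\<close>, and the inequality survives the limit.\<close>

lemma qlim_convex: "convex_on {0<..} qlim"
proof (rule convex_onI)
  fix t b c :: real assume t: "0 < t" "t < 1" and b: "b \<in> {0<..}" and c: "c \<in> {0<..}"
  define d where "d = (1 - t) *\<^sub>R b + t *\<^sub>R c"
  have d0: "d > 0" using t b c by (simp add: d_def add_pos_pos)
  have "\<forall>\<^sub>F x in at_right 0. qlog d x \<le> (1 - t) * qlog b x + t * qlog c x"
    using eventually_at_right_less[of "0::real"]
  proof eventually_elim
    case (elim x)
    have "lambert_term d 1 x n \<le> (1 - t) * lambert_term b 1 x n + t * lambert_term c 1 x n" for n
    proof -
      define s where "s = real (Suc n)"
      have "exp ((1 - t) * (- b * s * x) + t * (- c * s * x)) \<le> (1 - t) * exp (- b * s * x) + t * exp (- c * s * x)"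
        using convex_onD[OF exp_convex, of t "- b * s * x" "- c * s * x"] t by (simp only: real_scaleR_def UNIV_I less_imp_le)
      moreover have "- d * s * x = (1 - t) * (- b * s * x) + t * (- c * s * x)"
        by (simp add: d_def algebra_simps)
      ultimately have "exp (- d * s * x) \<le> (1 - t) * exp (- b * s * x) + t * exp (- c * s * x)" by simp
      moreover have "0 < s * (1 - exp (- s * x))"
      proof -
        have "s > 0" by (simp add: s_def)
        thus ?thesis using elim by (intro mult_pos_pos) auto
      qed
      ultimately have "exp (- d * s * x) / (s * (1 - exp (- s * x))) \<le> ((1 - t) * exp (- b * s * x) + t * exp (- c * s * x)) / (s * (1 - exp (- s * x)))"
        by (intro divide_right_mono) auto
      thus ?thesis unfolding lambert_term_def s_def[symmetric] power_one_right
        by (simp only: add_divide_distrib times_divide_eq_right)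
    qed
    moreover have "lambert_term d 1 x sums lambert d 1 x" using d0 elim by (intro lambert_term_sums) auto
    moreover have "(\<lambda>n. (1 - t) * lambert_term b 1 x n + t * lambert_term c 1 x n) sums ((1 - t) * lambert b 1 x + t * lambert c 1 x)"
      using b c elim by (intro sums_add sums_mult lambert_term_sums) auto
    ultimately have "lambert d 1 x \<le> (1 - t) * lambert b 1 x + t * lambert c 1 x"
      by (rule sums_le)
    moreover have "1/2 - d = (1 - t) * (1/2 - b) + t * (1/2 - c)" by (simp add: d_def field_simps)
    moreover have "L - z + ((1 - t) * p + t * q) * l \<le> (1 - t) * (B - z + p * l) + t * (C - z + q * l)"
      if "L \<le> (1 - t) * B + t * C" for L B C p q z l :: real
      using that by (simp add: algebra_simps)
    ultimately show ?case unfolding qlog_def by presburger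
  qed
  moreover have "((\<lambda>x. (1 - t) * qlog b x + t * qlog c x) \<longlongrightarrow> (1 - t) * qlim b + t * qlim c) (at_right 0)"
    using b c by (intro tendsto_add tendsto_mult tendsto_const qlog_tendsto_qlim) auto
  ultimately have "qlim d \<le> (1 - t) * qlim b + t * qlim c"
    by (intro tendsto_le[OF trivial_limit_at_right_real _ qlog_tendsto_qlim[OF d0]])
  thus "qlim ((1 - t) *\<^sub>R b + t *\<^sub>R c) \<le> (1 - t) * qlim b + t * qlim c" by (simp add: d_def)
qed simp

text \<open>From \<open>y / (1 - y^2) + y^2 / (1 - y^2) = y / (1 - y)\<close> one gets
  \<open>lambert (1/2) 1 x + lambert 1 1 x = lambert 1 1 (x / 2)\<close>. In the limit the unknown
  \<open>qlim 1\<close> occurs twice with opposite signs, so a value is obtained before the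
  normalisation is known.\<close>

lemma qlim_half: "qlim (1/2) = - ln 2 / 2"
proof -
  have "((\<lambda>x. qlog 1 (x / 2) - ln 2 / 2 - qlog 1 x) \<longlongrightarrow> qlim 1 - ln 2 / 2 - qlim 1) (at_right 0)"
  proof (intro tendsto_diff tendsto_const qlog_tendsto_qlim)
    have "filterlim (\<lambda>x::real. x / 2) (at_right 0) (at_right 0)"
      unfolding filterlim_at using eventually_at_right_less[of "0::real"]
      by (auto intro!: tendsto_eq_intros elim!: eventually_mono)
    thus "((\<lambda>x. qlog 1 (x / 2)) \<longlongrightarrow> qlim 1) (at_right 0)"
      using filterlim_compose[OF qlog_tendsto_qlim[of 1]] by simp
  qed simp
  moreover have "\<forall>\<^sub>F x in at_right 0. qlog 1 (x / 2) - ln 2 / 2 - qlog 1 x = qlog (1/2) x"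
    using eventually_at_right_less[of "0::real"]
  proof eventually_elim
    case (elim x)
    have "lambert_term (1/2) 1 x n + lambert_term 1 1 x n = lambert_term 1 1 (x / 2) n" for n
    proof -
      define r where "r = real (Suc n)"
      define y where "y = exp (- (r * x / 2))"
      have y: "0 < y" "y < 1" using elim by (auto simp: y_def r_def)
      have "exp (- r * x) = y ^ 2" by (simp add: y_def exp_double[symmetric])
      moreover have "exp (- (1/2) * r * x) = y" "exp (- r * (x / 2)) = y" "exp (- 1 * r * x) = exp (- r * x)" "exp (- 1 * r * (x / 2)) = exp (- r * (x / 2))"
        by (simp_all add: y_def)
      moreover have "y / (s * (1 - y ^ 2)) + y ^ 2 / (s * (1 - y ^ 2)) = y / (s * (1 - y))" for s
      proof -
        have "y / (s * (1 - y ^ 2)) + y ^ 2 / (s * (1 - y ^ 2)) = y * (1 + y) / (s * ((1 - y) * (1 + y)))"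
          by (simp add: add_divide_distrib[symmetric] power2_eq_square algebra_simps)
        thus ?thesis using y by simp
      qed
      ultimately show ?thesis unfolding lambert_term_def power_one_right r_def[symmetric] by (simp only:)
    qed
    moreover have "(\<lambda>n. lambert_term (1/2) 1 x n + lambert_term 1 1 x n) sums (lambert (1/2) 1 x + lambert 1 1 x)"
      using elim by (intro sums_add lambert_term_sums) auto
    moreover have "lambert_term 1 1 (x / 2) sums lambert 1 1 (x / 2)" using elim by (intro lambert_term_sums) auto
    ultimately have "lambert (1/2) 1 x + lambert 1 1 x = lambert 1 1 (x / 2)" using sums_unique2 by simp
    moreover have "ln (x / 2) = ln x - ln 2" using elim by (intro ln_divide_pos) auto
    moreover have "zeta_nat 2 / (x / 2) = 2 * (zeta_nat 2 / x)" by simp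
    ultimately show ?case unfolding qlog_def by (simp only: algebra_simps)
  qed
  ultimately have "(qlog (1/2) \<longlongrightarrow> qlim 1 - ln 2 / 2 - qlim 1) (at_right 0)"
    by (rule Lim_transform_eventually)
  from qlim_eqI[OF this] show ?thesis by simp
qed

text \<open>Bohr--Mollerup, normalised by the duplication identity at \<open>a = 1/2\<close>.\<close>
lemma qlim_eq:
  assumes a: "a > 0"
  shows "qlim a = ln (Gamma a) - ln (2 * pi) / 2"
proof -
  define G where "G = (\<lambda>a. exp (qlim a - qlim 1))"
  have G: "G b = Gamma b" if "b > 0" for b
  proof (rule Gamma_pos_real_unique)
    show "G 1 = 1" by (simp add: G_def)
    show "G (x + 1) = x * G x" if "x > 0" for x
      using qlim_eqI[OF qlog_shift_tendsto[OF that qlog_tendsto_qlim[OF that]]] that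
      by (simp add: G_def exp_add exp_diff)
    show "convex_on {0<..} (ln \<circ> G)"
    proof -
      have "convex_on {0<..} (\<lambda>a. qlim a + - qlim 1)"
        by (intro convex_on_add qlim_convex convex_onI) (auto simp: algebra_simps)
      thus ?thesis by (simp add: G_def o_def)
    qed
  qed (use that in \<open>auto simp: G_def\<close>)
  have "qlim b - qlim 1 = ln (Gamma b)" if "b > 0" for b
  proof -
    have "ln (G b) = qlim b - qlim 1" by (simp add: G_def)
    thus ?thesis using G[OF that] by simp
  qed
  note this[OF a]
  \<comment> \<open>Comparing \<open>qlim_half\<close> with \<open>Gamma (1/2) = sqrt pi\<close>
    fixes the additive constant that Bohr--Mollerup leaves open.\<close>
  moreover have "qlim 1 = - ln 2 / 2 - ln (sqrt pi)"
    using \<open>\<And>b. b > 0 \<Longrightarrow> qlim b - qlim 1 = ln (Gamma b)\<close>[of "1/2"] by (simp add: qlim_half Gamma_one_half_real)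
  ultimately show ?thesis by (simp add: ln_mult ln_sqrt field_simps)
qed

theorem lambert_eq:
  assumes a: "0 < a" "a \<le> 1" and N: "odd N" and x: "x > 0"
  shows "lambert a N x = zeta_nat (N + 1) / x
     + 1 / real N * ((1/2 - a) * ((real N - 1) * euler_mascheroni - ln x) + ln (Gamma a) - 1/2 * ln (2 * pi))
     + mlcorr a N x"
proof -
  obtain C where C: "(qlog a \<longlongrightarrow> C) (at_right 0)" and
    L: "lambert a N x = zeta_nat (N + 1) / x + (1/2 - a) * euler_mascheroni + mlcorr a N x
     + (C - (1/2 - a) * euler_mascheroni - (1/2 - a) * ln x) / real N"
    using qlog_Icc_tendsto[OF a] N x by blast
  have C': "C = ln (Gamma a) - ln (2 * pi) / 2" using qlim_eqI[OF C] qlim_eq[OF a(1)] by simp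
  have N0: "real N \<noteq> 0" using odd_pos[OF N] by simp
  have "h * g + (G - p / 2 - h * g - h * l) / n = 1 / n * (h * ((n - 1) * g - l) + G - 1/2 * p)"
    if "n \<noteq> 0" for h g G p l n :: real using that by (simp add: field_simps)
  from this[OF N0] show ?thesis unfolding L C' by simp
qed

section \<open>Evaluation of the correction terms\<close>

lemma A_Nj_eq_ray: "A_Nj N j (real (Suc m) / x) = of_real pi * ray N x m j"
  by (simp add: A_Nj_def ray_def cis_conv_exp)

lemma Ln_ray:
  assumes N: "N = 2 * M + 1" and j: "j \<in> {- int M..int M}" and x: "x > 0"
  shows "Ln (ray N x m j) = of_real (ln (2 * pi * real (Suc m) / x) / real N) + \<i> * of_real (pi * of_int j / real N)"
proof (rule Ln_unique)
  define W where "W = 2 * pi * real (Suc m) / x"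
  let ?L = "of_real (ln (2 * pi * real (Suc m) / x) / real N) + \<i> * of_real (pi * of_int j / real N) :: complex"
  have W: "W > 0" using x by (simp add: W_def)
  have "\<bar>real_of_int j\<bar> < real N" using j N by auto
  hence "\<bar>real_of_int j / real N\<bar> < 1" using N by (simp add: divide_simps)
  hence "pi * \<bar>real_of_int j / real N\<bar> < pi * 1" by (intro mult_strict_left_mono) auto
  hence b: "\<bar>pi * (real_of_int j / real N)\<bar> < pi" by (simp only: abs_mult) simp
  show "- pi < Im (?L)"
    "Im (?L) \<le> pi"
    using b unfolding abs_less_iff by simp_all
  have "exp (of_real (ln W / real N)) = complex_of_real (W powr (1 / real N))"
    by (subst exp_of_real) (use W in \<open>simp add: powr_def\<close>)
  thus "exp (?L) = ray N x m j"
    unfolding W_def[symmetric] exp_add ray_def by (simp add: cis_conv_exp W_def)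
qed

text \<open>The angles cancel by symmetry in \<open>j\<close> and the modulus contributes
  \<open>N\<close> equal parts. Read from right to left, it distributes the logarithmic constant of
  the integral over the rays.\<close>

lemma sum_Ln_ray:
  assumes N: "N = 2 * M + 1" and x: "x > 0"
  shows "(\<Sum>j\<in>{- int M..int M}. Ln (ray N x m j)) = of_real (ln (2 * pi * real (Suc m) / x))"
proof -
  define l where "l = ln (2 * pi * real (Suc m) / x)"
  have "(\<Sum>j\<in>{- int M..int M}. Ln (ray N x m j)) = (\<Sum>j\<in>{- int M..int M}. of_real (l / real N) + \<i> * of_real (pi / real N) * of_int j)"
    using Ln_ray[OF N _ x] by (intro sum.cong) (auto simp: l_def)
  also have "\<dots> = of_nat (card {- int M..int M}) * of_real (l / real N) + \<i> * of_real (pi / real N) * of_int (\<Sum>j\<in>{- int M..int M}. j)"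
    by (simp only: sum.distrib sum_constant sum_distrib_left[symmetric] of_int_sum)
  also have "(\<Sum>j\<in>{- int M..int M}. j) = 0"
  proof -
    have "(\<Sum>j\<in>{- int M..int M}. j) = (\<Sum>j\<in>{- int M..int M}. - j)"
      by (rule sum.reindex_bij_witness[of _ uminus uminus]) auto
    thus ?thesis by (simp add: sum_negf)
  qed
  also have "card {- int M..int M} = N" using N by simp
  finally have "(\<Sum>j\<in>{- int M..int M}. Ln (ray N x m j)) = of_nat N * of_real (l / real N)" by simp
  moreover have "N > 0" using N by simp
  ultimately show ?thesis unfolding l_def[symmetric] by simp
qed

text \<open>Sign and reciprocal combine to the \<open>M\<close>-th power of a root of unity, so the
  sum vanishes unless \<open>N\<close> divides \<open>M\<close>, that is, unless
  \<open>M = 0\<close> and \<open>N = 1\<close>.\<close>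

lemma sum_alternating_inverse_ray:
  assumes N: "N = 2 * M + 1" and x: "x > 0"
  shows "(\<Sum>j\<in>{- int M..int M}. (- 1) powi j / (2 * ray N x m j))
     = (if N = 1 then of_real (x / (2 * (2 * pi * real (Suc m)))) else 0)"
proof -
  define R where "R = (2 * pi * real (Suc m) / x) powr (1 / real N)"
  have R: "R > 0" using x by (simp add: R_def)
  have summand: "(- 1) powi j / (2 * ray N x m j) = of_real (1 / (2 * R)) * cis (2 * pi * of_int (int M) * of_int j / real N)" for j
  proof -
    have "(- 1) powi j / (2 * ray N x m j) = of_real (1 / (2 * R)) * (cis (pi * of_int j) / cis (pi * of_int j / real N))"
      by (simp add: ray_def R_def minus_one_powi_eq_cis)
    also have "cis (pi * of_int j) / cis (pi * of_int j / real N) = cis (2 * pi * of_int (int M) * of_int j / real N)"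
      unfolding cis_divide by (rule arg_cong[of _ _ cis]) (simp add: N field_simps)
    finally show ?thesis .
  qed
  have "(\<Sum>j\<in>{- int M..int M}. (- 1) powi j / (2 * ray N x m j)) = of_real (1 / (2 * R)) * (if int N dvd int M then of_nat N else 0)"
    unfolding summand sum_distrib_left[symmetric] sum_roots_of_unity[OF N] ..
  also have "\<dots> = (if N = 1 then of_real (x / (2 * (2 * pi * real (Suc m)))) else 0)"
  proof (cases "N = 1")
    case True
    thus ?thesis using N x by (simp add: R_def)
  next
    case False
    hence "\<not> int N dvd int M" using N by (auto dest!: zdvd_imp_le)
    thus ?thesis using False by simp
  qed
  finally show ?thesis .
qed

definition cos_summand :: "real \<Rightarrow> nat \<Rightarrow> real \<Rightarrow> int \<Rightarrow> nat \<Rightarrow> complex" where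
  "cos_summand a N x j m = of_real (cos (2 * pi * real (Suc m) * a)) / (of_nat (Suc m) * (exp (2 * of_real pi * ray N x m j) - 1))"

definition sin_summand :: "real \<Rightarrow> nat \<Rightarrow> real \<Rightarrow> int \<Rightarrow> nat \<Rightarrow> complex" where
  "sin_summand a N x j m = of_real (sin (2 * pi * real (Suc m) * a) / real (Suc m)) *
     (Ln (ray N x m j) - (Digamma (\<i> * ray N x m j) + Digamma (- \<i> * ray N x m j)) / 2)"

text \<open>The crude estimate \<open>\<bar>exp (2 * pi * z) - 1\<bar> \<ge> 2 * pi * Re z\<close>
  suffices, because \<open>1 / R\<close> lies below the two powers of \<open>R\<close> in
  \<open>mlweight\<close>, whether \<open>R\<close> is large or small.\<close>

lemma summable_cos_summand:
  assumes N: "N = 2 * M + 1" and j: "j \<in> {- int M..int M}" and x: "x > 0"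
  shows "summable (cos_summand a N x j)"
proof (rule summable_comparison_test')
  define k where "k = cos (pi * of_int j / real N)"
  have k: "k > 0" unfolding k_def by (rule ray_angle[OF N j])
  have "N > 0" using N by simp
  thus "summable (\<lambda>m. 1 / k * mlweight N x m)" using x by (intro summable_mult summable_mlweight)
  fix m
  define z where "z = ray N x m j"
  note rs = ray_simps[OF N j x, of m]
  define R where "R = norm z"
  have z: "Re z > 0" unfolding z_def by (rule rs(2))
  have R: "R > 0" using z by (auto simp: R_def)
  have Rez: "Re z = R * k" using rs(3) z k R by (simp add: z_def[symmetric] R_def k_def[symmetric] field_simps)
  have "2 * pi * (R * k) \<le> exp (2 * pi * (R * k)) - 1" using exp_ge_add_one_self[of "2 * pi * (R * k)"] by linarith
  also have "\<dots> = norm (exp (2 * of_real pi * z)) - norm (1 :: complex)" by (simp add: norm_exp_eq_Re Rez)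
  also have "\<dots> \<le> norm (exp (2 * of_real pi * z) - 1)" by (rule norm_triangle_ineq2)
  finally have ge: "2 * pi * (R * k) \<le> norm (exp (2 * of_real pi * z) - 1)" .
  have Rinv: "1 / R \<le> R powr - 2 + R powr - (1/2)"
  proof (cases "R \<ge> 1")
    case True
    have "1 / R = R powr - 1" using R by (simp only: powr_minus_divide powr_one less_imp_le)
    also have "\<dots> \<le> R powr - (1/2)" using True by (intro powr_mono) auto
    finally show ?thesis by (simp add: add_increasing)
  next
    case False
    have "1 / R = R powr - 1" using R by (simp only: powr_minus_divide powr_one less_imp_le)
    also have "\<dots> \<le> R powr - 2" using False R by (intro powr_mono') auto
    finally show ?thesis by (simp add: add_increasing2)
  qed
  have "norm (cos_summand a N x j m) = \<bar>cos (2 * pi * real (Suc m) * a)\<bar> / (real (Suc m) * norm (exp (2 * of_real pi * z) - 1))"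
    by (simp only: cos_summand_def z_def norm_divide norm_mult norm_of_real norm_of_nat)
  also have "\<dots> \<le> 1 / (real (Suc m) * (2 * pi * (R * k)))"
    using R k by (intro frac_le mult_left_mono ge) auto
  also have "\<dots> = 1 / k * (1 / (2 * pi * real (Suc m)) * (1 / R))" by simp
  also have "\<dots> \<le> 1 / k * (1 / (2 * pi * real (Suc m)) * (R powr - 2 + R powr - (1/2)))"
    using k by (intro mult_left_mono Rinv) auto
  also have "\<dots> = 1 / k * mlweight N x m"
    using rs(1) by (simp only: mlweight_def Let_def R_def z_def)
  finally show "norm (cos_summand a N x j m) \<le> 1 / k * mlweight N x m" .
qed

lemma summable_sin_summand:
  assumes N: "N = 2 * M + 1" and j: "j \<in> {- int M..int M}" and x: "x > 0"
  shows "summable (sin_summand a N x j)"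
proof (rule summable_comparison_test')
  define B where "B = (1 / cos (pi * of_int j / real N))\<^sup>2"
  define T where "T = (\<Sum>p. tail_weight p)"
  have "N > 0" using N by simp
  thus "summable (\<lambda>m. 2 * pi * B * T * mlweight N x m)" using x by (intro summable_mult summable_mlweight)
  fix m
  note rs = ray_simps[OF N j x, of m]
  define z where "z = ray N x m j"
  define Y where "Y = Ln z - (Digamma (\<i> * z) + Digamma (- \<i> * z)) / 2"
  have z: "Re z > 0" unfolding z_def by (rule rs(2))
  have Y: "norm Y \<le> B * (norm z powr - 2 + norm z powr - (1/2)) * T"
    using norm_Ln_minus_Digamma_le[OF z] rs(3) by (simp only: Y_def B_def T_def z_def)
  have "norm (sin_summand a N x j m) = \<bar>sin (2 * pi * real (Suc m) * a)\<bar> / real (Suc m) * norm Y"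
    unfolding sin_summand_def z_def[symmetric] Y_def[symmetric] norm_mult norm_of_real abs_divide by simp
  also have "\<dots> \<le> 1 / real (Suc m) * (B * (norm z powr - 2 + norm z powr - (1/2)) * T)"
    by (intro mult_mono Y divide_right_mono) auto
  also have "\<dots> = 2 * pi * B * T * (1 / (2 * pi * real (Suc m)) * (norm z powr - 2 + norm z powr - (1/2)))" by simp
  also have "\<dots> = 2 * pi * B * T * mlweight N x m"
    using rs(1) by (simp only: mlweight_def Let_def z_def)
  finally show "norm (sin_summand a N x j m) \<le> 2 * pi * B * T * mlweight N x m" .
qed

text \<open>The logarithm in the primitive at \<open>T = K ^ N * x\<close> grows like
  \<open>N * ln K\<close> up to a constant, exactly what the harmonic parts of the \<open>N\<close>
  rays require.\<close>

lemma tendsto_ln_diff: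
  fixes x w :: real
  assumes N: "N > 0" and x: "x > 0" and w: "w > 0"
  shows "(\<lambda>K. real N * ln (real K) - 1/2 * ln (1 + (real K ^ N * x)\<^sup>2 / w\<^sup>2)) \<longlonglongrightarrow> ln (w / x)"
proof -
  have "(\<lambda>K. inverse (real K) ^ (2 * N)) \<longlonglongrightarrow> 0 ^ (2 * N)" by (intro tendsto_power lim_inverse_n)
  hence "(\<lambda>K. inverse (real K) ^ (2 * N)) \<longlonglongrightarrow> 0" using N by (simp add: zero_power)
  hence "(\<lambda>K. - (1/2 * ln (inverse (real K) ^ (2 * N) + x\<^sup>2 / w\<^sup>2))) \<longlonglongrightarrow> - (1/2 * ln (0 + x\<^sup>2 / w\<^sup>2))"
    using x w by (intro tendsto_minus tendsto_mult tendsto_const tendsto_ln tendsto_add) auto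
  also have "- (1/2 * ln (0 + x\<^sup>2 / w\<^sup>2)) = ln (w / x)"
    using x w by (simp add: ln_divide_pos ln_realpow field_simps)
  finally have "(\<lambda>K. - (1/2 * ln (inverse (real K) ^ (2 * N) + x\<^sup>2 / w\<^sup>2))) \<longlonglongrightarrow> ln (w / x)" .
  moreover have "\<forall>\<^sub>F K in sequentially. - (1/2 * ln (inverse (real K) ^ (2 * N) + x\<^sup>2 / w\<^sup>2))
      = real N * ln (real K) - 1/2 * ln (1 + (real K ^ N * x)\<^sup>2 / w\<^sup>2)"
    using eventually_gt_at_top[of 0]
  proof eventually_elim
    case (elim K)
    have k: "real K > 0" using elim by simp
    have k1: "inverse (real K) ^ (2 * N) = 1 / real K ^ (2 * N)" by (simp add: power_inverse divide_inverse)
    have pos: "inverse (real K) ^ (2 * N) + x\<^sup>2 / w\<^sup>2 > 0" using k x w by (intro add_pos_pos) auto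
    have "(real K ^ N * x)\<^sup>2 / w\<^sup>2 = real K ^ (2 * N) * (x\<^sup>2 / w\<^sup>2)"
      by (simp add: power_mult_distrib power_mult[symmetric] mult.commute)
    hence "1 + (real K ^ N * x)\<^sup>2 / w\<^sup>2 = real K ^ (2 * N) * (inverse (real K) ^ (2 * N) + x\<^sup>2 / w\<^sup>2)"
      using k unfolding k1 by (simp add: distrib_left)
    also have "ln \<dots> = ln (real K ^ (2 * N)) + ln (inverse (real K) ^ (2 * N) + x\<^sup>2 / w\<^sup>2)"
      using k pos by (intro ln_mult_pos) auto
    also have "ln (real K ^ (2 * N)) = 2 * real N * ln (real K)" using k by (simp add: ln_realpow)
    finally show ?case by (simp add: add_divide_distrib)
  qed
  ultimately show ?thesis by (rule Lim_transform_eventually)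
qed

text \<open>The partial sums over \<open>k < K\<close> split into cotangent-type sums
  \<open>P\<close>, harmonic-type sums \<open>Q\<close> and one telescoped primitive. The limits of
  \<open>P\<close> and \<open>Q\<close> are known, and the constants from the primitive cancel those
  in the limits or are distributed over the rays.\<close>

lemma sum_mldiff_eq:
  assumes N: "N = 2 * M + 1" and x: "x > 0"
  shows "complex_of_real (\<Sum>k. mldiff a N x m k) =
     (\<Sum>j\<in>{- int M..int M}. (- 1) ^ M * (- 1) powi j * cos_summand a N x j m - of_real (1 / pi) * sin_summand a N x j m) / of_nat N
      - (if N = 1 then of_real (x * (cos (2 * pi * real (Suc m) * a) / (2 * pi * real (Suc m))\<^sup>2)) else 0)"
proof -
  let ?J = "{- int M..int M}"
  define w where "w = 2 * pi * real (Suc m)"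
  have w: "w > 0" by (simp add: w_def)
  define C S where "C = complex_of_real (cos (w * a))" and "S = complex_of_real (sin (w * a))"
  define z where "z = ray N x m"
  let ?E = "\<lambda>j. exp (2 * of_real pi * z j) - 1" and ?D = "\<lambda>j. Digamma (\<i> * z j) + Digamma (- \<i> * z j)"
    and ?s = "\<lambda>j. (- 1) ^ M * (- 1) powi j :: complex" and ?l = "\<lambda>K. ln (1 + (real K ^ N * x)\<^sup>2 / w\<^sup>2)"
  have N0: "N > 0" and oddN: "odd N" using N by simp_all
  define q where "q = complex_of_real (2 / (real N * w))"
  define P where "P = (\<lambda>j K. \<Sum>k<K. z j / (of_nat (Suc k) ^ 2 + z j ^ 2))"
  define Q where "Q = (\<lambda>j K. \<Sum>k<K. of_nat (Suc k) / (of_nat (Suc k) ^ 2 + z j ^ 2) :: complex)"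
  have Rez: "Re (z j) > 0" if "j \<in> ?J" for j unfolding z_def by (rule ray_simps(2)[OF N that x])
  \<comment> \<open>Each ray receives one copy of \<open>ln K\<close>; together they cancel the
    \<open>N * ln K\<close> inserted next to the logarithm of the primitive, so that both brackets
    converge.\<close>
  have part: "complex_of_real (\<Sum>k<K. mldiff a N x m k) = q *
      (\<Sum>j\<in>?J. C * (?s j * P j K) - S * (Q j K - of_real (ln (real K))))
      - q * (C * of_real (arctan (real K ^ N * x / w)) + S * of_real (real N * ln (real K) - 1/2 * ?l K))" for K
  proof -
    have tel: "(\<Sum>k<K. mldiff a N x m k) = (\<Sum>k<K. mlterm a m (real (Suc k) ^ N * x) / real (Suc k)) - mlprim a m (real K ^ N * x) / real N"
      using N0 by (induction K) (simp_all add: mldiff_def diff_divide_distrib zero_power)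
    have pr: "complex_of_real (mlprim a m (real K ^ N * x) / real N)
        = q * (C * of_real (arctan (real K ^ N * x / w)) - S * of_real (1/2 * ?l K))"
    proof -
      have "mlprim a m (real K ^ N * x) / real N = 2 / (real N * w) * (cos (w * a) * arctan (real K ^ N * x / w) - sin (w * a) * (1/2 * ?l K))"
        unfolding mlprim_def Let_def w_def[symmetric] using w N0 by (simp add: field_simps)
      thus ?thesis by (simp only: q_def C_def S_def of_real_mult of_real_diff)
    qed
    have "complex_of_real (\<Sum>k<K. mlterm a m (real (Suc k) ^ N * x) / real (Suc k))
       = (\<Sum>k<K. q * (\<Sum>j\<in>?J. C * (?s j * (z j / (of_nat (Suc k) ^ 2 + z j ^ 2))) - S * (of_nat (Suc k) / (of_nat (Suc k) ^ 2 + z j ^ 2))))"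
      unfolding of_real_sum
    proof (rule sum.cong)
      fix k
      have pos: "real (Suc k) > 0" by simp
      show "complex_of_real (mlterm a m (real (Suc k) ^ N * x) / real (Suc k)) =
        q * (\<Sum>j\<in>?J. C * (?s j * (z j / (of_nat (Suc k) ^ 2 + z j ^ 2))) - S * (of_nat (Suc k) / (of_nat (Suc k) ^ 2 + z j ^ 2)))"
        unfolding mlterm_partial_fractions[OF N pos x] w_def[symmetric] q_def C_def S_def z_def of_real_of_nat_eq ..
    qed simp
    also have "\<dots> = q * (\<Sum>j\<in>?J. C * (?s j * P j K) - S * Q j K)"
      unfolding sum_distrib_left[symmetric] P_def Q_def
      by (subst sum.swap) (simp only: sum_subtractf sum_distrib_left)
    also have "(\<Sum>j\<in>?J. C * (?s j * P j K) - S * Q j K)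
       = (\<Sum>j\<in>?J. C * (?s j * P j K) - S * (Q j K - of_real (ln (real K)))) - S * of_real (real N * ln (real K))"
    proof -
      have "(\<Sum>j\<in>?J. C * (?s j * P j K) - S * (Q j K - of_real (ln (real K))))
        = (\<Sum>j\<in>?J. (C * (?s j * P j K) - S * Q j K) + S * of_real (ln (real K)))"
        by (intro sum.cong refl) (simp add: algebra_simps)
      also have "\<dots> = (\<Sum>j\<in>?J. C * (?s j * P j K) - S * Q j K) + of_nat (card ?J) * (S * of_real (ln (real K)))"
        by (simp only: sum.distrib sum_constant)
      also have "card ?J = N" using N by simp
      finally show ?thesis by simp
    qed
    finally show ?thesis unfolding tel of_real_diff pr by (simp add: algebra_simps)
  qed
  have at: "(\<lambda>K. arctan (real K ^ N * x / w)) \<longlonglongrightarrow> pi / 2"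
  proof -
    have "filterlim (\<lambda>K. real K ^ N * (x / w)) at_top sequentially"
      using x w by (intro filterlim_at_top_mult_tendsto_pos[OF tendsto_const] filterlim_pow_at_top N0 filterlim_real_sequentially) auto
    from filterlim_compose[OF tendsto_arctan_at_top this] show ?thesis by simp
  qed
  have Pl: "P j \<longlonglongrightarrow> of_real pi / 2 + of_real pi / ?E j - 1 / (2 * z j)" if "j \<in> ?J" for j
    using sums_inverse_square_plus[OF Rez[OF that]] unfolding sums_def P_def .
  have Ql: "(\<lambda>K. Q j K - of_real (ln (real K))) \<longlonglongrightarrow> - ?D j / 2" if "j \<in> ?J" for j
    using tendsto_sum_minus_ln_Digamma[OF Rez[OF that]] unfolding Q_def .
  have "(\<lambda>K. complex_of_real (\<Sum>k<K. mldiff a N x m k)) \<longlonglongrightarrow>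
      q * (\<Sum>j\<in>?J. C * (?s j * (of_real pi / 2 + of_real pi / ?E j - 1 / (2 * z j)))
         - S * (- ?D j / 2))
      - q * (C * of_real (pi / 2) + S * of_real (ln (w / x)))"
    unfolding part
    by (intro tendsto_diff tendsto_mult tendsto_add tendsto_const tendsto_sum Pl Ql tendsto_of_real at tendsto_ln_diff N0 x w)
  moreover have "(\<lambda>K. complex_of_real (\<Sum>k<K. mldiff a N x m k)) \<longlonglongrightarrow> complex_of_real (\<Sum>k. mldiff a N x m k)"
    using summable_LIMSEQ[OF mldiff_sums(3)[OF oddN x]] by (rule tendsto_of_real)
  ultimately have "complex_of_real (\<Sum>k. mldiff a N x m k) =
      q * (\<Sum>j\<in>?J. C * (?s j * (of_real pi / 2 + of_real pi / ?E j - 1 / (2 * z j)))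
         - S * (- ?D j / 2))
      - q * (C * of_real (pi / 2) + S * of_real (ln (w / x)))"
    by (rule LIMSEQ_unique[rotated])
  \<comment> \<open>This is where the \<open>Ln\<close> beside the digamma values
    originates.\<close>
  also have "of_real (ln (w / x)) = (\<Sum>j\<in>?J. Ln (z j))"
    unfolding z_def sum_Ln_ray[OF N x] w_def ..
  also have "(\<Sum>j\<in>?J. C * (?s j * (of_real pi / 2 + of_real pi / ?E j - 1 / (2 * z j)))
         - S * (- ?D j / 2))
      = (\<Sum>j\<in>?J. (C * of_real pi * (?s j / ?E j) - S * (Ln (z j) - ?D j / 2))
          + C * (- 1) ^ M * of_real (pi / 2) * (- 1) powi j - C * (- 1) ^ M * ((- 1) powi j / (2 * z j)) + S * Ln (z j))"
    by (intro sum.cong refl) (simp add: algebra_simps diff_divide_distrib add_divide_distrib)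
  also have "\<dots> = (\<Sum>j\<in>?J. C * of_real pi * (?s j / ?E j) - S * (Ln (z j) - ?D j / 2))
          + C * (- 1) ^ M * of_real (pi / 2) * (\<Sum>j\<in>?J. (- 1) powi j) - C * (- 1) ^ M * (\<Sum>j\<in>?J. (- 1) powi j / (2 * z j)) + S * (\<Sum>j\<in>?J. Ln (z j))"
    by (simp only: sum.distrib sum_subtractf sum_distrib_left)
  \<comment> \<open>The alternating sum over the rays reduces the constants \<open>pi / 2\<close> to
    a single one, which cancels the limit of the arctangent.\<close>
  also have "C * (- 1) ^ M * of_real (pi / 2) * (\<Sum>j\<in>?J. (- 1) powi j) = C * of_real (pi / 2)"
    unfolding sum_alternating_symmetric by (simp flip: power_add)
  \<comment> \<open>The only leftover, present for \<open>N = 1\<close> alone; summed over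
    \<open>m\<close> it becomes the Bernoulli term.\<close>
  also have "C * (- 1) ^ M * (\<Sum>j\<in>?J. (- 1) powi j / (2 * z j)) = C * (if N = 1 then of_real (x / (2 * w)) else 0)"
    unfolding z_def sum_alternating_inverse_ray[OF N x] w_def using N by simp
  finally have "complex_of_real (\<Sum>k. mldiff a N x m k) =
     q * (\<Sum>j\<in>?J. C * of_real pi * (?s j / ?E j) - S * (Ln (z j) - ?D j / 2))
      - q * C * (if N = 1 then of_real (x / (2 * w)) else 0)"
    by (simp add: algebra_simps)
  also have "q * (\<Sum>j\<in>?J. C * of_real pi * (?s j / ?E j) - S * (Ln (z j) - ?D j / 2))
     = (\<Sum>j\<in>?J. (- 1) ^ M * (- 1) powi j * cos_summand a N x j m - of_real (1 / pi) * sin_summand a N x j m) / of_nat N"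
    unfolding sum_distrib_left sum_divide_distrib
  proof (intro sum.cong refl)
    fix j
    define E where "E = exp (2 * of_real pi * z j) - 1"
    define Y where "Y = Ln (z j) - ?D j / 2"
    define s :: complex where "s = (- 1) ^ M * (- 1) powi j"
    have q': "q = of_real (1 / pi) * (1 / of_nat (Suc m)) / of_nat N"
      unfolding q_def w_def by (simp del: of_nat_Suc)
    have c: "cos_summand a N x j m = C / (of_nat (Suc m) * E)"
      by (simp only: cos_summand_def C_def w_def E_def z_def)
    have s': "sin_summand a N x j m = S * (1 / of_nat (Suc m)) * Y"
      unfolding sin_summand_def S_def w_def Y_def z_def by simp
    have "p * b / n * (C * of_real pi * (s / E) - S * Y) = (s * (C * b / E) - p * (S * b * Y)) / n" if "p * of_real pi = 1" for p b n :: complex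
    proof -
      have "p * b / n * (C * of_real pi * (s / E) - S * Y) = ((p * of_real pi) * (b * C * (s / E)) - p * b * S * Y) / n"
        by (simp add: algebra_simps diff_divide_distrib)
      thus ?thesis unfolding that by (simp add: algebra_simps)
    qed
    from this[of "of_real (1 / pi)" "1 / of_nat (Suc m)" "of_nat N"]
    show "q * (C * of_real pi * (?s j / ?E j) - S * (Ln (z j) - ?D j / 2))
      = (?s j * cos_summand a N x j m - of_real (1 / pi) * sin_summand a N x j m) / of_nat N"
      unfolding E_def[symmetric] Y_def[symmetric] s_def[symmetric] c s' q' by (simp add: divide_divide_eq_left)
  qed
  also have "q * C * (if N = 1 then of_real (x / (2 * w)) else 0) = (if N = 1 then of_real (x * (cos (2 * pi * real (Suc m) * a) / (2 * pi * real (Suc m))\<^sup>2)) else 0)"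
    unfolding w_def[symmetric] q_def C_def by (simp add: power2_eq_square)
  finally show ?thesis .
qed

lemma mlcorr_eq:
  assumes N: "N = 2 * M + 1" and x: "x > 0" and a: "0 \<le> a" "a \<le> 1"
  shows "complex_of_real (mlcorr a N x) =
     (\<Sum>j\<in>{- int M..int M}. (- 1) ^ M * (- 1) powi j * (\<Sum>m. cos_summand a N x j m) - of_real (1 / pi) * (\<Sum>m. sin_summand a N x j m)) / of_nat N
      - (if N = 1 then of_real (x * (bernpoly 2 a / 4)) else 0)"
proof -
  let ?J = "{- int M..int M}"
  have oddN: "odd N" using N by simp
  have "(\<lambda>m. 2 * (- 1) ^ 0 * fact (2 * Suc 0) / (2 * pi * real (Suc m)) ^ (2 * Suc 0) * cos (2 * pi * real (Suc m) * a)) sums bernpoly (2 * Suc 0) a"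
    using a by (intro bernpoly_fourier_sums) simp
  \<comment> \<open>The Fourier coefficients of the second Bernoulli polynomial are
    \<open>2 * fact 2 / w^2 = 4 / w^2\<close>, hence the factor \<open>1/4\<close>.\<close>
  from sums_mult[OF this, of "1/4"] have B: "(\<lambda>m. cos (2 * pi * real (Suc m) * a) / (2 * pi * real (Suc m))\<^sup>2) sums (bernpoly 2 a / 4)"
    by (simp add: numeral_2_eq_2)
  have "(\<lambda>m. (\<Sum>j\<in>?J. (- 1) ^ M * (- 1) powi j * cos_summand a N x j m - of_real (1 / pi) * sin_summand a N x j m) / of_nat N
      - (if N = 1 then of_real (x * (cos (2 * pi * real (Suc m) * a) / (2 * pi * real (Suc m))\<^sup>2)) else 0)) sums
     ((\<Sum>j\<in>?J. (- 1) ^ M * (- 1) powi j * (\<Sum>m. cos_summand a N x j m) - of_real (1 / pi) * (\<Sum>m. sin_summand a N x j m)) / of_nat N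
      - (if N = 1 then of_real (x * (bernpoly 2 a / 4)) else 0))"
  proof (intro sums_diff sums_divide sums_sum sums_mult summable_sums)
    show "summable (cos_summand a N x j)" if "j \<in> ?J" for j by (rule summable_cos_summand[OF N that x])
    show "summable (sin_summand a N x j)" if "j \<in> ?J" for j by (rule summable_sin_summand[OF N that x])
    show "(\<lambda>m. if N = 1 then complex_of_real (x * (cos (2 * pi * real (Suc m) * a) / (2 * pi * real (Suc m))\<^sup>2)) else 0) sums
       (if N = 1 then of_real (x * (bernpoly 2 a / 4)) else 0)"
    proof -
      have "(\<lambda>m. complex_of_real (x * (cos (2 * pi * real (Suc m) * a) / (2 * pi * real (Suc m))\<^sup>2))) sums
          of_real (x * (bernpoly 2 a / 4))"
        by (intro sums_of_real sums_mult B)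
      thus ?thesis by (cases "N = 1") (simp_all only: if_True if_False sums_zero simp_thms)
    qed
  qed
  moreover have "(\<lambda>m. complex_of_real (\<Sum>k. mldiff a N x m k)) sums complex_of_real (mlcorr a N x)"
    unfolding mlcorr_def by (intro sums_of_real summable_sums mldiff_sums(4) oddN x)
  ultimately show ?thesis unfolding sum_mldiff_eq[OF N x] by (rule sums_unique2[symmetric])
qed

lemma summand_sums_conv:
  shows "(\<Sum>m. cos_summand a N x j m) = (\<Sum>n. complex_of_real (cos (2 * pi * real (Suc n) * a))
            / (of_nat (Suc n) * (exp (2 * A_Nj N j (real (Suc n) / x)) - 1)))"
    and "(\<Sum>m. sin_summand a N x j m) = (\<Sum>n. complex_of_real (sin (2 * pi * real (Suc n) * a) / real (Suc n)) *
                  (Ln (A_Nj N j (real (Suc n) / x) / complex_of_real pi)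
                   - 1/2 * (Digamma (\<i> / complex_of_real pi * A_Nj N j (real (Suc n) / x))
                            + Digamma (- \<i> / complex_of_real pi * A_Nj N j (real (Suc n) / x)))))"
  unfolding cos_summand_def sin_summand_def A_Nj_eq_ray by (simp_all add: mult.assoc)

theorem lambert_transformation:
  assumes a: "0 < a" "a \<le> 1" and N: "N = 2 * M + 1" and x: "x > 0"
  shows "complex_of_real (lambert a N x) = complex_of_real (zeta_nat (N + 1) / x
     + 1 / real N * ((1/2 - a) * ((real N - 1) * euler_mascheroni - ln x) + ln (Gamma a) - 1/2 * ln (2 * pi))
     + - (if N = 1 then x * (bernpoly 2 a / 4) else 0))
     + (- 1) ^ M / of_nat N * (\<Sum>j\<in>{- int M..int M}. (- 1) powi j *
         ((\<Sum>m. cos_summand a N x j m) + (- 1) powi (j + int (M + 1)) / of_real pi * (\<Sum>m. sin_summand a N x j m)))"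
proof -
  have oddN: "odd N" using N by simp
  define Z where "Z = (\<Sum>j\<in>{- int M..int M}. (- 1) powi j *
         ((\<Sum>m. cos_summand a N x j m) + (- 1) powi (j + int (M + 1)) / of_real pi * (\<Sum>m. sin_summand a N x j m)))"
  have h: "(\<Sum>j\<in>{- int M..int M}. (- 1) ^ M * (- 1) powi j * (\<Sum>m. cos_summand a N x j m) - of_real (1 / pi) * (\<Sum>m. sin_summand a N x j m))
    = (- 1) ^ M * Z"
    unfolding Z_def sum_distrib_left
  proof (intro sum.cong refl)
    fix j
    \<comment> \<open>The sine series enters without alternating sign; the sign
      \<open>(- 1) powi (j + int (M + 1))\<close> of the final formula cancels both outer signs up
      to a factor \<open>- 1\<close>.\<close>
    have sq: "(- 1) ^ M * (- 1) powi j * (- 1) powi (j + int (M + 1)) = (- 1 :: complex)"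
    proof -
      have "(- 1 :: complex) powi (j + int (M + 1)) = (- 1) powi j * (- 1) powi int (M + 1)"
        by (rule power_int_add) simp
      also have "(- 1 :: complex) powi int (M + 1) = (- 1) ^ (M + 1)" by (rule power_int_of_nat)
      finally have e: "(- 1 :: complex) powi (j + int (M + 1)) = (- 1) powi j * (- 1) ^ (M + 1)" .
      have "(- 1 :: complex) powi j * (- 1) powi j = 1"
        by (simp flip: power_int_mult_distrib)
      moreover have "(- 1 :: complex) ^ M * (- 1) ^ (M + 1) = - 1" by (simp flip: power_add)
      ultimately show ?thesis unfolding e by (metis (no_types, lifting) mult.commute mult.left_commute mult.right_neutral)
    qed
    have "(- 1) ^ M * ((- 1) powi j * (c + (- 1) powi (j + int (M + 1)) / of_real pi * s)) =
       (- 1) ^ M * (- 1) powi j * c + ((- 1) ^ M * (- 1) powi j * (- 1) powi (j + int (M + 1))) * (of_real (1 / pi) * s)" for c s :: complex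
      by (simp add: distrib_left mult_ac)
    thus "(- 1) ^ M * (- 1) powi j * (\<Sum>m. cos_summand a N x j m) - of_real (1 / pi) * (\<Sum>m. sin_summand a N x j m)
     = (- 1) ^ M * ((- 1) powi j * ((\<Sum>m. cos_summand a N x j m) + (- 1) powi (j + int (M + 1)) / of_real pi * (\<Sum>m. sin_summand a N x j m)))"
      unfolding sq by simp
  qed
  have ite: "(if N = 1 then complex_of_real r else 0) = complex_of_real (if N = 1 then r else 0)" for r by simp
  have "complex_of_real (mlcorr a N x) = (- 1) ^ M * Z / of_nat N - of_real (if N = 1 then x * (bernpoly 2 a / 4) else 0)"
    using mlcorr_eq[OF N x less_imp_le[OF a(1)] a(2)] unfolding h ite .
  thus ?thesis unfolding lambert_eq[OF a oddN x] of_real_add of_real_diff Z_def[symmetric] by simp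
qed

section \<open>The symmetric form in \<open>\<alpha>\<close> and \<open>\<beta>\<close>\<close>

text \<open>For \<open>x = 2 ^ N * \<alpha>\<close> the constraint makes
  \<open>2 * pi * n / x\<close> equal to \<open>(\<beta> / (2 * pi)) ^ N * (2 * n)\<close>, so the
  \<open>N\<close>-th root is explicit in \<open>\<beta>\<close>.\<close>

lemma ray_alpha_beta:
  assumes al: "\<alpha> > 0" and be: "\<beta> > 0" and ab: "\<alpha> * \<beta> ^ N = pi ^ (N + 1)" and N: "N > 0"
  shows "ray N (2 ^ N * \<alpha>) m j = of_real (\<beta> / (2 * pi) * (2 * real (Suc m)) powr (1 / real N)) * exp (\<i> * of_real (pi * of_int j / real N))"
proof -
  have "2 * pi * real (Suc m) / (2 ^ N * \<alpha>) = (\<beta> / (2 * pi)) ^ N * (2 * real (Suc m))"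
  proof -
    have "\<alpha> = pi ^ (N + 1) / \<beta> ^ N" using ab be by (simp add: field_simps)
    moreover have "2 * pi * s / (2 ^ N * (pi ^ (N + 1) / \<beta> ^ N)) = (\<beta> / (2 * pi)) ^ N * (2 * s)" for s
      using be by (simp add: power_divide power_mult_distrib)
    ultimately show ?thesis by (simp only:)
  qed
  hence "(2 * pi * real (Suc m) / (2 ^ N * \<alpha>)) powr (1 / real N) = ((\<beta> / (2 * pi)) ^ N) powr (1 / real N) * (2 * real (Suc m)) powr (1 / real N)"
    using be by (simp only: powr_mult)
  also have "((\<beta> / (2 * pi)) ^ N) powr (1 / real N) = \<beta> / (2 * pi)"
    using be N by (simp add: powr_powr flip: powr_realpow)
  finally show ?thesis by (simp add: ray_def cis_conv_exp)
qed

text \<open>Euler's formula applies since \<open>N + 1\<close> is even; the constraint turns the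
  power of \<open>pi\<close> into \<open>\<alpha> * \<beta> ^ N\<close>. The zeta term thereby
  becomes the \<open>j = 0\<close> term of the Bernoulli sum.\<close>

lemma zeta_nat_alpha_beta:
  assumes N: "N = 2 * M + 1" and al: "\<alpha> > 0" and be: "\<beta> > 0" and ab: "\<alpha> * \<beta> ^ N = pi ^ (N + 1)"
  shows "zeta_nat (N + 1) / (2 ^ N * \<alpha>) = (- 1) ^ M * (bernpoly (N + 1) 1 / fact (N + 1) * \<beta> ^ N)"
proof -
  have N1: "N + 1 = 2 * Suc M" using N by simp
  have "zeta_nat (N + 1) = (- 1) ^ M * bernpoly (N + 1) 1 * (2 * pi) ^ (N + 1) / (2 * fact (N + 1))"
    unfolding N1 by (rule zeta_nat_even)
  moreover have "(2 * pi) ^ (N + 1) = 2 * 2 ^ N * (\<alpha> * \<beta> ^ N)"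
    unfolding ab by (simp add: power_mult_distrib)
  ultimately show ?thesis using al by (simp only:) simp
qed

text \<open>The constraint gives \<open>ln \<alpha> = (N + 1) * ln pi - N * ln \<beta>\<close>, so
  \<open>ln (\<alpha> / \<beta>) / (N + 1)\<close> is simply
  \<open>ln pi - ln \<beta>\<close>.\<close>

lemma log_terms_alpha_beta:
  assumes N: "N > 0" and al: "\<alpha> > 0" and be: "\<beta> > 0" and ab: "\<alpha> * \<beta> ^ N = pi ^ (N + 1)"
  shows "(1 / real N) * ((1/2 - a) * ((real N - 1) * g - ln (2 ^ N * \<alpha>)) + G - 1/2 * ln (2 * pi))
     = (1 / real N) * ((a - 1) * ln (2 * pi) + G)
          + (a - 1/2) * ((real N - 1) * (ln 2 - g) / real N + ln (\<alpha> / \<beta>) / real (N + 1))"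
proof -
  have "ln (\<alpha> * \<beta> ^ N) = ln (pi ^ (N + 1))" by (simp only: ab)
  hence A: "ln \<alpha> = (real N + 1) * ln pi - real N * ln \<beta>"
    using al be by (simp add: ln_mult_pos ln_realpow algebra_simps del: power_Suc)
  have l1: "ln (2 ^ N * \<alpha>) = real N * ln 2 + ((real N + 1) * ln pi - real N * ln \<beta>)"
    using al by (simp add: ln_mult_pos ln_realpow A)
  have l2: "ln (2 * pi) = ln 2 + ln pi" by (simp add: ln_mult_pos)
  have l3: "ln (\<alpha> / \<beta>) / real (N + 1) = ln pi - ln \<beta>"
    using ln_divide_pos[OF al be] by (simp add: A field_simps)
  show ?thesis unfolding l1 l2 l3 using N by (simp add: divide_simps) (simp add: algebra_simps)
qed

lemma rhs_alpha_beta: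
  assumes N: "N = 2 * M + 1" and al: "\<alpha> > 0" and be: "\<beta> > 0" and ab: "\<alpha> * \<beta> ^ N = pi ^ (N + 1)"
  shows "zeta_nat (N + 1) / (2 ^ N * \<alpha>)
     + 1 / real N * ((1/2 - a) * ((real N - 1) * euler_mascheroni - ln (2 ^ N * \<alpha>)) + ln (Gamma a) - 1/2 * ln (2 * pi))
     + - (if N = 1 then (2 ^ N * \<alpha>) * (bernpoly 2 a / 4) else 0) =
     ((1 / real N) * ((a - 1) * ln (2 * pi) + ln (Gamma a))
          + (a - 1/2) * ((real N - 1) * (ln 2 - euler_mascheroni) / real N
                         + ln (\<alpha> / \<beta>) / real (N + 1))
          + (-1) ^ ((N + 3) div 2) *
            (\<Sum>j = 0..(N + 1) div (2 * N).
               (-1) ^ j * bernpoly (2 * j) a * bernpoly (N + 1 - 2 * N * j) 1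
               / (fact (2 * j) * fact (N + 1 - 2 * N * j))
               * \<alpha> powr (2 * real j / real (N + 1))
               * \<beta> powr (real N - 2 * real N ^ 2 * real j / real (N + 1))))"
proof -
  have N0: "N > 0" using N by simp
  have sg: "(- 1 :: real) ^ ((N + 3) div 2) = (- 1) ^ M" using N by simp
  let ?t = "\<lambda>j. (- 1) ^ j * bernpoly (2 * j) a * bernpoly (N + 1 - 2 * N * j) 1
               / (fact (2 * j) * fact (N + 1 - 2 * N * j))
               * \<alpha> powr (2 * real j / real (N + 1))
               * \<beta> powr (real N - 2 * real N ^ 2 * real j / real (N + 1))"
  have t0: "?t 0 = bernpoly (N + 1) 1 / fact (N + 1) * \<beta> ^ N"
    using al be by (simp add: powr_realpow)
  \<comment> \<open>The upper limit \<open>(N + 1) div (2 * N)\<close> is 1 for \<open>N = 1\<close>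
    and 0 otherwise, so apart from \<open>j = 0\<close> there is at most the term with the second
    Bernoulli polynomial.\<close>
  have "(- 1) ^ M * (\<Sum>j = 0..(N + 1) div (2 * N). ?t j) = (- 1) ^ M * ?t 0 + - (if N = 1 then (2 ^ N * \<alpha>) * (bernpoly 2 a / 4) else 0)"
  proof (cases "N = 1")
    case True
    have "(\<Sum>j = 0..(N + 1) div (2 * N). ?t j) = ?t 0 + ?t 1" using True by simp
    moreover have "?t 1 = - (\<alpha> * (bernpoly 2 a / 2))" using True al be by simp
    moreover have "M = 0" using True N by simp
    ultimately show ?thesis using True by simp
  next
    case False
    hence "(N + 1) div (2 * N) = 0" using N0 by (intro div_less) simp
    thus ?thesis using False by simp
  qed
  thus ?thesis
    unfolding zeta_nat_alpha_beta[OF N al be ab] log_terms_alpha_beta[OF N0 al be ab] sg t0 by linarith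
qed

theorem theorem1p10:
  fixes a :: real and N :: nat
  assumes "0 < a" and "a \<le> 1" and "odd N"
  shows
  "(\<forall>x::real. x > 0 \<longrightarrow>
     complex_of_real (\<Sum>n. exp (- a * real (Suc n) ^ N * x)
                          / (real (Suc n) * (1 - exp (- (real (Suc n) ^ N) * x))))
     = complex_of_real
         (zeta_nat (N + 1) / x
          + (1 / real N) * ((1/2 - a) * ((real N - 1) * euler_mascheroni - ln x)
                            + ln (Gamma a) - 1/2 * ln (2 * pi))
          + (-1) ^ ((N + 3) div 2) * 2 ^ N * pi ^ (N + 1) *
            (\<Sum>j = 1..(N + 1) div (2 * N).
               (-1 / (4 * pi^2)) ^ (j * N) * bernpoly (2 * j) a * bernpoly (N + 1 - 2 * j * N) 1
               / (fact (2 * j) * fact (N + 1 - 2 * j * N)) * x ^ (2 * j - 1)))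
       + (-1) ^ ((N + 3) div 2) / of_nat N *
         (\<Sum>j \<in> {- int ((N - 1) div 2) .. int ((N - 1) div 2)}.
            (-1) powi j *
            ((\<Sum>n. complex_of_real (cos (2 * pi * real (Suc n) * a))
                    / (of_nat (Suc n) * (exp (2 * A_Nj N j (real (Suc n) / x)) - 1)))
             + (-1) powi (j + int ((N + 1) div 2)) / complex_of_real pi *
               (\<Sum>n. complex_of_real (sin (2 * pi * real (Suc n) * a) / real (Suc n)) *
                  (Ln (A_Nj N j (real (Suc n) / x) / complex_of_real pi)
                   - 1/2 * (Digamma (\<i> / complex_of_real pi * A_Nj N j (real (Suc n) / x))
                            + Digamma (- \<i> / complex_of_real pi * A_Nj N j (real (Suc n) / x))))))))
   \<and>
   (\<forall>\<alpha> \<beta> :: real. \<alpha> > 0 \<longrightarrow> \<beta> > 0 \<longrightarrow> \<alpha> * \<beta> ^ N = pi ^ (N + 1) \<longrightarrow>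
     complex_of_real (\<Sum>n. exp (- a * (2 * real (Suc n)) ^ N * \<alpha>)
                          / (real (Suc n) * (1 - exp (- ((2 * real (Suc n)) ^ N) * \<alpha>))))
     - (-1) ^ ((N + 3) div 2) / of_nat N *
         (\<Sum>j \<in> {- int ((N - 1) div 2) .. int ((N - 1) div 2)}.
            (-1) powi j *
            ((\<Sum>n. complex_of_real (cos (2 * pi * real (Suc n) * a))
                    / (of_nat (Suc n) *
                       (exp (complex_of_real ((2 * real (Suc n)) powr (1 / real N) * \<beta>)
                             * exp (\<i> * complex_of_real (pi * real_of_int j / real N))) - 1)))
             + (-1) powi (j + int ((N + 1) div 2)) / complex_of_real pi *
               (\<Sum>n. complex_of_real (sin (2 * pi * real (Suc n) * a) / real (Suc n)) *
                  (Ln (complex_of_real (\<beta> / (2 * pi) * (2 * real (Suc n)) powr (1 / real N))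
                       * exp (\<i> * complex_of_real (pi * real_of_int j / real N)))
                   - 1/2 * (Digamma (\<i> * complex_of_real (\<beta> / (2 * pi) * (2 * real (Suc n)) powr (1 / real N))
                                    * exp (\<i> * complex_of_real (pi * real_of_int j / real N)))
                            + Digamma (- \<i> * complex_of_real (\<beta> / (2 * pi) * (2 * real (Suc n)) powr (1 / real N))
                                    * exp (\<i> * complex_of_real (pi * real_of_int j / real N))))))))
     = complex_of_real
         ((1 / real N) * ((a - 1) * ln (2 * pi) + ln (Gamma a))
          + (a - 1/2) * ((real N - 1) * (ln 2 - euler_mascheroni) / real N
                         + ln (\<alpha> / \<beta>) / real (N + 1))
          + (-1) ^ ((N + 3) div 2) *
            (\<Sum>j = 0..(N + 1) div (2 * N).
               (-1) ^ j * bernpoly (2 * j) a * bernpoly (N + 1 - 2 * N * j) 1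
               / (fact (2 * j) * fact (N + 1 - 2 * N * j))
               * \<alpha> powr (2 * real j / real (N + 1))
               * \<beta> powr (real N - 2 * real N ^ 2 * real j / real (N + 1)))))"
proof (intro conjI allI impI, goal_cases)
  case (1 x)
  define M where "M = (N - 1) div 2"
  have N: "N = 2 * M + 1" using odd_two_times_div_two_succ[OF \<open>odd N\<close>] \<open>odd N\<close> by (simp add: M_def)
  have D: "(N - 1) div 2 = M" "(N + 3) div 2 = M + 2" "(N + 1) div 2 = M + 1" using N by simp_all
  have sg: "(- 1) ^ (M + 2) = ((- 1) ^ M :: complex)" by simp
  \<comment> \<open>The range of \<open>j\<close> is empty unless \<open>N = 1\<close>; then
    \<open>j = 1\<close> is its only element and the powers of \<open>pi\<close> cancel.\<close>
  have R: "(- 1) ^ (M + 2) * 2 ^ N * pi ^ (N + 1) *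
            (\<Sum>j = 1..(N + 1) div (2 * N).
               (-1 / (4 * pi^2)) ^ (j * N) * bernpoly (2 * j) a * bernpoly (N + 1 - 2 * j * N) 1
               / (fact (2 * j) * fact (N + 1 - 2 * j * N)) * x ^ (2 * j - 1))
      = - (if N = 1 then x * (bernpoly 2 a / 4) else 0)"
  proof (cases "N = 1")
    case True
    moreover have "M = 0" using True N by simp
    ultimately show ?thesis by (simp add: power2_eq_square)
  next
    case False
    hence "(N + 1) div (2 * N) = 0" using N by (intro div_less) simp
    thus ?thesis using False by simp
  qed
  show ?case
    using lambert_transformation[OF assms(1,2) N 1]
    unfolding summand_sums_conv lambert_def lambert_term_def D R sg .
next
  case (2 \<alpha> \<beta>)
  define M where "M = (N - 1) div 2"
  have N: "N = 2 * M + 1" using odd_two_times_div_two_succ[OF \<open>odd N\<close>] \<open>odd N\<close> by (simp add: M_def)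
  have N0: "N > 0" using N by simp
  have D: "(N - 1) div 2 = M" "(N + 1) div 2 = M + 1" using N by simp_all
  have sg: "(- 1) ^ ((N + 3) div 2) = ((- 1) ^ M :: complex)" using N by simp
  \<comment> \<open>This choice turns \<open>n ^ N * x\<close> into
    \<open>(2 * n) ^ N * \<alpha>\<close>, so the second identity is the first one at this
    \<open>x\<close>.\<close>
  define x where "x = 2 ^ N * \<alpha>"
  have x: "x > 0" using 2 by (simp add: x_def)
  note ray = ray_alpha_beta[OF 2 N0, folded x_def]
  have pw: "s ^ N * x = (2 * s) ^ N * \<alpha>" for s by (simp add: x_def power_mult_distrib mult_ac)
  have L: "(\<Sum>n. exp (- a * (2 * real (Suc n)) ^ N * \<alpha>)
                          / (real (Suc n) * (1 - exp (- ((2 * real (Suc n)) ^ N) * \<alpha>)))) = lambert a N x"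
    unfolding lambert_def lambert_term_def minus_mult_left[symmetric] mult.assoc pw ..
  have c: "(\<Sum>n. complex_of_real (cos (2 * pi * real (Suc n) * a))
                    / (of_nat (Suc n) *
                       (exp (complex_of_real ((2 * real (Suc n)) powr (1 / real N) * \<beta>)
                             * exp (\<i> * complex_of_real (pi * real_of_int j / real N))) - 1)))
      = (\<Sum>m. cos_summand a N x j m)" for j
  proof -
    have e: "2 * of_real pi * (of_real (\<beta> / (2 * pi) * p) * e) = of_real (p * \<beta>) * e" for p :: real and e :: complex by simp
    show ?thesis unfolding cos_summand_def ray e ..
  qed
  have s: "(\<Sum>n. complex_of_real (sin (2 * pi * real (Suc n) * a) / real (Suc n)) *
                  (Ln (complex_of_real (\<beta> / (2 * pi) * (2 * real (Suc n)) powr (1 / real N))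
                       * exp (\<i> * complex_of_real (pi * real_of_int j / real N)))
                   - 1/2 * (Digamma (\<i> * complex_of_real (\<beta> / (2 * pi) * (2 * real (Suc n)) powr (1 / real N))
                                    * exp (\<i> * complex_of_real (pi * real_of_int j / real N)))
                            + Digamma (- \<i> * complex_of_real (\<beta> / (2 * pi) * (2 * real (Suc n)) powr (1 / real N))
                                    * exp (\<i> * complex_of_real (pi * real_of_int j / real N))))))
      = (\<Sum>m. sin_summand a N x j m)" for j
  proof -
    have h: "1/2 * Y = Y / 2" for Y :: complex by simp
    show ?thesis unfolding sin_summand_def ray mult.assoc[of _ _ "exp _"] h ..
  qed
  have tr: "R - S = complex_of_real R'" if "R = complex_of_real R'' + S" "R'' = R'" for R R' R'' S
    using that by simp
  show ?case
    unfolding D sg L c s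
    by (rule tr[OF lambert_transformation[OF assms(1,2) N x] rhs_alpha_beta[OF N 2, folded x_def]])
qed

end
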